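(* Let $K$ be any field, let $X$ be an uncountable set, and let $E_{\mathcal{F}(X)}$ be the graph of nonempty finite subsets of $X$ (defined in the context). Then the Leavitt path algebra $L_K(E_{\mathcal{F}(X)})$ is a prime, non-primitive, von Neumann regular ring. In particular, let $\{X_\alpha\mid\alpha\in\mathcal{A}\}$ be a collection of uncountable sets, each of different cardinality. Then the collection $\{L_{\mathbb{C}}(E_{\mathcal{F}(X_\alpha)})\mid\alpha\in\mathcal{A}\}$ consists of pairwise nonisomorphic, prime, non-primitive, von Neumann regular $\mathbb{C}$-algebras.
   Context: A (directed) graph $E=(E^0,E^1,r,s)$ consists of sets $E^0$ (vertices), $E^1$ (edges), of arbitrary cardinality, and functions $r,s:E^1\to E^0$ (range and source). For a nonempty set $X$, let $\mathcal{F}(X)$ be the collection of nonempty finite subsets of $X$. The graph $E_{\mathcal{F}(X)}$ has vertex set $\mathcal{F}(X)$ and edge set $\{e_{A,A'}\mid A,A'\in\mathcal{F}(X),\ A\subsetneq A'\}$, with $s(e_{A,A'})=A$ and $r(e_{A,A'})=A'$. The Leavitt path algebra $L_K(E)$ is the (associative, not necessarily unital) $K$-algebra generated by the set $\{v\mid v\in E^0\}\cup\{e,e^*\mid e\in E^1\}$ subject to the relations: (V) $vw=\delta_{v,w}v$ for $v,w\in E^0$; (E1) $s(e)e=er(e)=e$ for $e\in E^1$; (E2) $r(e)e^*=e^*s(e)=e^*$ for $e\in E^1$; (CK1) $e^*e'=\delta_{e,e'}r(e)$ for $e,e'\in E^1$; (CK2) $v=\sum_{\{e\in E^1\mid s(e)=v\}}ee^*$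 for every vertex $v$ with $1\le|s^{-1}(v)|<\infty$. A ring $R$ (possibly nonunital) is prime if the product of any two nonzero two-sided ideals is nonzero; left primitive if it admits a simple faithful left $R$-module; von Neumann regular if for each $a\in R$ there is $x\in R$ with $a=axa$. Since $L_K(E)\cong L_K(E)^{op}$, left and right primitivity coincide for $L_K(E)$, and one simply says primitive. *)

theory Defs
  imports
    Complex_Main
    "HOL-Library.Countable_Set"
    "HOL-Library.Equipollence"
    "HOL-Library.Poly_Mapping"
    "HOL-Algebra.QuotRing"
    "HOL-Algebra.Ideal_Product"
    "HOL-Algebra.Module"
    "Graph_Theory.Digraph"
begin

section \<open>Rings and algebras without unit\<close>

text \<open>
  Rings need not have a unit. The record types of HOL-Algebra are reused, but their field
  \<^term>\<open>one\<close> carries no meaning here: nothing below refers to it.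
\<close>

locale nonunital_ring = abelian_group R for R (structure) +
  assumes m_closed: "\<lbrakk>a \<in> carrier R; b \<in> carrier R\<rbrakk> \<Longrightarrow> a \<otimes> b \<in> carrier R"
    and m_assoc: "\<lbrakk>a \<in> carrier R; b \<in> carrier R; c \<in> carrier R\<rbrakk>
      \<Longrightarrow> (a \<otimes> b) \<otimes> c = a \<otimes> (b \<otimes> c)"
    and l_distr: "\<lbrakk>a \<in> carrier R; b \<in> carrier R; c \<in> carrier R\<rbrakk>
      \<Longrightarrow> (a \<oplus> b) \<otimes> c = a \<otimes> c \<oplus> b \<otimes> c"
    and r_distr: "\<lbrakk>a \<in> carrier R; b \<in> carrier R; c \<in> carrier R\<rbrakk>
      \<Longrightarrow> c \<otimes> (a \<oplus> b) = c \<otimes> a \<oplus> c \<otimes> b"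

locale nonunital_algebra = nonunital_ring A for A :: "('k::field, 'a) module" (structure) +
  assumes smult_closed: "x \<in> carrier A \<Longrightarrow> c \<odot> x \<in> carrier A"
    and smult_l_distr: "x \<in> carrier A \<Longrightarrow> (c + d) \<odot> x = c \<odot> x \<oplus> d \<odot> x"
    and smult_r_distr: "\<lbrakk>x \<in> carrier A; y \<in> carrier A\<rbrakk> \<Longrightarrow> c \<odot> (x \<oplus> y) = c \<odot> x \<oplus> c \<odot> y"
    and smult_smult: "x \<in> carrier A \<Longrightarrow> (c * d) \<odot> x = c \<odot> (d \<odot> x)"
    and smult_one: "x \<in> carrier A \<Longrightarrow> 1 \<odot> x = x"
    and smult_mult_left: "\<lbrakk>x \<in> carrier A; y \<in> carrier A\<rbrakk> \<Longrightarrow> (c \<odot> x) \<otimes> y = c \<odot> (x \<otimes> y)"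
    and smult_mult_right: "\<lbrakk>x \<in> carrier A; y \<in> carrier A\<rbrakk> \<Longrightarrow> x \<otimes> (c \<odot> y) = c \<odot> (x \<otimes> y)"

definition algebra_isomorphic ::
  "('k::field, 'a) module \<Rightarrow> ('k, 'b) module \<Rightarrow> bool" where
  "algebra_isomorphic A B \<longleftrightarrow> (\<exists>f. bij_betw f (carrier A) (carrier B) \<and>
     (\<forall>x\<in>carrier A. \<forall>y\<in>carrier A. f (x \<oplus>\<^bsub>A\<^esub> y) = f x \<oplus>\<^bsub>B\<^esub> f y) \<and>
     (\<forall>x\<in>carrier A. \<forall>y\<in>carrier A. f (x \<otimes>\<^bsub>A\<^esub> y) = f x \<otimes>\<^bsub>B\<^esub> f y) \<and>
     (\<forall>c. \<forall>x\<in>carrier A. f (c \<odot>\<^bsub>A\<^esub> x) = c \<odot>\<^bsub>B\<^esub> f x))"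

definition two_sided_ideal :: "'a set \<Rightarrow> ('a, 'b) ring_scheme \<Rightarrow> bool" where
  "two_sided_ideal I R \<longleftrightarrow> additive_subgroup I R \<and>
     (\<forall>a\<in>carrier R. \<forall>x\<in>I. a \<otimes>\<^bsub>R\<^esub> x \<in> I \<and> x \<otimes>\<^bsub>R\<^esub> a \<in> I)"

definition prime_ring :: "('a, 'b) ring_scheme \<Rightarrow> bool" where
  "prime_ring R \<longleftrightarrow> (\<forall>I J. two_sided_ideal I R \<and> I \<noteq> {\<zero>\<^bsub>R\<^esub>} \<and>
     two_sided_ideal J R \<and> J \<noteq> {\<zero>\<^bsub>R\<^esub>} \<longrightarrow> ideal_prod R I J \<noteq> {\<zero>\<^bsub>R\<^esub>})"

definition von_neumann_regular :: "('a, 'b) ring_scheme \<Rightarrow> bool" where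
  "von_neumann_regular R \<longleftrightarrow>
     (\<forall>a\<in>carrier R. \<exists>x\<in>carrier R. a = a \<otimes>\<^bsub>R\<^esub> x \<otimes>\<^bsub>R\<^esub> a)"

locale left_module = nonunital_ring R + M?: abelian_group M
    for R (structure) and M :: "('a, 'm) module" (structure) +
  assumes act_closed: "\<lbrakk>a \<in> carrier R; x \<in> carrier M\<rbrakk> \<Longrightarrow> a \<odot>\<^bsub>M\<^esub> x \<in> carrier M"
    and act_l_distr: "\<lbrakk>a \<in> carrier R; b \<in> carrier R; x \<in> carrier M\<rbrakk>
      \<Longrightarrow> (a \<oplus> b) \<odot>\<^bsub>M\<^esub> x = a \<odot>\<^bsub>M\<^esub> x \<oplus>\<^bsub>M\<^esub> b \<odot>\<^bsub>M\<^esub> x"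
    and act_r_distr: "\<lbrakk>a \<in> carrier R; x \<in> carrier M; y \<in> carrier M\<rbrakk>
      \<Longrightarrow> a \<odot>\<^bsub>M\<^esub> (x \<oplus>\<^bsub>M\<^esub> y) = a \<odot>\<^bsub>M\<^esub> x \<oplus>\<^bsub>M\<^esub> a \<odot>\<^bsub>M\<^esub> y"
    and act_assoc: "\<lbrakk>a \<in> carrier R; b \<in> carrier R; x \<in> carrier M\<rbrakk>
      \<Longrightarrow> (a \<otimes> b) \<odot>\<^bsub>M\<^esub> x = a \<odot>\<^bsub>M\<^esub> (b \<odot>\<^bsub>M\<^esub> x)"

text \<open>
  Over a ring without unit, simplicity of \<open>M\<close> includes \<open>RM \<noteq> 0\<close> (so \<open>M \<noteq> 0\<close>).
\<close>

definition simple_left_module :: "('a, 'b) ring_scheme \<Rightarrow> ('a, 'm) module \<Rightarrow> bool" where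
  "simple_left_module R M \<longleftrightarrow> left_module R M \<and>
     (\<exists>a\<in>carrier R. \<exists>x\<in>carrier M. a \<odot>\<^bsub>M\<^esub> x \<noteq> \<zero>\<^bsub>M\<^esub>) \<and>
     (\<forall>N. submodule N R M \<longrightarrow> N = {\<zero>\<^bsub>M\<^esub>} \<or> N = carrier M)"

definition faithful_left_module :: "('a, 'b) ring_scheme \<Rightarrow> ('a, 'm) module \<Rightarrow> bool" where
  "faithful_left_module R M \<longleftrightarrow> left_module R M \<and>
     (\<forall>a\<in>carrier R. (\<forall>x\<in>carrier M. a \<odot>\<^bsub>M\<^esub> x = \<zero>\<^bsub>M\<^esub>) \<longrightarrow> a = \<zero>\<^bsub>R\<^esub>)"

text \<open>
  HOL cannot quantify over the type in which a module lives, so that type is a parameter.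
  A theorem refuting \<open>left_primitive TYPE('m) R\<close> for a free type variable \<open>'m\<close>
  excludes simple faithful modules in every type.
\<close>

definition left_primitive :: "'m itself \<Rightarrow> ('a, 'b) ring_scheme \<Rightarrow> bool" where
  "left_primitive _ R \<longleftrightarrow>
     (\<exists>M :: ('a, 'm) module. simple_left_module R M \<and> faithful_left_module R M)"


section \<open>Algebras given by generators and relations\<close>

datatype 'g word = Word (letters: "'g list")

instantiation word :: (type) monoid_add
begin

definition zero_word :: "'a word" where "zero_word = Word []"

definition plus_word :: "'a word \<Rightarrow> 'a word \<Rightarrow> 'a word" where
  "plus_word u v = Word (letters u @ letters v)"

instance
  by standard (simp_all add: zero_word_def plus_word_def)

end

text \<open>
  With words added by concatenation, the product of \<^theory>\<open>HOL-Library.Poly_Mapping\<close> is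
  that of noncommutative polynomials. Excluding the empty word \<open>0\<close> gives the free algebra
  without unit.
\<close>

definition free_algebra :: "'g set \<Rightarrow> ('k::field, 'g word \<Rightarrow>\<^sub>0 'k) module" where
  "free_algebra G =
     \<lparr>carrier = {p. \<forall>w\<in>Poly_Mapping.keys p. w \<noteq> 0 \<and> set (letters w) \<subseteq> G},
      mult = (*), one = 0, zero = 0, add = (+),
      smult = (\<lambda>c p. Poly_Mapping.map ((*) c) p)\<rparr>"

definition gen :: "'g \<Rightarrow> 'g word \<Rightarrow>\<^sub>0 'k::field" where
  "gen g = Poly_Mapping.single (Word [g]) 1"

definition algebra_ideal :: "'a set \<Rightarrow> ('k::field, 'a) module \<Rightarrow> bool" where
  "algebra_ideal I A \<longleftrightarrow> two_sided_ideal I A \<and> (\<forall>c. \<forall>x\<in>I. c \<odot>\<^bsub>A\<^esub> x \<in> I)"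

definition algebra_ideal_generated :: "('k::field, 'a) module \<Rightarrow> 'a set \<Rightarrow> 'a set" where
  "algebra_ideal_generated A S = \<Inter>{I. algebra_ideal I A \<and> S \<subseteq> I}"

definition quotient_algebra ::
  "('k::field, 'a) module \<Rightarrow> 'a set \<Rightarrow> ('k, 'a set) module" where
  "quotient_algebra A I =
     \<lparr>carrier = a_rcosets\<^bsub>A\<^esub> I, mult = rcoset_mult A I, one = I, zero = I, add = set_add A,
      smult = (\<lambda>c C. \<Union>x\<in>C. I +>\<^bsub>A\<^esub> (c \<odot>\<^bsub>A\<^esub> x))\<rparr>"


section \<open>Leavitt path algebras\<close>

text \<open>
  Graphs are those of \<^theory>\<open>Graph_Theory.Digraph\<close>: the source map is \<^const>\<open>tail\<close>, the
  range map is \<^const>\<open>head\<close>. \<open>Ghost e\<close> stands for \<open>e\<^sup>*\<close>.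
\<close>

datatype ('v, 'e) lpa_generator = Vertex 'v | Edge 'e | Ghost 'e

definition lpa_generators :: "('v, 'e) pre_digraph \<Rightarrow> ('v, 'e) lpa_generator set" where
  "lpa_generators E = Vertex ` verts E \<union> Edge ` arcs E \<union> Ghost ` arcs E"

text \<open>Each relation \<open>l = r\<close> is recorded as the element \<open>l - r\<close>.\<close>

inductive_set lpa_relations ::
  "('v, 'e) pre_digraph \<Rightarrow> (('v, 'e) lpa_generator word \<Rightarrow>\<^sub>0 'k::field) set"
  for E :: "('v, 'e) pre_digraph" where
  V: "\<lbrakk>v \<in> verts E; w \<in> verts E\<rbrakk> \<Longrightarrow>
      gen (Vertex v) * gen (Vertex w) - (if v = w then gen (Vertex v) else 0) \<in> lpa_relations E"
| E1_source: "e \<in> arcs E \<Longrightarrow>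
      gen (Vertex (tail E e)) * gen (Edge e) - gen (Edge e) \<in> lpa_relations E"
| E1_range: "e \<in> arcs E \<Longrightarrow>
      gen (Edge e) * gen (Vertex (head E e)) - gen (Edge e) \<in> lpa_relations E"
| E2_range: "e \<in> arcs E \<Longrightarrow>
      gen (Vertex (head E e)) * gen (Ghost e) - gen (Ghost e) \<in> lpa_relations E"
| E2_source: "e \<in> arcs E \<Longrightarrow>
      gen (Ghost e) * gen (Vertex (tail E e)) - gen (Ghost e) \<in> lpa_relations E"
| CK1: "\<lbrakk>e \<in> arcs E; f \<in> arcs E\<rbrakk> \<Longrightarrow>
      gen (Ghost e) * gen (Edge f) - (if e = f then gen (Vertex (head E e)) else 0)
        \<in> lpa_relations E"
| CK2: "\<lbrakk>v \<in> verts E; finite {e \<in> arcs E. tail E e = v}; {e \<in> arcs E. tail E e = v} \<noteq> {}\<rbrakk> \<Longrightarrow>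
      gen (Vertex v) - (\<Sum>e\<in>{e \<in> arcs E. tail E e = v}. gen (Edge e) * gen (Ghost e))
        \<in> lpa_relations E"

definition leavitt_path_algebra ::
  "('v, 'e) pre_digraph \<Rightarrow> ('k::field, (('v, 'e) lpa_generator word \<Rightarrow>\<^sub>0 'k) set) module" where
  "leavitt_path_algebra E =
     (let F = free_algebra (lpa_generators E)
      in quotient_algebra F (algebra_ideal_generated F (lpa_relations E)))"


section \<open>The graph of nonempty finite subsets\<close>

definition finite_subset_graph :: "'x set \<Rightarrow> ('x set, 'x set \<times> 'x set) pre_digraph" where
  "finite_subset_graph X =
     (let V = {A. A \<subseteq> X \<and> finite A \<and> A \<noteq> {}}
      in \<lparr>verts = V, arcs = {(A, A'). A \<in> V \<and> A' \<in> V \<and> A \<subset> A'}, tail = fst, head = snd\<rparr>)"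

lemma wf_finite_subset_graph: "wf_digraph (finite_subset_graph X)"
  by unfold_locales (auto simp: finite_subset_graph_def Let_def)


section \<open>Leavitt path algebras are associative algebras\<close>

lemma free_algebra_nonunital_algebra:
  "nonunital_algebra (free_algebra G :: ('k::field, 'g word \<Rightarrow>\<^sub>0 'k) module)"
proof -
  let ?F = "free_algebra G :: ('k::field, 'g word \<Rightarrow>\<^sub>0 'k) module"
  define N where "N = {w :: 'g word. w \<noteq> 0 \<and> set (letters w) \<subseteq> G}"
  have C: "carrier ?F = {p. Poly_Mapping.keys p \<subseteq> N}" by (auto simp: free_algebra_def N_def)
  have N: "u + v \<in> N" if "u \<in> N" "v \<in> N" for u v
    using that by (auto simp: N_def plus_word_def zero_word_def word.expand)
  have mapmul: "Poly_Mapping.map ((*) c) p = Poly_Mapping.single 0 c * p" for c and p :: "'g word \<Rightarrow>\<^sub>0 'k"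
    by (simp add: mult_map_scale_conv_mult)
  have mapmul': "p * Poly_Mapping.single 0 c = Poly_Mapping.single 0 c * p" for c and p :: "'g word \<Rightarrow>\<^sub>0 'k"
  proof (induction p rule: update_induct)
    case (update f a b)
    have "Poly_Mapping.update a b f = f + Poly_Mapping.single a b"
      by (rule poly_mapping_eqI)
         (use update(1) in \<open>auto simp: lookup_update lookup_add lookup_single when_def in_keys_iff\<close>)
    then show ?case using update by (simp add: ring_distribs mult_single mult.commute)
  qed simp
  have km: "p * q \<in> carrier ?F" if "p \<in> carrier ?F" "q \<in> carrier ?F" for p q
    using that keys_mult[of p q] N unfolding C by blast
  have scalar: "Poly_Mapping.single 0 (c + d) = Poly_Mapping.single 0 c + (Poly_Mapping.single 0 d :: 'g word \<Rightarrow>\<^sub>0 'k)"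
    "Poly_Mapping.single 0 (c * d) = Poly_Mapping.single 0 c * (Poly_Mapping.single 0 d :: 'g word \<Rightarrow>\<^sub>0 'k)" for c d
    by (simp_all add: single_add mult_single)
  have ab: "abelian_group ?F"
  proof (rule abelian_groupI)
    fix x y assume "x \<in> carrier ?F" "y \<in> carrier ?F"
    then show "x \<oplus>\<^bsub>?F\<^esub> y \<in> carrier ?F"
      using Poly_Mapping.keys_add[of x y] by (auto simp: free_algebra_def)
  next
    fix x assume "x \<in> carrier ?F"
    then show "\<exists>y\<in>carrier ?F. y \<oplus>\<^bsub>?F\<^esub> x = \<zero>\<^bsub>?F\<^esub>"
      by (intro bexI[of _ "- x"]) (auto simp: free_algebra_def)
  qed (auto simp: free_algebra_def add.assoc add.commute)

  have smult_closed: "c \<odot>\<^bsub>?F\<^esub> x \<in> carrier ?F" if "x \<in> carrier ?F" for c x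
    using keys_mult[of "Poly_Mapping.single 0 c" x] that unfolding C
    by (auto simp: free_algebra_def mapmul split: if_splits)
  have smult_right: "x \<otimes>\<^bsub>?F\<^esub> (c \<odot>\<^bsub>?F\<^esub> y) = c \<odot>\<^bsub>?F\<^esub> (x \<otimes>\<^bsub>?F\<^esub> y)" for c x y
    using mapmul'[of x c] by (simp add: free_algebra_def mapmul flip: mult.assoc)
  have mult_closed: "x \<otimes>\<^bsub>?F\<^esub> y \<in> carrier ?F" if "x \<in> carrier ?F" "y \<in> carrier ?F" for x y
    using km[OF that] by (simp add: free_algebra_def)
  show ?thesis
    apply (rule nonunital_algebra.intro)
     apply (rule nonunital_ring.intro)
      apply (rule ab)
     apply (rule nonunital_ring_axioms.intro)
        apply (rule mult_closed, assumption+)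
       apply (simp_all add: free_algebra_def ring_distribs mult.assoc)[3]
    apply (rule nonunital_algebra_axioms.intro)
          apply (rule smult_closed, assumption)
         apply (simp add: free_algebra_def mapmul scalar distrib_right)
        apply (simp add: free_algebra_def mapmul distrib_left)
       apply (simp add: free_algebra_def mapmul scalar mult.assoc)
      apply (simp add: free_algebra_def mapmul)
     apply (simp add: free_algebra_def mapmul mult.assoc)
    apply (rule smult_right)
    done
qed

lemma algebra_ideal_algebra_ideal_generated:
  assumes "nonunital_algebra A" "S \<subseteq> carrier A"
  shows "algebra_ideal (algebra_ideal_generated A S) A" "S \<subseteq> algebra_ideal_generated A S"
proof -
  interpret nonunital_algebra A by fact
  have car: "algebra_ideal (carrier A) A"
    unfolding algebra_ideal_def two_sided_ideal_def
    by (auto intro!: additive_subgroup.intro simp: smult_closed m_closed)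
       (meson add.subgroup_self)
  let ?J = "{I. algebra_ideal I A \<and> S \<subseteq> I}"
  have "subgroup (\<Inter>?J) (add_monoid A)"
    by (rule add.subgroups_Inter) (use car assms in \<open>auto simp: algebra_ideal_def two_sided_ideal_def additive_subgroup_def\<close>)
  then show "algebra_ideal (algebra_ideal_generated A S) A"
    unfolding algebra_ideal_generated_def algebra_ideal_def two_sided_ideal_def additive_subgroup_def
    by auto
qed (auto simp: algebra_ideal_generated_def)

lemma quotient_algebra_nonunital_algebra:
  assumes "nonunital_algebra A" "algebra_ideal I A"
  shows "nonunital_algebra (quotient_algebra A I)"
proof -
  interpret nonunital_algebra A by fact
  interpret I: additive_subgroup I A using assms by (auto simp: algebra_ideal_def two_sided_ideal_def)
  interpret I: abelian_subgroup I A by (rule abelian_subgroupI3) unfold_locales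
  let ?Q = "quotient_algebra A I"
  have id: "a \<otimes>\<^bsub>A\<^esub> x \<in> I" "x \<otimes>\<^bsub>A\<^esub> a \<in> I" "c \<odot>\<^bsub>A\<^esub> x \<in> I" if "x \<in> I" "a \<in> carrier A" for a x c
    using assms that by (auto simp: algebra_ideal_def two_sided_ideal_def)
  have carr: "carrier ?Q = (\<lambda>x. I +>\<^bsub>A\<^esub> x) ` carrier A"
    by (auto simp: quotient_algebra_def A_RCOSETS_defs a_r_coset_def[symmetric])
  have mem: "y \<in> I +>\<^bsub>A\<^esub> x \<longleftrightarrow> (\<exists>h\<in>I. y = h \<oplus>\<^bsub>A\<^esub> x)" for x y by (auto simp: a_r_coset_def')
  have self: "x \<in> I +>\<^bsub>A\<^esub> x" if "x \<in> carrier A" for x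
    using I.a_rcos_self that by auto
  have abs: "I +>\<^bsub>A\<^esub> (h \<oplus>\<^bsub>A\<^esub> x) = I +>\<^bsub>A\<^esub> x" if "h \<in> I" "x \<in> carrier A" for h x
    using a_repr_independence[OF _ that(2) I.a_subgroup, of "h \<oplus>\<^bsub>A\<^esub> x"] mem[of "h \<oplus>\<^bsub>A\<^esub> x" x] that by force
  have hI: "h \<in> carrier A" if "h \<in> I" for h using that I.a_subset by auto
  have mul: "rcoset_mult A I (I +>\<^bsub>A\<^esub> x) (I +>\<^bsub>A\<^esub> y) = I +>\<^bsub>A\<^esub> (x \<otimes>\<^bsub>A\<^esub> y)"
    if xy: "x \<in> carrier A" "y \<in> carrier A" for x y
  proof -
    have "I +>\<^bsub>A\<^esub> (a \<otimes>\<^bsub>A\<^esub> b) = I +>\<^bsub>A\<^esub> (x \<otimes>\<^bsub>A\<^esub> y)" if ab: "a \<in> I +>\<^bsub>A\<^esub> x" "b \<in> I +>\<^bsub>A\<^esub> y" for a b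
    proof -
      obtain h k where hk: "h \<in> I" "k \<in> I" "a = h \<oplus>\<^bsub>A\<^esub> x" "b = k \<oplus>\<^bsub>A\<^esub> y" using ab mem by auto
      have "a \<otimes>\<^bsub>A\<^esub> b = (h \<otimes>\<^bsub>A\<^esub> k \<oplus>\<^bsub>A\<^esub> h \<otimes>\<^bsub>A\<^esub> y \<oplus>\<^bsub>A\<^esub> x \<otimes>\<^bsub>A\<^esub> k) \<oplus>\<^bsub>A\<^esub> x \<otimes>\<^bsub>A\<^esub> y"
        using hk xy hI by (simp add: l_distr r_distr m_closed a_ac)
      moreover have "h \<otimes>\<^bsub>A\<^esub> k \<oplus>\<^bsub>A\<^esub> h \<otimes>\<^bsub>A\<^esub> y \<oplus>\<^bsub>A\<^esub> x \<otimes>\<^bsub>A\<^esub> k \<in> I"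
        using hk xy hI id by auto
      ultimately show ?thesis using abs xy m_closed by metis
    qed
    then show ?thesis unfolding rcoset_mult_def using self xy by blast
  qed
  have sm: "(\<Union>z\<in>I +>\<^bsub>A\<^esub> x. I +>\<^bsub>A\<^esub> (c \<odot>\<^bsub>A\<^esub> z)) = I +>\<^bsub>A\<^esub> (c \<odot>\<^bsub>A\<^esub> x)" if x: "x \<in> carrier A" for c x
  proof -
    have "I +>\<^bsub>A\<^esub> (c \<odot>\<^bsub>A\<^esub> z) = I +>\<^bsub>A\<^esub> (c \<odot>\<^bsub>A\<^esub> x)" if zz: "z \<in> I +>\<^bsub>A\<^esub> x" for z
    proof -
      obtain h where h: "h \<in> I" "z = h \<oplus>\<^bsub>A\<^esub> x" using zz mem by auto
      show ?thesis using h x hI id abs smult_r_distr smult_closed by simp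
    qed
    then show ?thesis using self x by blast
  qed
  have ad: "(I +>\<^bsub>A\<^esub> x) <+>\<^bsub>A\<^esub> (I +>\<^bsub>A\<^esub> y) = I +>\<^bsub>A\<^esub> (x \<oplus>\<^bsub>A\<^esub> y)"
    if "x \<in> carrier A" "y \<in> carrier A" for x y using I.a_rcos_sum that by auto
  have I0: "I +>\<^bsub>A\<^esub> \<zero>\<^bsub>A\<^esub> = I" using a_coset_join2[OF zero_closed I.a_subgroup I.zero_closed] .
  have IQ: "I \<in> (\<lambda>x. I +>\<^bsub>A\<^esub> x) ` carrier A" by (metis I0 imageI zero_closed)
  have ab: "abelian_group ?Q"
  proof (rule abelian_groupI; unfold carr)
    fix x assume "x \<in> (\<lambda>x. I +>\<^bsub>A\<^esub> x) ` carrier A"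
    then obtain x' where x': "x' \<in> carrier A" "x = I +>\<^bsub>A\<^esub> x'" by auto
    show "\<zero>\<^bsub>?Q\<^esub> \<oplus>\<^bsub>?Q\<^esub> x = x"
      using ad[of "\<zero>\<^bsub>A\<^esub>" x'] x' by (simp add: quotient_algebra_def I0)
    show "\<exists>y\<in>(\<lambda>x. I +>\<^bsub>A\<^esub> x) ` carrier A. y \<oplus>\<^bsub>?Q\<^esub> x = \<zero>\<^bsub>?Q\<^esub>"
      using ad[of "\<ominus>\<^bsub>A\<^esub> x'" x'] x' by (auto simp: quotient_algebra_def I0 l_neg)
    fix y assume "y \<in> (\<lambda>x. I +>\<^bsub>A\<^esub> x) ` carrier A"
    then obtain y' where y': "y' \<in> carrier A" "y = I +>\<^bsub>A\<^esub> y'" by auto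
    show "x \<oplus>\<^bsub>?Q\<^esub> y \<in> (\<lambda>x. I +>\<^bsub>A\<^esub> x) ` carrier A"
      using x' y' by (simp add: quotient_algebra_def ad)
    show "x \<oplus>\<^bsub>?Q\<^esub> y = y \<oplus>\<^bsub>?Q\<^esub> x"
      using x' y' a_comm[of x' y'] by (simp add: quotient_algebra_def ad)
    fix z assume "z \<in> (\<lambda>x. I +>\<^bsub>A\<^esub> x) ` carrier A"
    then show "x \<oplus>\<^bsub>?Q\<^esub> y \<oplus>\<^bsub>?Q\<^esub> z = x \<oplus>\<^bsub>?Q\<^esub> (y \<oplus>\<^bsub>?Q\<^esub> z)"
      using x' y' by (auto simp: quotient_algebra_def ad a_assoc)
  qed (use IQ in \<open>simp add: quotient_algebra_def\<close>)
  have ops: "(I +>\<^bsub>A\<^esub> x) \<otimes>\<^bsub>?Q\<^esub> (I +>\<^bsub>A\<^esub> y) = I +>\<^bsub>A\<^esub> (x \<otimes>\<^bsub>A\<^esub> y)"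
    "(I +>\<^bsub>A\<^esub> x) \<oplus>\<^bsub>?Q\<^esub> (I +>\<^bsub>A\<^esub> y) = I +>\<^bsub>A\<^esub> (x \<oplus>\<^bsub>A\<^esub> y)"
    if "x \<in> carrier A" "y \<in> carrier A" for x y
    using that by (simp_all add: quotient_algebra_def mul ad)
  have smult_coset: "c \<odot>\<^bsub>?Q\<^esub> (I +>\<^bsub>A\<^esub> x) = I +>\<^bsub>A\<^esub> (c \<odot>\<^bsub>A\<^esub> x)" if "x \<in> carrier A" for x c
    using that by (simp add: quotient_algebra_def sm)
  have rep: "\<exists>x\<in>carrier A. X = I +>\<^bsub>A\<^esub> x" if "X \<in> carrier ?Q" for X
    using that carr by blast
  show ?thesis
  proof (rule nonunital_algebra.intro; (rule nonunital_ring.intro nonunital_algebra_axioms.intro)?)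
    show "abelian_group ?Q" by (rule ab)
    show "nonunital_ring_axioms ?Q"
    proof (rule nonunital_ring_axioms.intro)
      fix X Y assume "X \<in> carrier ?Q" "Y \<in> carrier ?Q"
      then obtain x y where xy: "x \<in> carrier A" "X = I +>\<^bsub>A\<^esub> x" "y \<in> carrier A" "Y = I +>\<^bsub>A\<^esub> y"
        using rep by metis
      show "X \<otimes>\<^bsub>?Q\<^esub> Y \<in> carrier ?Q"
        using xy by (simp add: ops carr m_closed)
      fix Z assume "Z \<in> carrier ?Q"
      then obtain z where z: "z \<in> carrier A" "Z = I +>\<^bsub>A\<^esub> z" using rep by metis
      show "X \<otimes>\<^bsub>?Q\<^esub> Y \<otimes>\<^bsub>?Q\<^esub> Z = X \<otimes>\<^bsub>?Q\<^esub> (Y \<otimes>\<^bsub>?Q\<^esub> Z)"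
        using xy z by (simp add: ops m_closed m_assoc)
      show "(X \<oplus>\<^bsub>?Q\<^esub> Y) \<otimes>\<^bsub>?Q\<^esub> Z = X \<otimes>\<^bsub>?Q\<^esub> Z \<oplus>\<^bsub>?Q\<^esub> Y \<otimes>\<^bsub>?Q\<^esub> Z"
        "Z \<otimes>\<^bsub>?Q\<^esub> (X \<oplus>\<^bsub>?Q\<^esub> Y) = Z \<otimes>\<^bsub>?Q\<^esub> X \<oplus>\<^bsub>?Q\<^esub> Z \<otimes>\<^bsub>?Q\<^esub> Y"
        using xy z by (simp_all add: ops m_closed l_distr r_distr)
    qed
  next
    fix X c d assume "X \<in> carrier ?Q"
    then obtain x where x: "x \<in> carrier A" "X = I +>\<^bsub>A\<^esub> x" using rep by metis
    show "c \<odot>\<^bsub>?Q\<^esub> X \<in> carrier ?Q"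
      using x by (simp add: smult_coset carr smult_closed)
    show "(c + d) \<odot>\<^bsub>?Q\<^esub> X = c \<odot>\<^bsub>?Q\<^esub> X \<oplus>\<^bsub>?Q\<^esub> d \<odot>\<^bsub>?Q\<^esub> X"
      "(c * d) \<odot>\<^bsub>?Q\<^esub> X = c \<odot>\<^bsub>?Q\<^esub> (d \<odot>\<^bsub>?Q\<^esub> X)" "1 \<odot>\<^bsub>?Q\<^esub> X = X"
      using x by (simp_all add: ops smult_coset smult_closed smult_l_distr smult_smult smult_one)
    fix Y assume "Y \<in> carrier ?Q"
    then obtain y where y: "y \<in> carrier A" "Y = I +>\<^bsub>A\<^esub> y" using rep by metis
    show "c \<odot>\<^bsub>?Q\<^esub> (X \<oplus>\<^bsub>?Q\<^esub> Y) = c \<odot>\<^bsub>?Q\<^esub> X \<oplus>\<^bsub>?Q\<^esub> c \<odot>\<^bsub>?Q\<^esub> Y"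
      "c \<odot>\<^bsub>?Q\<^esub> X \<otimes>\<^bsub>?Q\<^esub> Y = c \<odot>\<^bsub>?Q\<^esub> (X \<otimes>\<^bsub>?Q\<^esub> Y)"
      "X \<otimes>\<^bsub>?Q\<^esub> (c \<odot>\<^bsub>?Q\<^esub> Y) = c \<odot>\<^bsub>?Q\<^esub> (X \<otimes>\<^bsub>?Q\<^esub> Y)"
      using x y by (simp_all add: ops smult_coset m_closed smult_closed smult_r_distr smult_mult_left smult_mult_right)
  qed
qed

lemma gen_in_free_algebra: "g \<in> G \<Longrightarrow> gen g \<in> carrier (free_algebra G)"
  by (auto simp: free_algebra_def gen_def zero_word_def)

lemma lpa_relations_subset:
  fixes E :: "('v, 'e) pre_digraph"
  assumes "wf_digraph E"
  shows "lpa_relations E \<subseteq> carrier (free_algebra (lpa_generators E) :: ('k::field,_) module)"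
proof -
  let ?F = "free_algebra (lpa_generators E) :: ('k::field,_) module"
  interpret wf_digraph E by fact
  interpret F: nonunital_algebra ?F by (rule free_algebra_nonunital_algebra)
  have m: "p * q \<in> carrier ?F" if "p \<in> carrier ?F" "q \<in> carrier ?F" for p q
    using F.m_closed[OF that] by (simp add: free_algebra_def)
  have d: "p - q \<in> carrier ?F" if "p \<in> carrier ?F" "q \<in> carrier ?F" for p q
    using that keys_diff[of p q] by (auto simp: free_algebra_def)
  have z: "0 \<in> carrier ?F" by (auto simp: free_algebra_def)
  have s: "sum f B \<in> carrier ?F" if "\<And>b. b \<in> B \<Longrightarrow> f b \<in> carrier ?F" for f and B :: "'e set"
    using that
  proof (induction B rule: infinite_finite_induct)
    case (insert b B)
    have "f b \<oplus>\<^bsub>?F\<^esub> sum f B \<in> carrier ?F"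
      by (rule F.a_closed) (use insert in auto)
    then show ?case using insert.hyps by (simp add: free_algebra_def)
  qed (simp_all add: z)
  have g: "gen (Vertex v) \<in> carrier ?F" if "v \<in> verts E" for v using that by (auto intro!: gen_in_free_algebra simp: lpa_generators_def)
  have g2: "gen (Edge e) \<in> carrier ?F" "gen (Ghost e) \<in> carrier ?F" if "e \<in> arcs E" for e using that by (auto intro!: gen_in_free_algebra simp: lpa_generators_def)
  show ?thesis
  proof
    fix p :: "('v, 'e) lpa_generator word \<Rightarrow>\<^sub>0 'k"
    assume "p \<in> lpa_relations E"
    then show "p \<in> carrier ?F"
    proof cases
      case (V v w)
      then show ?thesis by (cases "v = w") (simp_all only: refl if_True if_False d m z g)
    next
      case (CK1 e f)
      then show ?thesis by (cases "e = f") (simp_all only: refl if_True if_False d m z g g2 head_in_verts)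
    next
      case (CK2 v)
      show ?thesis unfolding CK2(1) by (intro d s m g g2) (use CK2 in auto)
    qed (simp_all only: d m g g2 head_in_verts tail_in_verts)
  qed
qed

lemma leavitt_path_algebra_nonunital_algebra:
  "wf_digraph E \<Longrightarrow> nonunital_algebra (leavitt_path_algebra E)"
  unfolding leavitt_path_algebra_def Let_def
  by (intro quotient_algebra_nonunital_algebra free_algebra_nonunital_algebra
      algebra_ideal_algebra_ideal_generated lpa_relations_subset)

end

theory Submission
  imports Defs "HOL-Library.Sublist"
begin

text \<open>
  Every vertex of the graph emits infinitely many edges, so relation (CK2) is void and the algebra
  has the basis of all monomials \<open>\<alpha>\<beta>\<^sup>*\<close>, where \<open>\<alpha>\<close> and \<open>\<beta>\<close> are paths with the same range. This is
  established by a faithful representation by linear operators in which \<open>\<alpha>\<beta>\<^sup>*\<close> replaces the prefix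
  \<open>\<beta>\<close> of a word by \<open>\<alpha>\<close> (\<open>leavitt_path_algebra_embedding\<close>); everything else is computed with these
  operators.

  \<^item> Prime: for a nonzero element and a pair of paths \<open>p\<close>, \<open>q\<close> of minimal total length in its support,
    multiplication by \<open>(pf)\<^sup>*\<close> and \<open>qf\<close>, for an edge \<open>f\<close> into a large enough set \<open>B\<close>, yields a nonzero
    multiple of the vertex \<open>B\<close> (\<open>swap_corner_in_path_ops\<close>). Two nonzero ideals thus contain a common
    vertex, a nonzero idempotent.

  \<^item> Von Neumann regular: the graph is acyclic, and the monomials inside a finite set of vertices span
    a finite direct product of matrix algebras, in which Gaussian elimination produces quasi-inverses
    (\<open>path_ops_regular\<close>).

  \<^item> Not primitive: let \<open>M\<close> be simple and faithful and \<open>m \<in> M\<close> nonzero. For each \<open>x \<in> X\<close> the ideal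
    generated by the vertex \<open>{x}\<close> contains an \<open>a x\<close> with \<open>(a x) m = m\<close> (\<open>ideal_fixes_vector\<close>), so no
    product \<open>(a x) (a y)\<close> vanishes. The finitely many paths in \<open>a x\<close> end in sets containing \<open>x\<close>, and for
    uncountable \<open>X\<close> some \<open>x\<close> and \<open>y\<close> are such that no path in \<open>a x\<close> is comparable with a path in \<open>a y\<close>
    (\<open>ops_above_product_zero\<close>), a contradiction.

  \<^item> Not isomorphic: the vertices \<open>{x}\<close> are orthogonal nonzero idempotents, and only finitely many of
    these fit into the span of the monomials inside a finite set of vertices, which has finite
    dimension. Since an infinite set has as many finite subsets as elements, an isomorphism between
    the algebras of \<open>X\<close> and \<open>Y\<close> forces \<open>X\<close> and \<open>Y\<close> to have the same cardinality
    (\<open>isomorphic_imp_lepoll\<close>).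
\<close>

section \<open>Linear operators on a function space\<close>

text \<open>
  The \<open>K\<close>-linear endomorphisms of the space of all functions \<open>'b \<Rightarrow> 'k\<close>, with composition as
  product. Making them a type gives the ring and vector space automation for products of paths.
\<close>

typedef (overloaded) ('b, 'k::field) op =
  "{f :: ('b \<Rightarrow> 'k) \<Rightarrow> ('b \<Rightarrow> 'k).
     (\<forall>x y. f (\<lambda>t. x t + y t) = (\<lambda>t. f x t + f y t)) \<and>
     (\<forall>c x. f (\<lambda>t. c * x t) = (\<lambda>t. c * f x t))}"
  morphisms app Op
  by (rule exI[of _ "\<lambda>x. x"]) simp

setup_lifting type_definition_op

lemma op_eqI: "(\<And>x t. app S x t = app T x t) \<Longrightarrow> S = T"
  by (simp add: app_inject[symmetric] fun_eq_iff)

instantiation op :: (type, field) ring_1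
begin

lift_definition zero_op :: "('a, 'b) op" is "\<lambda>x t. 0" by simp
lift_definition one_op :: "('a, 'b) op" is "\<lambda>x. x" by simp
lift_definition plus_op :: "('a, 'b) op \<Rightarrow> ('a, 'b) op \<Rightarrow> ('a, 'b) op" is "\<lambda>S T x t. S x t + T x t"
  by (auto simp: algebra_simps)
lift_definition uminus_op :: "('a, 'b) op \<Rightarrow> ('a, 'b) op" is "\<lambda>S x t. - S x t"
  by (auto simp: algebra_simps)
lift_definition minus_op :: "('a, 'b) op \<Rightarrow> ('a, 'b) op \<Rightarrow> ('a, 'b) op" is "\<lambda>S T x t. S x t - T x t"
  by (auto simp: algebra_simps)
lift_definition times_op :: "('a, 'b) op \<Rightarrow> ('a, 'b) op \<Rightarrow> ('a, 'b) op" is "\<lambda>S T x. S (T x)"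
  by auto

instance
proof
  fix a b c :: "('a, 'b) op"
  show "a * b * c = a * (b * c)" by transfer simp
  show "1 * a = a" "a * 1 = a" by (transfer; simp)+
  show "a + b + c = a + (b + c)" "a + b = b + a" "0 + a = a" "- a + a = 0" "a - b = a + - b"
    by (transfer; simp add: algebra_simps)+
  show "(a + b) * c = a * c + b * c" by transfer simp
  show "a * (b + c) = a * b + a * c" by transfer simp
  show "(0 :: ('a, 'b) op) \<noteq> 1"
    by transfer (auto simp: fun_eq_iff intro!: exI[of _ "\<lambda>_. 1"])
qed

end

text \<open>
  The scalar action; with it the operators form a \<open>K\<close>-algebra.
\<close>

lift_definition smul :: "'k::field \<Rightarrow> ('b, 'k) op \<Rightarrow> ('b, 'k) op" is "\<lambda>c S x t. c * S x t"
  by (auto simp: algebra_simps)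

global_interpretation op: vector_space smul
  by standard (transfer; simp add: algebra_simps)+

lemma smul_mult: "smul c S * T = smul c (S * T)"
  by transfer simp

lemma mult_smul: "S * smul c T = smul c (S * T)"
  by transfer simp

lemma mult_span_span:
  assumes "a \<in> op.span A" "b \<in> op.span B" "\<And>x y. x \<in> A \<Longrightarrow> y \<in> B \<Longrightarrow> x * y \<in> op.span D"
  shows "a * b \<in> op.span D"
  using assms(1)
proof (induction rule: op.span_induct_alt)
  case base
  then show ?case by (simp add: op.span_zero)
next
  case (step c x y)
  have "x * b \<in> op.span D"
    using assms(2)
  proof (induction rule: op.span_induct_alt)
    case base
    then show ?case by (simp add: op.span_zero)
  next
    case step': (step c z w)
    then show ?case
      using assms(3)[OF step(1)] by (simp add: distrib_left mult_smul op.span_add op.span_scale)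
  qed
  then show ?case
    using step by (simp add: distrib_right smul_mult op.span_add op.span_scale)
qed

text \<open>
  Elements of the span of an indexed family as sums over indices; the family need not be injective.
\<close>

lemma span_indexed:
  assumes "a \<in> op.span (f ` V)"
  obtains S c where "finite S" "S \<subseteq> V" "\<And>i. i \<in> S \<Longrightarrow> c i \<noteq> 0" "a = (\<Sum>i\<in>S. smul (c i) (f i))"
proof -
  have "\<exists>S c. finite S \<and> S \<subseteq> V \<and> a = (\<Sum>i\<in>S. smul (c i) (f i))"
    using assms
  proof (induction rule: op.span_induct_alt)
    case base
    show ?case by (rule exI[of _ "{}"]) simp
  next
    case (step k x y)
    then obtain S c i where h: "finite S" "S \<subseteq> V" "y = (\<Sum>i\<in>S. smul (c i) (f i))" "i \<in> V" "x = f i"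
      by blast
    define c' where "c' = (\<lambda>j. (if j = i then k else 0) + (if j \<in> S then c j else 0))"
    have "smul k x + y = (\<Sum>j\<in>insert i S. smul (if j = i then k else 0) (f j))
        + (\<Sum>j\<in>insert i S. smul (if j \<in> S then c j else 0) (f j))"
    proof -
      have "(\<Sum>j\<in>insert i S. smul (if j = i then k else 0) (f j)) = (\<Sum>j\<in>insert i S. if j = i then smul k (f j) else 0)"
        by (rule sum.cong) auto
      moreover have "(\<Sum>j\<in>insert i S. smul (if j \<in> S then c j else 0) (f j)) = y"
        unfolding h(3) by (rule sum.mono_neutral_cong_right) (use h in auto)
      ultimately show ?thesis using h by simp
    qed
    also have "\<dots> = (\<Sum>j\<in>insert i S. smul (c' j) (f j))"
      by (simp add: c'_def op.scale_left_distrib sum.distrib)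
    finally show ?case using h by (intro exI[of _ "insert i S"] exI[of _ c']) auto
  qed
  then obtain S c where h: "finite S" "S \<subseteq> V" "a = (\<Sum>i\<in>S. smul (c i) (f i))" by blast
  have "a = (\<Sum>i\<in>{i \<in> S. c i \<noteq> 0}. smul (c i) (f i))"
    unfolding h(3) by (rule sum.mono_neutral_right) (use h in auto)
  then show ?thesis
    using h(1,2) by (intro that[of "{i \<in> S. c i \<noteq> 0}" c]) auto
qed


section \<open>Partial prefix replacements\<close>

text \<open>
  The operator \<open>swap \<alpha> \<beta>\<close> represents the monomial \<open>\<alpha>\<beta>\<^sup>*\<close>. On the indicator function of a word it
  replaces a prefix \<open>\<beta>\<close> by \<open>\<alpha>\<close> and kills the words without that prefix. Since paths in a graph
  without parallel edges are determined by their vertices, words are lists of vertices, and the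
  trivial path at \<open>v\<close> is \<open>[v]\<close>. A path and its continuation then share one vertex, which is why
  \<open>\<alpha>\<close> and \<open>\<beta>\<close> are later required to be nonempty with equal last vertex.
\<close>

lift_definition swap :: "'v list \<Rightarrow> 'v list \<Rightarrow> ('v list, 'k::field) op" is
  "\<lambda>\<alpha> \<beta> x t. if prefix \<alpha> t then x (\<beta> @ drop (length \<alpha>) t) else 0"
  by (auto simp: fun_eq_iff)

lemma app_swap: "app (swap \<alpha> \<beta>) x t = (if prefix \<alpha> t then x (\<beta> @ drop (length \<alpha>) t) else 0)"
  by transfer simp

lemma app_mult: "app (S * T) x = app S (app T x)"
  by transfer simp

lemma app_zero: "app 0 x t = 0"
  by transfer simp

lemma swap_mult_left: "swap \<alpha> \<beta> * swap (\<beta> @ u) \<delta> = swap (\<alpha> @ u) \<delta>"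
proof (rule op_eqI)
  fix x t
  show "app (swap \<alpha> \<beta> * swap (\<beta> @ u) \<delta>) x t = app (swap (\<alpha> @ u) \<delta>) x t"
  proof (cases "prefix \<alpha> t")
    case True
    then obtain s where "t = \<alpha> @ s" by (rule prefixE)
    then show ?thesis by (simp add: app_mult app_swap)
  next
    case False
    then show ?thesis by (auto simp: app_mult app_swap dest: append_prefixD)
  qed
qed

lemma swap_mult_right: "swap \<alpha> (\<gamma> @ u) * swap \<gamma> \<delta> = swap \<alpha> (\<delta> @ u)"
  by (rule op_eqI) (simp add: app_mult app_swap)

lemma swap_mult_same: "swap \<alpha> \<beta> * swap \<beta> \<delta> = swap \<alpha> \<delta>"
  using swap_mult_left[of \<alpha> \<beta> "[]" \<delta>] by simp

lemma swap_mult_zero: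
  assumes "\<not> prefix \<beta> \<gamma>" "\<not> prefix \<gamma> \<beta>"
  shows "swap \<alpha> \<beta> * swap \<gamma> \<delta> = 0"
proof (rule op_eqI)
  fix x t
  show "app (swap \<alpha> \<beta> * swap \<gamma> \<delta>) x t = app 0 x t"
    using assms prefix_same_cases[of \<beta> "\<beta> @ drop (length \<alpha>) t" \<gamma>] by (auto simp: app_mult app_swap app_zero)
qed

lemma swap_nonzero: "swap \<alpha> \<beta> \<noteq> (0 :: ('v list, 'k::field) op)"
proof
  assume "swap \<alpha> \<beta> = (0 :: ('v list, 'k) op)"
  then have "app (swap \<alpha> \<beta>) (\<lambda>_. 1 :: 'k) \<alpha> = app 0 (\<lambda>_. 1) \<alpha>" by simp
  then show False by (simp add: app_swap app_zero)
qed

text \<open>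
  Multiplying by a letter \<open>f\<close> that occurs nowhere else forces both prefixes to match.
\<close>

lemma swap_corner:
  assumes f: "f \<notin> set p" "f \<notin> set q" "f \<notin> set \<alpha>" "f \<notin> set \<beta>"
  shows "swap [f] (p @ [f]) * swap \<alpha> \<beta> * swap (q @ [f]) [f] =
    (if \<exists>u. p = \<alpha> @ u \<and> q = \<beta> @ u then swap [f] [f] else (0 :: ('v list, 'k::field) op))"
proof (cases "prefix \<alpha> p")
  case True
  then obtain u where u: "p = \<alpha> @ u" by (auto simp: prefix_def)
  have e: "swap [f] (p @ [f]) * swap \<alpha> \<beta> = (swap [f] (\<beta> @ u @ [f]) :: ('v list, 'k) op)"
    using swap_mult_right[of "[f]" \<alpha> "u @ [f]" \<beta>] u by simp
  show ?thesis
  proof (cases "q = \<beta> @ u")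
    case True
    then show ?thesis using e u by (simp add: swap_mult_same[of _ "\<beta> @ u @ [f]"])
  next
    case False
    have "x = y" if "prefix (x @ [f]) (y @ [f])" "f \<notin> set x" "f \<notin> set y" for x y :: "'v list"
      using that by (auto simp: prefix_snoc dest: set_mono_prefix)
    then have "\<not> prefix (\<beta> @ u @ [f]) (q @ [f])" "\<not> prefix (q @ [f]) (\<beta> @ u @ [f])"
      using f u False by (metis append.assoc set_append Un_iff)+
    then show ?thesis using e u False by (simp add: swap_mult_zero)
  qed
next
  case False
  have "\<not> prefix \<alpha> (p @ [f])" "\<not> prefix (p @ [f]) \<alpha>"
    using False f by (auto simp: prefix_snoc dest: set_mono_prefix)
  then show ?thesis using False by (auto simp: swap_mult_zero)
qed

text \<open>
  For a linear combination of the operators \<open>swap \<alpha> \<beta>\<close>, choose a pair \<open>(p, q)\<close> of minimal total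
  length in its support: no other pair of the support is of the form \<open>(\<alpha>, \<beta>)\<close> with
  \<open>p = \<alpha> u\<close> and \<open>q = \<beta> u\<close>, so every fresh letter isolates the coefficient of \<open>(p, q)\<close>. This gives
  linear independence, and also vertices in nonzero ideals.
\<close>

lemma swap_sum_corner:
  fixes c :: "'v list \<times> 'v list \<Rightarrow> 'k::field"
  assumes "finite S" "S \<noteq> {}"
  obtains p q where "(p, q) \<in> S"
    "\<And>f. (\<And>\<alpha> \<beta>. (\<alpha>, \<beta>) \<in> S \<Longrightarrow> f \<notin> set \<alpha> \<union> set \<beta>) \<Longrightarrow>
       swap [f] (p @ [f]) * (\<Sum>(\<alpha>, \<beta>)\<in>S. smul (c (\<alpha>, \<beta>)) (swap \<alpha> \<beta>)) * swap (q @ [f]) [f]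
         = smul (c (p, q)) (swap [f] [f])"
proof -
  obtain p q where pq: "(p, q) \<in> S"
    and min: "\<And>\<alpha> \<beta>. (\<alpha>, \<beta>) \<in> S \<Longrightarrow> length p + length q \<le> length \<alpha> + length \<beta>"
    using ex_min_if_finite[of "(\<lambda>(\<alpha>, \<beta>). length \<alpha> + length \<beta>) ` S"] assms
    by (fastforce simp: not_less)
  have "swap [f] (p @ [f]) * (\<Sum>(\<alpha>, \<beta>)\<in>S. smul (c (\<alpha>, \<beta>)) (swap \<alpha> \<beta>)) * swap (q @ [f]) [f]
         = smul (c (p, q)) (swap [f] [f])"
    if f: "\<And>\<alpha> \<beta>. (\<alpha>, \<beta>) \<in> S \<Longrightarrow> f \<notin> set \<alpha> \<union> set \<beta>" for f
  proof -
    have "swap [f] (p @ [f]) * swap \<alpha> \<beta> * swap (q @ [f]) [f] = (if (\<alpha>, \<beta>) = (p, q) then swap [f] [f] else (0 :: (_, 'k) op))"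
      if "(\<alpha>, \<beta>) \<in> S" for \<alpha> \<beta>
      using swap_corner[of f p q \<alpha> \<beta>] f[OF that] f[OF pq] min[OF that] by (auto split: if_splits)
    then have "(\<Sum>(\<alpha>, \<beta>)\<in>S. smul (c (\<alpha>, \<beta>)) (swap [f] (p @ [f]) * swap \<alpha> \<beta> * swap (q @ [f]) [f]))
       = (\<Sum>i\<in>S. if i = (p, q) then smul (c (p, q)) (swap [f] [f]) else 0)"
      by (intro sum.cong refl) (auto split: if_splits)
    also have "\<dots> = smul (c (p, q)) (swap [f] [f])"
      using assms pq by simp
    finally show ?thesis
      by (simp add: sum_distrib_left sum_distrib_right case_prod_unfold mult_smul smul_mult)
  qed
  with pq that show ?thesis by blast
qed


section \<open>Embedding a quotient algebra\<close>

lemma quotient_algebra_embedding: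
  fixes A :: "('k::field, 'a) module" and \<phi> :: "'a \<Rightarrow> ('b, 'k) op"
  assumes "nonunital_algebra A" "algebra_ideal I A"
    and add: "\<And>x y. x \<in> carrier A \<Longrightarrow> y \<in> carrier A \<Longrightarrow> \<phi> (x \<oplus>\<^bsub>A\<^esub> y) = \<phi> x + \<phi> y"
    and mult: "\<And>x y. x \<in> carrier A \<Longrightarrow> y \<in> carrier A \<Longrightarrow> \<phi> (x \<otimes>\<^bsub>A\<^esub> y) = \<phi> x * \<phi> y"
    and smult: "\<And>c x. x \<in> carrier A \<Longrightarrow> \<phi> (c \<odot>\<^bsub>A\<^esub> x) = smul c (\<phi> x)"
    and ker: "\<And>x. x \<in> carrier A \<Longrightarrow> \<phi> x = 0 \<longleftrightarrow> x \<in> I"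
  obtains h where "bij_betw h (carrier (quotient_algebra A I)) (\<phi> ` carrier A)"
    "\<And>x y. x \<in> carrier (quotient_algebra A I) \<Longrightarrow> y \<in> carrier (quotient_algebra A I) \<Longrightarrow>
       h (x \<oplus>\<^bsub>quotient_algebra A I\<^esub> y) = h x + h y"
    "\<And>x y. x \<in> carrier (quotient_algebra A I) \<Longrightarrow> y \<in> carrier (quotient_algebra A I) \<Longrightarrow>
       h (x \<otimes>\<^bsub>quotient_algebra A I\<^esub> y) = h x * h y"
    "\<And>c x. x \<in> carrier (quotient_algebra A I) \<Longrightarrow>
       h (c \<odot>\<^bsub>quotient_algebra A I\<^esub> x) = smul c (h x)"
proof -
  let ?Q = "quotient_algebra A I"
  interpret nonunital_algebra A by fact
  interpret Q: nonunital_algebra ?Q using assms(1,2) by (rule quotient_algebra_nonunital_algebra)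
  interpret I: additive_subgroup I A using assms(2) by (auto simp: algebra_ideal_def two_sided_ideal_def)
  interpret I: abelian_subgroup I A by (rule abelian_subgroupI3) unfold_locales
  have car: "carrier ?Q = (\<lambda>x. I +>\<^bsub>A\<^esub> x) ` carrier A"
    by (auto simp: quotient_algebra_def A_RCOSETS_defs a_r_coset_def[symmetric])
  have sub: "C \<subseteq> carrier A" if "C \<in> carrier ?Q" for C
    using that I.a_rcosets_carrier by (auto simp: quotient_algebra_def)
  have same: "\<phi> y = \<phi> z" if C: "C \<in> carrier ?Q" and yz: "y \<in> C" "z \<in> C" for C y z
  proof -
    obtain x where x: "x \<in> carrier A" "C = I +>\<^bsub>A\<^esub> x" using C car by auto
    have "\<phi> w = \<phi> x" if w: "w \<in> C" for w
    proof -
      obtain i where i: "i \<in> I" "w = i \<oplus>\<^bsub>A\<^esub> x" using w x(2) by (auto simp: a_r_coset_def')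
      then have "i \<in> carrier A" "\<phi> i = 0" using I.a_subset ker[of i] by blast+
      then show ?thesis using add[of i x] x(1) i by simp
    qed
    then show ?thesis using yz by simp
  qed
  define h where "h C = \<phi> (SOME x. x \<in> C)" for C
  have h: "h C = \<phi> x" if "C \<in> carrier ?Q" "x \<in> C" for C x
    unfolding h_def using that same by (metis someI)
  have self: "x \<in> I +>\<^bsub>A\<^esub> x" if "x \<in> carrier A" for x
    using I.a_rcos_self that by auto
  have ne: "\<exists>x\<in>carrier A. x \<in> C" if "C \<in> carrier ?Q" for C
    using that self car by auto
  have h': "h (I +>\<^bsub>A\<^esub> x) = \<phi> x" if "x \<in> carrier A" for x
    using h self that car by blast
  have img: "h ` carrier ?Q = \<phi> ` carrier A"
    unfolding car image_image using h' by (auto intro!: image_cong)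
  have inj: "inj_on h (carrier ?Q)"
  proof (rule inj_onI)
    fix C D assume CD: "C \<in> carrier ?Q" "D \<in> carrier ?Q" "h C = h D"
    then obtain x y where xy: "x \<in> carrier A" "C = I +>\<^bsub>A\<^esub> x" "y \<in> carrier A" "D = I +>\<^bsub>A\<^esub> y"
      using car by auto
    have "\<phi> x = \<phi> y" using CD xy h' by simp
    moreover have "\<phi> (x \<ominus>\<^bsub>A\<^esub> y) + \<phi> y = \<phi> x"
      using xy add[of "x \<ominus>\<^bsub>A\<^esub> y" y] by (simp add: minus_eq a_assoc l_neg)
    ultimately have "x \<ominus>\<^bsub>A\<^esub> y \<in> I" using xy ker[of "x \<ominus>\<^bsub>A\<^esub> y"] by simp
    then have "x \<in> I +>\<^bsub>A\<^esub> y" using I.a_rcos_module[OF xy(3,1)] by (simp add: minus_eq)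
    then show "C = D" using I.a_repr_independence' xy by metis
  qed
  show thesis
  proof (rule that[of h])
    show "bij_betw h (carrier ?Q) (\<phi> ` carrier A)" using inj img by (simp add: bij_betw_def)
  next
    fix C D assume CD: "C \<in> carrier ?Q" "D \<in> carrier ?Q"
    then obtain x y where xy: "x \<in> carrier A" "x \<in> C" "y \<in> carrier A" "y \<in> D"
      using ne by metis
    have "x \<oplus>\<^bsub>A\<^esub> y \<in> C \<oplus>\<^bsub>?Q\<^esub> D"
      using xy by (auto simp: quotient_algebra_def set_add_def')
    moreover have "x \<otimes>\<^bsub>A\<^esub> y \<in> C \<otimes>\<^bsub>?Q\<^esub> D"
      using xy self[of "x \<otimes>\<^bsub>A\<^esub> y"] m_closed by (auto simp: quotient_algebra_def rcoset_mult_def)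
    ultimately show "h (C \<oplus>\<^bsub>?Q\<^esub> D) = h C + h D" "h (C \<otimes>\<^bsub>?Q\<^esub> D) = h C * h D"
      using h CD xy add mult Q.m_closed Q.a_closed by metis+
  next
    fix c C assume C: "C \<in> carrier ?Q"
    then obtain x where x: "x \<in> carrier A" "x \<in> C"
      using ne by metis
    have "c \<odot>\<^bsub>A\<^esub> x \<in> c \<odot>\<^bsub>?Q\<^esub> C"
      using x self[of "c \<odot>\<^bsub>A\<^esub> x"] smult_closed by (auto simp: quotient_algebra_def)
    then show "h (c \<odot>\<^bsub>?Q\<^esub> C) = smul c (h C)"
      using h C x smult Q.smult_closed by metis
  qed
qed


section \<open>Leavitt path algebras without regular vertices as operator algebras\<close>

text \<open>
  The operators of the generators, the same operators for words and, by linear extension, for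
  elements of the free algebra.
\<close>

primrec gen_op :: "('v, 'v \<times> 'v) lpa_generator \<Rightarrow> ('v list, 'k::field) op" where
  "gen_op (Vertex v) = swap [v] [v]"
| "gen_op (Edge e) = swap [fst e, snd e] [snd e]"
| "gen_op (Ghost e) = swap [snd e] [fst e, snd e]"

definition word_op :: "('v, 'v \<times> 'v) lpa_generator word \<Rightarrow> ('v list, 'k::field) op" where
  "word_op w = prod_list (map gen_op (letters w))"

definition op_of :: "(('v, 'v \<times> 'v) lpa_generator word \<Rightarrow>\<^sub>0 'k) \<Rightarrow> ('v list, 'k::field) op" where
  "op_of x = (\<Sum>w\<in>Poly_Mapping.keys x. smul (Poly_Mapping.lookup x w) (word_op w))"

lemma word_op_plus: "word_op (u + v) = word_op u * word_op v"
  by (simp add: word_op_def plus_word_def)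

lemma op_of_zero: "op_of 0 = 0"
  by (simp add: op_of_def)

lemma op_of_single: "op_of (Poly_Mapping.single w c) = smul c (word_op w)"
  by (simp add: op_of_def)

lemma op_of_add: "op_of (x + y) = op_of x + op_of y"
  unfolding op_of_def by (rule setsum_keys_plus_distrib) (simp_all add: op.scale_left_distrib)

lemma op_of_diff: "op_of (x - y) = op_of x - op_of y"
  using op_of_add[of "x - y" y] by simp

lemma update_eq_add:
  assumes "a \<notin> Poly_Mapping.keys f"
  shows "Poly_Mapping.update a b f = f + Poly_Mapping.single a b"
  by (rule poly_mapping_eqI)
     (use assms in \<open>auto simp: lookup_update lookup_add lookup_single when_def in_keys_iff\<close>)

lemma op_of_mult: "op_of (x * y) = op_of x * op_of y"
proof (induction x rule: update_induct)
  case const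
  then show ?case by (simp add: op_of_zero)
next
  case (update f a b)
  have "op_of (Poly_Mapping.single a b * y) = op_of (Poly_Mapping.single a b) * op_of y"
  proof (induction y rule: update_induct)
    case const
    then show ?case by (simp add: op_of_zero)
  next
    case (update g c d)
    then show ?case
      by (simp add: update_eq_add distrib_left op_of_add mult_single op_of_single word_op_plus smul_mult mult_smul)
  qed
  with update show ?case
    by (simp add: update_eq_add distrib_right op_of_add)
qed

lemma op_of_smult:
  fixes x :: "('a, 'a \<times> 'a) lpa_generator word \<Rightarrow>\<^sub>0 'b::field"
  shows "op_of (Poly_Mapping.map ((*) c) x) = smul c (op_of x)"
proof -
  have "word_op 0 = (1 :: ('a list, 'b) op)" by (simp add: word_op_def zero_word_def)
  then show ?thesis by (simp add: mult_map_scale_conv_mult op_of_mult op_of_single smul_mult)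
qed

lemma op_of_gen: "op_of (gen g) = gen_op g"
  by (simp add: gen_def op_of_single word_op_def)

text \<open>
  A pair of paths \<open>\<alpha>\<close>, \<open>\<beta>\<close> with common last vertex \<open>v\<close> has the normal word \<open>\<alpha> v \<beta>\<^sup>*\<close>. The vertex in
  the middle is redundant unless both paths are trivial, but keeping it makes all normal words
  uniform.
\<close>

fun edge_word :: "'v list \<Rightarrow> ('v, 'v \<times> 'v) lpa_generator list" where
  "edge_word (a # b # r) = Edge (a, b) # edge_word (b # r)"
| "edge_word _ = []"

fun ghost_word :: "'v list \<Rightarrow> ('v, 'v \<times> 'v) lpa_generator list" where
  "ghost_word (a # b # r) = ghost_word (b # r) @ [Ghost (a, b)]"
| "ghost_word _ = []"

definition normal_word :: "'v list \<Rightarrow> 'v list \<Rightarrow> ('v, 'v \<times> 'v) lpa_generator list" where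
  "normal_word \<alpha> \<beta> = edge_word \<alpha> @ Vertex (last \<alpha>) # ghost_word \<beta>"

lemma edge_word_snoc: "\<alpha> \<noteq> [] \<Longrightarrow> edge_word (\<alpha> @ [b]) = edge_word \<alpha> @ [Edge (last \<alpha>, b)]"
  by (induction \<alpha> rule: edge_word.induct) auto

lemma ghost_word_Cons: "\<beta> \<noteq> [] \<Longrightarrow> ghost_word (a # \<beta>) = ghost_word \<beta> @ [Ghost (a, hd \<beta>)]"
  by (cases \<beta>) auto

lemma word_op_normal_word:
  assumes "\<alpha> \<noteq> []" "\<beta> \<noteq> []" "last \<alpha> = last \<beta>"
  shows "word_op (Word (normal_word \<alpha> \<beta>)) = (swap \<alpha> \<beta> :: ('v list, 'k::field) op)"
proof -
  have 1: "word_op (Word (edge_word \<alpha>)) * swap [last \<alpha>] [last \<alpha>] = (swap \<alpha> [last \<alpha>] :: ('v list, 'k) op)"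
    if "\<alpha> \<noteq> []" for \<alpha> :: "'v list"
    using that
  proof (induction \<alpha> rule: edge_word.induct)
    case (1 a b r)
    then show ?case
      using swap_mult_left[of "[a, b]" "[b]" r "[last (b # r)]"] by (simp add: word_op_def mult.assoc)
  qed (simp_all add: word_op_def)
  have 2: "swap [last \<beta>] [last \<beta>] * word_op (Word (ghost_word \<beta>)) = (swap [last \<beta>] \<beta> :: ('v list, 'k) op)"
    if "\<beta> \<noteq> []" for \<beta> :: "'v list"
    using that
  proof (induction \<beta> rule: ghost_word.induct)
    case (1 a b r)
    then show ?case
      using swap_mult_right[of "[last (b # r)]" "[b]" r "[a, b]"] by (simp add: word_op_def flip: mult.assoc)
  qed (simp_all add: word_op_def)
  have idem: "swap [v] [v] * (swap [v] [v] * x) = swap [v] [v] * x" for v and x :: "('v list, 'k) op"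
    by (simp add: swap_mult_same flip: mult.assoc)
  have "word_op (Word (normal_word \<alpha> \<beta>)) =
      (word_op (Word (edge_word \<alpha>)) * swap [last \<alpha>] [last \<alpha>]) * (swap [last \<beta>] [last \<beta>] * word_op (Word (ghost_word \<beta>)) :: ('v list, 'k) op)"
    using assms by (simp add: normal_word_def word_op_def mult.assoc idem)
  also have "\<dots> = swap \<alpha> \<beta>"
    using assms 1[of \<alpha>] 2[of \<beta>] by (simp add: swap_mult_same)
  finally show ?thesis .
qed


section \<open>The normal form in a graph without regular vertices\<close>

text \<open>
  A vertex is regular if it emits at least one and only finitely many edges; relation (CK2) is
  about regular vertices only. Here there are none, and edges are pairs of vertices, so there are no
  parallel edges. Infinitely many letters are needed for fresh ones to exist.
\<close>

locale irregular_digraph = wf_digraph E for E :: "('v, 'v \<times> 'v) pre_digraph" +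
  assumes tail: "tail E = fst" and head: "head E = snd"
    and no_regular: "finite {e \<in> arcs E. tail E e = v} \<Longrightarrow> {e \<in> arcs E. tail E e = v} = {}"
    and infinite_UNIV: "infinite (UNIV :: 'v set)"
begin

text \<open>
  A path is the nonempty list of the vertices that it visits; \<open>path_pairs\<close> indexes the monomials
  \<open>\<alpha>\<beta>\<^sup>*\<close>.
\<close>

definition path :: "'v list \<Rightarrow> bool" where
  "path \<alpha> \<longleftrightarrow> \<alpha> \<noteq> [] \<and> set \<alpha> \<subseteq> verts E \<and> successively (\<lambda>a b. (a, b) \<in> arcs E) \<alpha>"

definition path_pairs :: "('v list \<times> 'v list) set" where
  "path_pairs = {(\<alpha>, \<beta>). path \<alpha> \<and> path \<beta> \<and> last \<alpha> = last \<beta>}"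

text \<open>
  The ideal of relations, by which the free algebra is divided.
\<close>

definition rel_ideal :: "(('v, 'v \<times> 'v) lpa_generator word \<Rightarrow>\<^sub>0 'k::field) set" where
  "rel_ideal = algebra_ideal_generated (free_algebra (lpa_generators E)) (lpa_relations E)"

text \<open>
  Words that agree modulo the ideal of relations, and words that lie in it. The field appears only
  as a type argument.
\<close>

definition cong_word :: "'k::field itself \<Rightarrow> ('v, 'v \<times> 'v) lpa_generator list \<Rightarrow> ('v, 'v \<times> 'v) lpa_generator list \<Rightarrow> bool" where
  "cong_word _ u v \<longleftrightarrow>
     Poly_Mapping.single (Word u) (1 :: 'k) - Poly_Mapping.single (Word v) 1 \<in> rel_ideal"

definition null_word :: "'k::field itself \<Rightarrow> ('v, 'v \<times> 'v) lpa_generator list \<Rightarrow> bool" where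
  "null_word _ u \<longleftrightarrow> Poly_Mapping.single (Word u) (1 :: 'k) \<in> rel_ideal"

lemma path_Cons: "path (a # b # r) \<longleftrightarrow> (a, b) \<in> arcs E \<and> path (b # r)"
  using head_in_verts[of "(a, b)"] tail_in_verts[of "(a, b)"]
  by (auto simp: path_def head tail)

lemma path_single: "path [a] \<longleftrightarrow> a \<in> verts E"
  by (auto simp: path_def)

lemma path_snoc: "\<alpha> \<noteq> [] \<Longrightarrow> path (\<alpha> @ [b]) \<longleftrightarrow> path \<alpha> \<and> (last \<alpha>, b) \<in> arcs E"
  using head_in_verts[of "(last \<alpha>, b)"]
  by (auto simp: path_def head successively_append_iff)

lemma path_last: "path \<alpha> \<Longrightarrow> last \<alpha> \<in> verts E"
  by (auto simp: path_def)

lemma algebra_ideal_rel_ideal: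
  "algebra_ideal rel_ideal (free_algebra (lpa_generators E) :: ('k::field, _) module)"
  and relations_in_rel_ideal: "lpa_relations E \<subseteq> (rel_ideal :: (_ \<Rightarrow>\<^sub>0 'k) set)"
  unfolding rel_ideal_def
  by (intro algebra_ideal_algebra_ideal_generated free_algebra_nonunital_algebra
      lpa_relations_subset wf_digraph_axioms)+

abbreviation F :: "'k::field itself \<Rightarrow> ('k, ('v, 'v \<times> 'v) lpa_generator word \<Rightarrow>\<^sub>0 'k) module" where
  "F _ \<equiv> free_algebra (lpa_generators E)"

lemma rel_ideal_add:
  assumes "x \<in> rel_ideal" "y \<in> rel_ideal"
  shows "x + y \<in> (rel_ideal :: (_ \<Rightarrow>\<^sub>0 'k::field) set)"
proof -
  have "additive_subgroup rel_ideal (F TYPE('k))"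
    using algebra_ideal_rel_ideal by (auto simp: algebra_ideal_def two_sided_ideal_def)
  from additive_subgroup.a_closed[OF this assms] show ?thesis by (simp add: free_algebra_def)
qed

lemma rel_ideal_smult:
  assumes "x \<in> rel_ideal"
  shows "Poly_Mapping.single 0 c * x \<in> (rel_ideal :: (_ \<Rightarrow>\<^sub>0 'k::field) set)"
  using assms algebra_ideal_rel_ideal[where ?'k = 'k]
  by (auto simp: algebra_ideal_def free_algebra_def simp flip: mult_map_scale_conv_mult)

lemma rel_ideal_zero: "0 \<in> (rel_ideal :: (_ \<Rightarrow>\<^sub>0 'k::field) set)"
proof -
  have "additive_subgroup rel_ideal (F TYPE('k))"
    using algebra_ideal_rel_ideal by (auto simp: algebra_ideal_def two_sided_ideal_def)
  from additive_subgroup.zero_closed[OF this] show ?thesis by (simp add: free_algebra_def)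
qed

lemma rel_ideal_uminus:
  assumes "x \<in> rel_ideal"
  shows "- x \<in> (rel_ideal :: (_ \<Rightarrow>\<^sub>0 'k::field) set)"
proof -
  have "Poly_Mapping.single 0 (-1) * x = - x"
    by (simp add: single_uminus)
  then show ?thesis using rel_ideal_smult[OF assms, of "-1"] by simp
qed

lemma rel_ideal_mult_word:
  assumes "x \<in> rel_ideal" "set u \<subseteq> lpa_generators E"
  shows "Poly_Mapping.single (Word u) 1 * x \<in> (rel_ideal :: (_ \<Rightarrow>\<^sub>0 'k::field) set)"
    "x * Poly_Mapping.single (Word u) 1 \<in> (rel_ideal :: (_ \<Rightarrow>\<^sub>0 'k::field) set)"
proof -
  have "Poly_Mapping.single (Word u) (1 :: 'k) \<in> carrier (F TYPE('k))" if "u \<noteq> []"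
    using assms that by (auto simp: free_algebra_def zero_word_def)
  moreover have "Poly_Mapping.single (Word u) (1 :: 'k) = 1" if "u = []"
    using that by (simp add: single_one flip: zero_word_def)
  ultimately show "Poly_Mapping.single (Word u) 1 * x \<in> (rel_ideal :: (_ \<Rightarrow>\<^sub>0 'k::field) set)"
    "x * Poly_Mapping.single (Word u) 1 \<in> (rel_ideal :: (_ \<Rightarrow>\<^sub>0 'k::field) set)"
    using assms algebra_ideal_rel_ideal[where ?'k = 'k]
    by (cases "u = []"; auto simp: algebra_ideal_def two_sided_ideal_def free_algebra_def)+
qed

lemma single_Word_append:
  "Poly_Mapping.single (Word (u @ v)) (1 :: 'k::field) = Poly_Mapping.single (Word u) 1 * Poly_Mapping.single (Word v) 1"
  by (simp add: mult_single plus_word_def)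

lemma cong_word_refl: "cong_word K u u"
  by (simp add: cong_word_def rel_ideal_zero)

lemma cong_word_sym: "cong_word K u v \<Longrightarrow> cong_word K v u"
  unfolding cong_word_def using rel_ideal_uminus by fastforce

lemma cong_word_trans [trans]: "cong_word K u v \<Longrightarrow> cong_word K v w \<Longrightarrow> cong_word K u w"
  unfolding cong_word_def using rel_ideal_add by fastforce

lemma cong_word_null [trans]: "cong_word K u v \<Longrightarrow> null_word K v \<Longrightarrow> null_word K u"
  unfolding cong_word_def null_word_def using rel_ideal_add by fastforce

lemma cong_word_append:
  assumes "cong_word K u v" "set p \<subseteq> lpa_generators E" "set s \<subseteq> lpa_generators E"
  shows "cong_word K (p @ u @ s) (p @ v @ s)"
  using rel_ideal_mult_word(1)[OF rel_ideal_mult_word(2)[OF assms(1)[unfolded cong_word_def] assms(3)] assms(2)]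
  unfolding cong_word_def single_Word_append
  by (simp add: left_diff_distrib right_diff_distrib mult.assoc)

lemma null_word_append:
  assumes "null_word K u" "set p \<subseteq> lpa_generators E" "set s \<subseteq> lpa_generators E"
  shows "null_word K (p @ u @ s)"
  using rel_ideal_mult_word(1)[OF rel_ideal_mult_word(2)[OF assms(1)[unfolded null_word_def] assms(3)] assms(2)]
  unfolding null_word_def single_Word_append
  by (simp add: mult.assoc)

lemma gen_mult: "gen g * gen h = Poly_Mapping.single (Word [g, h]) (1 :: 'k::field)"
  by (simp add: gen_def mult_single plus_word_def)

text \<open>
  The subtracted zero is the form in which the relations (V) and (CK1) appear for distinct vertices
  or edges.
\<close>

lemma relation_cong_word:
  fixes K :: "'k::field itself"
  shows "gen g * gen h - gen l \<in> (lpa_relations E :: (_ \<Rightarrow>\<^sub>0 'k) set) \<Longrightarrow> cong_word K [g, h] [l]"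
    "gen g * gen h - 0 \<in> (lpa_relations E :: (_ \<Rightarrow>\<^sub>0 'k) set) \<Longrightarrow> null_word K [g, h]"
  using relations_in_rel_ideal unfolding gen_mult
  by (auto simp: cong_word_def null_word_def gen_def)

lemma basic_cong:
  fixes K :: "'k::field itself"
  shows "v \<in> verts E \<Longrightarrow> cong_word K [Vertex v, Vertex v] [Vertex v]"
    "v \<in> verts E \<Longrightarrow> w \<in> verts E \<Longrightarrow> v \<noteq> w \<Longrightarrow> null_word K [Vertex v, Vertex w]"
    "(a, b) \<in> arcs E \<Longrightarrow> cong_word K [Vertex a, Edge (a, b)] [Edge (a, b)]"
    "(a, b) \<in> arcs E \<Longrightarrow> cong_word K [Edge (a, b), Vertex b] [Edge (a, b)]"
    "(a, b) \<in> arcs E \<Longrightarrow> cong_word K [Vertex b, Ghost (a, b)] [Ghost (a, b)]"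
    "(a, b) \<in> arcs E \<Longrightarrow> cong_word K [Ghost (a, b), Vertex a] [Ghost (a, b)]"
    "(a, b) \<in> arcs E \<Longrightarrow> cong_word K [Ghost (a, b), Edge (a, b)] [Vertex b]"
    "e \<in> arcs E \<Longrightarrow> f \<in> arcs E \<Longrightarrow> e \<noteq> f \<Longrightarrow> null_word K [Ghost e, Edge f]"
  using lpa_relations.V[of v E v] lpa_relations.V[of v E w]
    lpa_relations.E1_source[of "(a, b)" E] lpa_relations.E1_range[of "(a, b)" E]
    lpa_relations.E2_range[of "(a, b)" E] lpa_relations.E2_source[of "(a, b)" E]
    lpa_relations.CK1[of "(a, b)" E "(a, b)"] lpa_relations.CK1[of e E f]
  by (auto simp: head tail intro!: relation_cong_word split: if_splits)

lemma generators:
  "Vertex v \<in> lpa_generators E \<longleftrightarrow> v \<in> verts E"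
  "Edge e \<in> lpa_generators E \<longleftrightarrow> e \<in> arcs E"
  "Ghost e \<in> lpa_generators E \<longleftrightarrow> e \<in> arcs E"
  by (auto simp: lpa_generators_def)

lemma set_edge_word: "path \<alpha> \<Longrightarrow> set (edge_word \<alpha>) \<subseteq> lpa_generators E"
  by (induction \<alpha> rule: edge_word.induct) (auto simp: generators path_Cons)

lemma set_ghost_word: "path \<beta> \<Longrightarrow> set (ghost_word \<beta>) \<subseteq> lpa_generators E"
  by (induction \<beta> rule: ghost_word.induct) (auto simp: generators path_Cons)

lemma set_normal_word: "(\<alpha>, \<beta>) \<in> path_pairs \<Longrightarrow> set (normal_word \<alpha> \<beta>) \<subseteq> lpa_generators E"
  using set_edge_word set_ghost_word path_last by (auto simp: normal_word_def path_pairs_def generators)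

text \<open>
  The product of a normal word with a generator on the right is again congruent to a normal word or
  to zero. This is checked for vertices first, since the vertex at which a real
  or ghost edge starts can be inserted before it.
\<close>

lemma normal_word_absorb:
  assumes "(\<alpha>, \<beta>) \<in> path_pairs"
  shows "cong_word K (normal_word \<alpha> \<beta> @ [Vertex (hd \<beta>)]) (normal_word \<alpha> \<beta>)"
proof (cases "\<exists>a b r. \<beta> = a # b # r")
  case True
  then obtain a b r where b: "\<beta> = a # b # r" by auto
  have g: "(a, b) \<in> arcs E" "path (b # r)" "path \<alpha>" using assms b by (auto simp: path_pairs_def path_Cons)
  show ?thesis
    using cong_word_append[OF basic_cong(6)[OF g(1)], of "edge_word \<alpha> @ Vertex (last \<alpha>) # ghost_word (b # r)" "[]"]
      g set_edge_word[OF g(3)] set_ghost_word[OF g(2)] path_last[OF g(3)]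
    by (simp add: b normal_word_def generators)
next
  case False
  then obtain a where b: "\<beta> = [a]" using assms by (cases \<beta> rule: ghost_word.cases) (auto simp: path_pairs_def path_def)
  have g: "a \<in> verts E" "path \<alpha>" "last \<alpha> = a" using assms b by (auto simp: path_pairs_def path_single)
  show ?thesis
    using cong_word_append[OF basic_cong(1)[OF g(1)], of "edge_word \<alpha>" "[]"] set_edge_word[OF g(2)] g(3)
    by (simp add: b normal_word_def)
qed

lemma normal_word_vertex:
  assumes "(\<alpha>, \<beta>) \<in> path_pairs" "v \<in> verts E" "v \<noteq> hd \<beta>"
  shows "null_word K (normal_word \<alpha> \<beta> @ [Vertex v])"
proof -
  have "hd \<beta> \<in> verts E" using assms(1) by (auto simp: path_pairs_def path_def)
  then have "null_word K (normal_word \<alpha> \<beta> @ [Vertex (hd \<beta>), Vertex v] @ [])"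
    using assms set_normal_word by (intro null_word_append basic_cong) auto
  moreover have "cong_word K ([] @ (normal_word \<alpha> \<beta> @ [Vertex (hd \<beta>)]) @ [Vertex v]) ([] @ normal_word \<alpha> \<beta> @ [Vertex v])"
    using assms by (intro cong_word_append normal_word_absorb) (auto simp: generators)
  ultimately show ?thesis using cong_word_null cong_word_sym by fastforce
qed

lemma normal_word_ghost:
  assumes "(\<alpha>, \<beta>) \<in> path_pairs" "(c, d) \<in> arcs E"
  shows "null_word K (normal_word \<alpha> \<beta> @ [Ghost (c, d)]) \<or>
    (\<exists>(\<alpha>', \<beta>')\<in>path_pairs. normal_word \<alpha> \<beta> @ [Ghost (c, d)] = normal_word \<alpha>' \<beta>')"
proof (cases "d = hd \<beta>")
  case True
  have "\<beta> \<noteq> []" using assms by (auto simp: path_pairs_def path_def)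
  then have "(\<alpha>, c # \<beta>) \<in> path_pairs" "normal_word \<alpha> \<beta> @ [Ghost (c, d)] = normal_word \<alpha> (c # \<beta>)"
    using assms True path_Cons[of c d "tl \<beta>"]
    by (auto simp: path_pairs_def normal_word_def ghost_word_Cons)
  then show ?thesis by blast
next
  case False
  have d: "d \<in> verts E" using assms(2) head_in_verts[of "(c, d)"] by (simp add: head)
  have "cong_word K (normal_word \<alpha> \<beta> @ [Vertex d, Ghost (c, d)] @ []) (normal_word \<alpha> \<beta> @ [Ghost (c, d)] @ [])"
    using assms set_normal_word by (intro cong_word_append basic_cong) auto
  moreover have "null_word K ([] @ (normal_word \<alpha> \<beta> @ [Vertex d]) @ [Ghost (c, d)])"
    using assms False d by (intro null_word_append normal_word_vertex) (auto simp: generators)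
  ultimately show ?thesis using cong_word_null cong_word_sym by fastforce
qed

lemma normal_word_edge:
  assumes "(\<alpha>, \<beta>) \<in> path_pairs" "(c, d) \<in> arcs E"
  shows "null_word K (normal_word \<alpha> \<beta> @ [Edge (c, d)]) \<or>
    (\<exists>(\<alpha>', \<beta>')\<in>path_pairs. cong_word K (normal_word \<alpha> \<beta> @ [Edge (c, d)]) (normal_word \<alpha>' \<beta>'))"
proof (cases "\<exists>a b r. \<beta> = a # b # r")
  case True
  then obtain a b r where b: "\<beta> = a # b # r" by auto
  have g: "(a, b) \<in> arcs E" "path (b # r)" "path \<alpha>" "(\<alpha>, b # r) \<in> path_pairs"
    using assms b by (auto simp: path_pairs_def path_Cons)
  have eq: "normal_word \<alpha> \<beta> = normal_word \<alpha> (b # r) @ [Ghost (a, b)]"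
    by (simp add: b normal_word_def)
  show ?thesis
  proof (cases "(a, b) = (c, d)")
    case True
    have "cong_word K (normal_word \<alpha> (b # r) @ [Ghost (a, b), Edge (a, b)] @ []) (normal_word \<alpha> (b # r) @ [Vertex b] @ [])"
      using g set_normal_word by (intro cong_word_append basic_cong) auto
    moreover have "cong_word K (normal_word \<alpha> (b # r) @ [Vertex b]) (normal_word \<alpha> (b # r))"
      using normal_word_absorb[OF g(4)] by simp
    ultimately have "cong_word K (normal_word \<alpha> \<beta> @ [Edge (c, d)]) (normal_word \<alpha> (b # r))"
      using True cong_word_trans eq by fastforce
    with g(4) show ?thesis by blast
  next
    case False
    have "null_word K (normal_word \<alpha> (b # r) @ [Ghost (a, b), Edge (c, d)] @ [])"
      using g assms False set_normal_word by (intro null_word_append basic_cong) auto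
    then show ?thesis by (simp add: eq)
  qed
next
  case False
  then obtain a where b: "\<beta> = [a]" using assms by (cases \<beta> rule: ghost_word.cases) (auto simp: path_pairs_def path_def)
  have g: "a \<in> verts E" "path \<alpha>" "last \<alpha> = a" "c \<in> verts E"
    using assms b tail_in_verts[of "(c, d)"] by (auto simp: path_pairs_def path_single tail)
  have eq: "normal_word \<alpha> \<beta> = edge_word \<alpha> @ [Vertex a]" using g by (simp add: normal_word_def b)
  have e: "set (edge_word \<alpha>) \<subseteq> lpa_generators E" using g set_edge_word by simp
  have 1: "cong_word K (normal_word \<alpha> \<beta> @ [Vertex c, Edge (c, d)] @ []) (normal_word \<alpha> \<beta> @ [Edge (c, d)] @ [])"
    using assms set_normal_word by (intro cong_word_append basic_cong) auto
  show ?thesis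
  proof (cases "a = c")
    case True
    have "cong_word K (edge_word \<alpha> @ [Vertex c, Edge (c, d)] @ []) (edge_word \<alpha> @ [Edge (c, d)] @ [])"
      using assms e by (intro cong_word_append basic_cong) auto
    moreover have "cong_word K (edge_word \<alpha> @ [Edge (c, d), Vertex d] @ []) (edge_word \<alpha> @ [Edge (c, d)] @ [])"
      using assms e by (intro cong_word_append basic_cong) auto
    moreover have "\<alpha> \<noteq> []" using g by (auto simp: path_def)
    ultimately have "cong_word K (normal_word \<alpha> \<beta> @ [Edge (c, d)]) (normal_word (\<alpha> @ [d]) [d])"
      using True g cong_word_trans[OF _ cong_word_sym] by (simp add: b normal_word_def edge_word_snoc)
    moreover have "(\<alpha> @ [d], [d]) \<in> path_pairs"
      using g True assms \<open>\<alpha> \<noteq> []\<close> head_in_verts[of "(c, d)"]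
      by (auto simp: path_pairs_def path_snoc path_single head)
    ultimately show ?thesis by blast
  next
    case False
    have "null_word K ([] @ (normal_word \<alpha> \<beta> @ [Vertex c]) @ [Edge (c, d)])"
      using assms False g b by (intro null_word_append normal_word_vertex) (auto simp: generators)
    with 1 show ?thesis using cong_word_null cong_word_sym by fastforce
  qed
qed

lemma word_cong_normal_word:
  assumes "w \<noteq> []" "set w \<subseteq> lpa_generators E"
  shows "null_word K w \<or> (\<exists>(\<alpha>, \<beta>)\<in>path_pairs. cong_word K w (normal_word \<alpha> \<beta>))"
  using assms
proof (induction w rule: rev_nonempty_induct)
  case (single g)
  then consider (v) v where "g = Vertex v" "v \<in> verts E" | (e) a b where "g = Edge (a, b)" "(a, b) \<in> arcs E"
    | (f) a b where "g = Ghost (a, b)" "(a, b) \<in> arcs E"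
    by (auto simp: lpa_generators_def)
  then show ?case
  proof cases
    case v
    then have "([v], [v]) \<in> path_pairs" "cong_word K [g] (normal_word [v] [v])"
      by (auto simp: path_pairs_def path_single normal_word_def cong_word_refl)
    then show ?thesis by blast
  next
    case e
    have "b \<in> verts E" using e head_in_verts[of "(a, b)"] by (simp add: head)
    then have "([a, b], [b]) \<in> path_pairs" "cong_word K [g] (normal_word [a, b] [b])"
      using e basic_cong(4)[of a b] cong_word_sym
      by (auto simp: path_pairs_def path_single path_Cons normal_word_def)
    then show ?thesis by blast
  next
    case f
    have "b \<in> verts E" using f head_in_verts[of "(a, b)"] by (simp add: head)
    then have "([b], [a, b]) \<in> path_pairs" "cong_word K [g] (normal_word [b] [a, b])"
      using f basic_cong(5)[of a b] cong_word_sym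
      by (auto simp: path_pairs_def path_single path_Cons normal_word_def)
    then show ?thesis by blast
  qed
next
  case (snoc g w)
  have g: "set [g] \<subseteq> lpa_generators E" and w: "set w \<subseteq> lpa_generators E" using snoc.prems by auto
  from snoc.IH[OF w] show ?case
  proof
    assume "null_word K w"
    then show ?thesis using null_word_append[of K w "[]" "[g]"] g by simp
  next
    assume "\<exists>(\<alpha>, \<beta>)\<in>path_pairs. cong_word K w (normal_word \<alpha> \<beta>)"
    then obtain \<alpha> \<beta> where ab: "(\<alpha>, \<beta>) \<in> path_pairs" "cong_word K w (normal_word \<alpha> \<beta>)" by blast
    have c: "cong_word K (w @ [g]) (normal_word \<alpha> \<beta> @ [g])"
      using cong_word_append[OF ab(2), of "[]" "[g]"] g by simp
    have "null_word K (normal_word \<alpha> \<beta> @ [g]) \<or>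
      (\<exists>(\<alpha>', \<beta>')\<in>path_pairs. cong_word K (normal_word \<alpha> \<beta> @ [g]) (normal_word \<alpha>' \<beta>'))"
    proof -
      consider (v) v where "g = Vertex v" "v \<in> verts E" | (e) a b where "g = Edge (a, b)" "(a, b) \<in> arcs E"
        | (f) a b where "g = Ghost (a, b)" "(a, b) \<in> arcs E"
        using g by (auto simp: lpa_generators_def)
      then show ?thesis
      proof cases
        case v
        then show ?thesis using normal_word_absorb[OF ab(1)] normal_word_vertex[OF ab(1)] ab(1) by blast
      next
        case e
        then show ?thesis using normal_word_edge[OF ab(1)] by simp
      next
        case f
        then show ?thesis using normal_word_ghost[OF ab(1), of a b] cong_word_refl by fastforce
      qed
    qed
    with c show ?thesis using cong_word_null cong_word_trans by blast
  qed
qed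


section \<open>Kernel and image of the representation\<close>

text \<open>
  The span of the operators of the monomials: the image of the Leavitt path algebra.
\<close>

definition path_ops :: "('v list, 'k::field) op set" where
  "path_ops = op.span ((\<lambda>(\<alpha>, \<beta>). swap \<alpha> \<beta>) ` path_pairs)"

text \<open>
  Linear combinations of normal words.
\<close>

definition normal_polys :: "(('v, 'v \<times> 'v) lpa_generator word \<Rightarrow>\<^sub>0 'k::field) set" where
  "normal_polys = {y. Poly_Mapping.keys y \<subseteq> Word ` (\<lambda>(\<alpha>, \<beta>). normal_word \<alpha> \<beta>) ` path_pairs}"

lemma path_pairs_word_op:
  "(\<alpha>, \<beta>) \<in> path_pairs \<Longrightarrow> word_op (Word (normal_word \<alpha> \<beta>)) = swap \<alpha> \<beta>"
  by (rule word_op_normal_word) (auto simp: path_pairs_def path_def)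

lemma normal_polys_subset: "normal_polys \<subseteq> carrier (F TYPE('k::field))"
  using set_normal_word by (fastforce simp: normal_polys_def free_algebra_def zero_word_def normal_word_def)

lemma free_algebra_normal_form:
  assumes "x \<in> carrier (F TYPE('k::field))"
  shows "\<exists>y\<in>normal_polys. x - y \<in> rel_ideal"
  using assms
proof (induction x rule: update_induct)
  case const
  show ?case by (rule bexI[of _ 0]) (auto simp: normal_polys_def rel_ideal_zero)
next
  case (update f a b)
  have eq: "Poly_Mapping.update a b f = f + Poly_Mapping.single a b"
    using update(1) by (rule update_eq_add)
  have "Poly_Mapping.keys (f + Poly_Mapping.single a b) = insert a (Poly_Mapping.keys f)"
    using update(1,2) by (auto simp: in_keys_iff lookup_add lookup_single when_def split: if_splits)
  then have fa: "f \<in> carrier (F TYPE('k))" "letters a \<noteq> []" "set (letters a) \<subseteq> lpa_generators E"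
    using update(4) by (auto simp: eq free_algebra_def zero_word_def) (metis word.collapse)
  obtain y where y: "y \<in> normal_polys" "f - y \<in> rel_ideal" using update(3) fa(1) by blast
  obtain z where z: "z \<in> normal_polys" "Poly_Mapping.single a 1 - z \<in> (rel_ideal :: (_ \<Rightarrow>\<^sub>0 'k) set)"
    using word_cong_normal_word[OF fa(2,3), of "TYPE('k)"]
  proof
    assume "null_word TYPE('k) (letters a)"
    then show thesis using that[of 0] by (auto simp: null_word_def normal_polys_def)
  next
    assume "\<exists>(\<alpha>, \<beta>)\<in>path_pairs. cong_word TYPE('k) (letters a) (normal_word \<alpha> \<beta>)"
    then obtain \<alpha> \<beta> where "(\<alpha>, \<beta>) \<in> path_pairs" "cong_word TYPE('k) (letters a) (normal_word \<alpha> \<beta>)"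
      by blast
    then show thesis
      using that[of "Poly_Mapping.single (Word (normal_word \<alpha> \<beta>)) 1"]
      by (auto simp: cong_word_def normal_polys_def)
  qed
  have "Poly_Mapping.keys (Poly_Mapping.single 0 b * z) \<subseteq> Poly_Mapping.keys z"
    using keys_mult[of "Poly_Mapping.single 0 b" z] by (auto split: if_splits)
  then have 1: "y + Poly_Mapping.single 0 b * z \<in> normal_polys"
    using y(1) z(1) Poly_Mapping.keys_add[of y "Poly_Mapping.single 0 b * z"]
    unfolding normal_polys_def by blast
  have "(f - y) + Poly_Mapping.single 0 b * (Poly_Mapping.single a 1 - z) \<in> rel_ideal"
    by (intro rel_ideal_add rel_ideal_smult y z)
  moreover have "Poly_Mapping.single 0 b * Poly_Mapping.single a 1 = Poly_Mapping.single a b"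
    by (simp add: mult_single)
  ultimately have "Poly_Mapping.update a b f - (y + Poly_Mapping.single 0 b * z) \<in> rel_ideal"
    by (simp add: eq algebra_simps)
  with 1 show ?case by blast
qed

text \<open>
  The relations hold for the operators. Relation (CK2) is vacuous.
\<close>

lemma op_of_rel_ideal:
  assumes "x \<in> (rel_ideal :: (_ \<Rightarrow>\<^sub>0 'k::field) set)"
  shows "op_of x = 0"
proof -
  interpret A: nonunital_algebra "F TYPE('k)" by (rule free_algebra_nonunital_algebra)
  let ?N = "{x \<in> carrier (F TYPE('k)). op_of x = 0}"
  have "op_of (- x) = - op_of x" for x :: "_ \<Rightarrow>\<^sub>0 'k"
    using op_of_diff[of 0 x] by (simp add: op_of_zero)
  moreover have "- x = \<ominus>\<^bsub>F TYPE('k)\<^esub> x" if "x \<in> carrier (F TYPE('k))" for x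
    using that by (intro A.minus_equality[symmetric]) (auto simp: free_algebra_def)
  ultimately have uminus: "op_of (\<ominus>\<^bsub>F TYPE('k)\<^esub> x) = - op_of x" if "x \<in> carrier (F TYPE('k))" for x
    using that by metis
  have plus: "op_of (x \<oplus>\<^bsub>F TYPE('k)\<^esub> y) = op_of x + op_of y"
    and times: "op_of (x \<otimes>\<^bsub>F TYPE('k)\<^esub> y) = op_of x * op_of y"
    and scale: "op_of (c \<odot>\<^bsub>F TYPE('k)\<^esub> x) = smul c (op_of x)" for x y c
    by (simp_all add: free_algebra_def op_of_add op_of_mult op_of_smult)
  have zero: "op_of \<zero>\<^bsub>F TYPE('k)\<^esub> = 0"
    by (simp add: free_algebra_def op_of_zero)
  have "additive_subgroup ?N (F TYPE('k))"
  proof (rule additive_subgroup.intro, rule A.add.subgroupI)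
    show "?N \<noteq> {}" using zero A.zero_closed by blast
  qed (simp_all add: plus uminus A.a_closed)
  then have "algebra_ideal ?N (F TYPE('k))"
    unfolding algebra_ideal_def two_sided_ideal_def
    by (simp add: times scale A.m_closed A.smult_closed)
  moreover have "lpa_relations E \<subseteq> ?N"
  proof
    fix x :: "_ \<Rightarrow>\<^sub>0 'k" assume x: "x \<in> lpa_relations E"
    then have "x \<in> carrier (F TYPE('k))" using lpa_relations_subset[OF wf_digraph_axioms] by blast
    moreover from x have "op_of x = 0"
    proof cases
      case (V v w)
      then show ?thesis
        by (auto simp: op_of_diff op_of_mult op_of_gen op_of_zero swap_mult_same intro!: swap_mult_zero)
    next
      case (CK1 e f)
      have "swap [snd e] [fst e, snd e] * swap [fst f, snd f] [snd f] = (0 :: ('v list, 'k) op)" if "e \<noteq> f"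
        using that by (intro swap_mult_zero) (auto simp: prod_eq_iff)
      then show ?thesis
        using CK1 by (auto simp: op_of_diff op_of_mult op_of_gen op_of_zero swap_mult_same head)
    next
      case (CK2 v)
      then show ?thesis using no_regular[of v] by blast
    next
      case (E1_source e)
      then show ?thesis using swap_mult_left[of "[fst e]" "[fst e]" "[snd e]" "[snd e]"]
        by (simp add: op_of_diff op_of_mult op_of_gen tail)
    next
      case (E2_source e)
      then show ?thesis using swap_mult_right[of "[snd e]" "[fst e]" "[snd e]" "[fst e]"]
        by (simp add: op_of_diff op_of_mult op_of_gen tail)
    qed (simp_all add: op_of_diff op_of_mult op_of_gen swap_mult_same head)
    ultimately show "x \<in> ?N" by simp
  qed
  ultimately have "rel_ideal \<subseteq> ?N"
    unfolding rel_ideal_def algebra_ideal_generated_def by blast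
  then show ?thesis using assms by blast
qed

lemma op_of_normal_poly:
  assumes "y \<in> (normal_polys :: (_ \<Rightarrow>\<^sub>0 'k::field) set)"
  obtains S where "finite S" "S \<subseteq> path_pairs" "S = {} \<longrightarrow> y = 0"
    "op_of y = (\<Sum>(\<alpha>, \<beta>)\<in>S. smul (Poly_Mapping.lookup y (Word (normal_word \<alpha> \<beta>))) (swap \<alpha> \<beta>))"
    "\<And>\<alpha> \<beta>. (\<alpha>, \<beta>) \<in> S \<Longrightarrow> Poly_Mapping.lookup y (Word (normal_word \<alpha> \<beta>)) \<noteq> 0"
proof -
  have "\<forall>w\<in>Poly_Mapping.keys y. \<exists>i\<in>path_pairs. w = Word (normal_word (fst i) (snd i))"
  proof
    fix w assume "w \<in> Poly_Mapping.keys y"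
    then have "w \<in> Word ` (\<lambda>(\<alpha>, \<beta>). normal_word \<alpha> \<beta>) ` path_pairs"
      using assms unfolding normal_polys_def by blast
    then show "\<exists>i\<in>path_pairs. w = Word (normal_word (fst i) (snd i))"
      by (auto simp: case_prod_unfold)
  qed
  then obtain g where g: "\<And>w. w \<in> Poly_Mapping.keys y \<Longrightarrow> g w \<in> path_pairs"
    "\<And>w. w \<in> Poly_Mapping.keys y \<Longrightarrow> w = Word (normal_word (fst (g w)) (snd (g w)))"
    by metis
  have inj: "inj_on g (Poly_Mapping.keys y)" using g(2) by (metis inj_onI)
  have "op_of y = (\<Sum>w\<in>Poly_Mapping.keys y. smul (Poly_Mapping.lookup y (Word (normal_word (fst (g w)) (snd (g w))))) (swap (fst (g w)) (snd (g w))))"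
    unfolding op_of_def
  proof (rule sum.cong)
    fix w assume w: "w \<in> Poly_Mapping.keys y"
    have "word_op w = (swap (fst (g w)) (snd (g w)) :: ('v list, 'k) op)"
      using g[OF w] path_pairs_word_op by (metis prod.collapse)
    then show "smul (Poly_Mapping.lookup y w) (word_op w) = smul (Poly_Mapping.lookup y (Word (normal_word (fst (g w)) (snd (g w))))) (swap (fst (g w)) (snd (g w)))"
      using g(2)[OF w] by simp
  qed simp
  also have "\<dots> = (\<Sum>(\<alpha>, \<beta>)\<in>g ` Poly_Mapping.keys y. smul (Poly_Mapping.lookup y (Word (normal_word \<alpha> \<beta>))) (swap \<alpha> \<beta>))"
    by (simp add: sum.reindex[OF inj] case_prod_unfold)
  finally have sum: "op_of y = \<dots>" .
  have nz: "Poly_Mapping.lookup y (Word (normal_word \<alpha> \<beta>)) \<noteq> 0" if "(\<alpha>, \<beta>) \<in> g ` Poly_Mapping.keys y" for \<alpha> \<beta>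
    using that g(2) by (metis fst_conv imageE in_keys_iff snd_conv)
  show thesis
    by (rule that[of "g ` Poly_Mapping.keys y"]) (use g(1) sum nz in auto)
qed

lemma swaps_independent:
  fixes c :: "'v list \<times> 'v list \<Rightarrow> 'k::field"
  assumes "finite S" "S \<noteq> {}" "\<And>i. i \<in> S \<Longrightarrow> c i \<noteq> 0"
  shows "(\<Sum>(\<alpha>, \<beta>)\<in>S. smul (c (\<alpha>, \<beta>)) (swap \<alpha> \<beta>)) \<noteq> 0"
proof -
  obtain p q where pq: "(p, q) \<in> S"
    "\<And>f. (\<And>\<alpha> \<beta>. (\<alpha>, \<beta>) \<in> S \<Longrightarrow> f \<notin> set \<alpha> \<union> set \<beta>) \<Longrightarrow>
       swap [f] (p @ [f]) * (\<Sum>(\<alpha>, \<beta>)\<in>S. smul (c (\<alpha>, \<beta>)) (swap \<alpha> \<beta>)) * swap (q @ [f]) [f]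
         = smul (c (p, q)) (swap [f] [f])"
    using swap_sum_corner[OF assms(1,2), of c] by blast
  have "finite (\<Union>(\<alpha>, \<beta>)\<in>S. set \<alpha> \<union> set \<beta>)" using assms(1) by auto
  then obtain f where "f \<notin> (\<Union>(\<alpha>, \<beta>)\<in>S. set \<alpha> \<union> set \<beta>)"
    using infinite_UNIV ex_new_if_finite by blast
  then have "swap [f] (p @ [f]) * (\<Sum>(\<alpha>, \<beta>)\<in>S. smul (c (\<alpha>, \<beta>)) (swap \<alpha> \<beta>)) * swap (q @ [f]) [f]
         = smul (c (p, q)) (swap [f] [f])"
    by (intro pq(2)) blast
  moreover have "smul (c (p, q)) (swap [f] [f]) \<noteq> (0 :: ('v list, 'k) op)"
    using assms(3)[OF pq(1)] swap_nonzero by simp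
  ultimately show ?thesis by auto
qed

lemma op_of_kernel:
  assumes "x \<in> carrier (F TYPE('k::field))"
  shows "op_of x = 0 \<longleftrightarrow> x \<in> rel_ideal"
proof
  assume x: "op_of x = 0"
  obtain y where y: "y \<in> normal_polys" "x - y \<in> rel_ideal"
    using free_algebra_normal_form[OF assms] by blast
  have "op_of y = 0" using op_of_rel_ideal[OF y(2)] x by (simp add: op_of_diff)
  obtain S where S: "finite S" "S \<subseteq> path_pairs" "S = {} \<longrightarrow> y = 0"
    "op_of y = (\<Sum>(\<alpha>, \<beta>)\<in>S. smul (Poly_Mapping.lookup y (Word (normal_word \<alpha> \<beta>))) (swap \<alpha> \<beta>))"
    "\<And>\<alpha> \<beta>. (\<alpha>, \<beta>) \<in> S \<Longrightarrow> Poly_Mapping.lookup y (Word (normal_word \<alpha> \<beta>)) \<noteq> 0"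
    by (rule op_of_normal_poly[OF y(1)], rule that)
  let ?c = "\<lambda>i. Poly_Mapping.lookup y (Word (normal_word (fst i) (snd i)))"
  have "?c i \<noteq> 0" if "i \<in> S" for i
    using S(5)[of "fst i" "snd i"] that by simp
  moreover have "(\<Sum>(\<alpha>, \<beta>)\<in>S. smul (?c (\<alpha>, \<beta>)) (swap \<alpha> \<beta>)) = (0 :: ('v list, 'k) op)"
    using S(4) \<open>op_of y = 0\<close> by simp
  ultimately have "S = {}"
    using swaps_independent[OF S(1), of ?c] by blast
  then show "x \<in> rel_ideal" using S(3) y(2) by simp
qed (rule op_of_rel_ideal)

lemma op_of_image: "op_of ` carrier (F TYPE('k::field)) = path_ops"
proof (intro subset_antisym subsetI)
  fix a assume "a \<in> op_of ` carrier (F TYPE('k))"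
  then obtain x where x: "x \<in> carrier (F TYPE('k))" "a = op_of x" by blast
  obtain y where y: "y \<in> normal_polys" "x - y \<in> rel_ideal"
    using free_algebra_normal_form[OF x(1)] by blast
  have "a = op_of y" using op_of_rel_ideal[OF y(2)] x by (simp add: op_of_diff)
  obtain S where S: "S \<subseteq> path_pairs"
    "op_of y = (\<Sum>(\<alpha>, \<beta>)\<in>S. smul (Poly_Mapping.lookup y (Word (normal_word \<alpha> \<beta>))) (swap \<alpha> \<beta>))"
    by (rule op_of_normal_poly[OF y(1)])
  show "a \<in> path_ops"
    unfolding \<open>a = op_of y\<close> S(2) path_ops_def
    using S(1) by (auto intro!: op.span_sum op.span_scale intro: op.span_base)
next
  fix a :: "('v list, 'k) op" assume "a \<in> path_ops"
  then show "a \<in> op_of ` carrier (F TYPE('k))"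
    unfolding path_ops_def
  proof (induction rule: op.span_induct_alt)
    case base
    show ?case by (rule image_eqI[of _ _ 0]) (auto simp: op_of_zero free_algebra_def)
  next
    case (step c s y)
    interpret A: nonunital_algebra "F TYPE('k)" by (rule free_algebra_nonunital_algebra)
    obtain \<alpha> \<beta> where ab: "(\<alpha>, \<beta>) \<in> path_pairs" "s = swap \<alpha> \<beta>" using step by auto
    let ?w = "Poly_Mapping.single (Word (normal_word \<alpha> \<beta>)) c"
    have "?w \<in> normal_polys" using ab by (auto simp: normal_polys_def)
    then have w: "?w \<in> carrier (F TYPE('k))" using normal_polys_subset by blast
    obtain z where z: "z \<in> carrier (F TYPE('k))" "y = op_of z" using step by auto
    have "?w + z \<in> carrier (F TYPE('k))" using A.a_closed[OF w z(1)] by (simp add: free_algebra_def)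
    moreover have "op_of (?w + z) = smul c s + y"
      using ab z by (simp add: op_of_add op_of_single path_pairs_word_op)
    ultimately show ?case by (metis imageI)
  qed
qed

text \<open>
  Every element is congruent to a combination of normal words, and the operators of distinct normal
  words are linearly independent; so the kernel on the free algebra is the ideal of relations.
\<close>

lemma leavitt_path_algebra_embedding:
  fixes L :: "('k::field, (('v, 'v \<times> 'v) lpa_generator word \<Rightarrow>\<^sub>0 'k) set) module"
  defines "L \<equiv> leavitt_path_algebra E"
  obtains h :: "_ \<Rightarrow> ('v list, 'k) op" where "bij_betw h (carrier L) path_ops"
    "\<And>x y. x \<in> carrier L \<Longrightarrow> y \<in> carrier L \<Longrightarrow> h (x \<oplus>\<^bsub>L\<^esub> y) = h x + h y"
    "\<And>x y. x \<in> carrier L \<Longrightarrow> y \<in> carrier L \<Longrightarrow> h (x \<otimes>\<^bsub>L\<^esub> y) = h x * h y"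
    "\<And>c x. x \<in> carrier L \<Longrightarrow> h (c \<odot>\<^bsub>L\<^esub> x) = smul c (h x)"
proof -
  have L: "L = quotient_algebra (F TYPE('k)) rel_ideal"
    by (simp add: L_def leavitt_path_algebra_def rel_ideal_def Let_def)
  obtain h :: "_ \<Rightarrow> ('v list, 'k) op" where h: "bij_betw h (carrier L) (op_of ` carrier (F TYPE('k)))"
    "\<And>x y. x \<in> carrier L \<Longrightarrow> y \<in> carrier L \<Longrightarrow> h (x \<oplus>\<^bsub>L\<^esub> y) = h x + h y"
    "\<And>x y. x \<in> carrier L \<Longrightarrow> y \<in> carrier L \<Longrightarrow> h (x \<otimes>\<^bsub>L\<^esub> y) = h x * h y"
    "\<And>c x. x \<in> carrier L \<Longrightarrow> h (c \<odot>\<^bsub>L\<^esub> x) = smul c (h x)"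
    unfolding L
    by (rule quotient_algebra_embedding[OF free_algebra_nonunital_algebra algebra_ideal_rel_ideal,
          where \<phi> = op_of])
       (auto simp: op_of_kernel, auto simp: free_algebra_def op_of_add op_of_mult op_of_smult)
  show thesis using that[OF h(1)[unfolded op_of_image] h(2-4)] .
qed


lemma path_append:
  assumes "path (\<gamma> @ u)" "\<gamma> \<noteq> []" "path \<delta>" "last \<delta> = last \<gamma>"
  shows "path (\<delta> @ u)" "last (\<delta> @ u) = last (\<gamma> @ u)"
  using assms by (cases u; auto simp: path_def successively_append_iff)+

text \<open>
  Nonzero products of monomials are monomials; their last vertex is that of the longer of the two
  paths that meet in the middle.
\<close>

lemma path_pairs_mult_cases:
  assumes "(\<alpha>, \<beta>) \<in> path_pairs" "(\<gamma>, \<delta>) \<in> path_pairs"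
  obtains (zero) "swap \<alpha> \<beta> * swap \<gamma> \<delta> = (0 :: ('v list, 'k::field) op)"
  | (left) u where "\<gamma> = \<beta> @ u" "swap \<alpha> \<beta> * swap \<gamma> \<delta> = (swap (\<alpha> @ u) \<delta> :: ('v list, 'k) op)" "(\<alpha> @ u, \<delta>) \<in> path_pairs"
  | (right) u where "\<beta> = \<gamma> @ u" "swap \<alpha> \<beta> * swap \<gamma> \<delta> = (swap \<alpha> (\<delta> @ u) :: ('v list, 'k) op)" "(\<alpha>, \<delta> @ u) \<in> path_pairs"
proof -
  consider "prefix \<beta> \<gamma>" | "prefix \<gamma> \<beta>" | "\<not> prefix \<beta> \<gamma>" "\<not> prefix \<gamma> \<beta>" by blast
  then show thesis
  proof cases
    case 1
    then obtain u where u: "\<gamma> = \<beta> @ u" by (rule prefixE)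
    have "(\<alpha> @ u, \<delta>) \<in> path_pairs"
      using assms path_append[of \<beta> u \<alpha>] u by (auto simp: path_pairs_def path_def)
    then show thesis using u left swap_mult_left by blast
  next
    case 2
    then obtain u where u: "\<beta> = \<gamma> @ u" by (rule prefixE)
    have "(\<alpha>, \<delta> @ u) \<in> path_pairs"
      using assms path_append[of \<gamma> u \<delta>] u by (auto simp: path_pairs_def path_def)
    then show thesis using u right swap_mult_right by blast
  next
    case 3
    then show thesis using zero swap_mult_zero by blast
  qed
qed

lemma swap_in_path_ops: "(\<alpha>, \<beta>) \<in> path_pairs \<Longrightarrow> swap \<alpha> \<beta> \<in> path_ops"
  unfolding path_ops_def by (rule op.span_base) auto

section \<open>Von Neumann regularity over acyclic graphs\<close>

text \<open>
  Paths inside a vertex set \<open>T\<close>, and the corresponding monomials.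
\<close>

definition paths_in :: "'v set \<Rightarrow> 'v list set" where
  "paths_in T = {p. path p \<and> set p \<subseteq> T}"

definition pairs_in :: "'v set \<Rightarrow> ('v list \<times> 'v list) set" where
  "pairs_in T = {(p, q). p \<in> paths_in T \<and> q \<in> paths_in T \<and> last p = last q}"

lemma pairs_in_subset: "pairs_in T \<subseteq> path_pairs"
  by (auto simp: pairs_in_def paths_in_def path_pairs_def)

lemma finite_paths_in:
  assumes "acyclic (arcs E)" "finite T"
  shows "finite (paths_in T)"
proof -
  have "distinct p" if "path p" for p
  proof -
    have "successively (\<lambda>a b. (a, b) \<in> (arcs E)\<^sup>+) p"
      using that by (auto simp: path_def intro: successively_mono)
    then have "sorted_wrt (\<lambda>a b. (a, b) \<in> (arcs E)\<^sup>+) p"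
      by (subst (asm) successively_conv_sorted_wrt) (auto intro: transpI)
    then show ?thesis
      using assms(1) by (auto simp: distinct_conv_nth sorted_wrt_iff_nth_less acyclic_def) (metis linorder_neqE_nat)
  qed
  then have "paths_in T \<subseteq> {p. set p \<subseteq> T \<and> distinct p}"
    by (auto simp: paths_in_def)
  then show ?thesis using finite_subset_distinct[OF assms(2)] by (rule finite_subset)
qed

lemma finite_pairs_in:
  assumes "acyclic (arcs E)" "finite T"
  shows "finite (pairs_in T)"
  by (rule finite_subset[of _ "paths_in T \<times> paths_in T"])
     (use finite_paths_in[OF assms] in \<open>auto simp: pairs_in_def\<close>)

lemma path_ops_local:
  assumes "a \<in> path_ops"
  obtains T where "finite T" "T \<subseteq> verts E" "a \<in> op.span ((\<lambda>(\<alpha>, \<beta>). swap \<alpha> \<beta>) ` pairs_in T)"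
proof -
  obtain S c where S: "finite S" "S \<subseteq> path_pairs" "a = (\<Sum>i\<in>S. smul (c i) (case i of (\<alpha>, \<beta>) \<Rightarrow> swap \<alpha> \<beta>))"
    by (rule span_indexed[OF assms[unfolded path_ops_def]])
  define T where "T = (\<Union>(\<alpha>, \<beta>)\<in>S. set \<alpha> \<union> set \<beta>)"
  have "S \<subseteq> pairs_in T"
    using S(2) by (fastforce simp: pairs_in_def paths_in_def T_def path_pairs_def)
  then have "a \<in> op.span ((\<lambda>(\<alpha>, \<beta>). swap \<alpha> \<beta>) ` pairs_in T)"
    unfolding S(3) by (intro op.span_sum op.span_scale op.span_base) auto
  moreover have "finite T" "T \<subseteq> verts E"
    using S by (auto simp: T_def path_pairs_def path_def)
  ultimately show thesis using that by blast
qed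

text \<open>
  The edges from \<open>v\<close> that stay in \<open>T\<close>, given by their ranges. For \<open>v = last p = last q\<close>, the operator
  \<open>unit_op T p q\<close> is \<open>p (v - \<Sum> e e\<^sup>*) q\<^sup>*\<close>, summed over these edges. On the words that are paths in
  \<open>T\<close> it acts as the matrix unit that takes \<open>q\<close> to \<open>p\<close>.
\<close>

definition exits :: "'v set \<Rightarrow> 'v \<Rightarrow> 'v set" where
  "exits T v = {b \<in> T. (v, b) \<in> arcs E}"

definition unit_op :: "'v set \<Rightarrow> 'v list \<Rightarrow> 'v list \<Rightarrow> ('v list, 'k::field) op" where
  "unit_op T p q = swap p q - (\<Sum>b\<in>exits T (last p). swap (p @ [b]) (q @ [b]))"

lemma swap_mult_unit_op: "last p = last q \<Longrightarrow> swap p q * unit_op T q q = unit_op T p q"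
  by (simp add: unit_op_def right_diff_distrib sum_distrib_left swap_mult_same swap_mult_left)

lemma unit_op_mult_swap: "unit_op T p p * swap p q = unit_op T p q"
  by (simp add: unit_op_def left_diff_distrib sum_distrib_right swap_mult_same swap_mult_right)

lemma swap_snoc_mult:
  "swap (q @ [b']) (q @ [b']) * swap (q @ b # u) s = (if b' = b then swap (q @ b # u) s else 0)"
  using swap_mult_left[of "q @ [b]" "q @ [b]" u s] by (auto intro!: swap_mult_zero)

lemma mult_swap_snoc:
  "swap s (q @ b # u) * swap (q @ [b']) (q @ [b']) = (if b' = b then swap s (q @ b # u) else 0)"
  using swap_mult_right[of s "q @ [b]" u "q @ [b]"] by (auto intro!: swap_mult_zero)

text \<open>
  A path that continues \<open>q\<close> inside \<open>T\<close> is removed by the correction terms.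
\<close>

lemma unit_op_kill:
  assumes "finite T" "b \<in> exits T (last q)"
  shows "unit_op T q q * swap (q @ b # u) s = 0" "swap s (q @ b # u) * unit_op T q q = 0"
proof -
  have "finite (exits T (last q))" using assms by (simp add: exits_def)
  then show "unit_op T q q * swap (q @ b # u) s = 0" "swap s (q @ b # u) * unit_op T q q = 0"
    using assms(2) swap_mult_left[of q q "b # u" s] swap_mult_right[of s q "b # u" q]
    by (simp_all add: unit_op_def left_diff_distrib right_diff_distrib sum_distrib_left sum_distrib_right
        swap_snoc_mult mult_swap_snoc)
qed

lemma unit_op_idem:
  assumes "finite T"
  shows "unit_op T q q * unit_op T q q = unit_op T q q"
proof -
  have "unit_op T q q * unit_op T q q
      = unit_op T q q * swap q q - (\<Sum>b\<in>exits T (last q). unit_op T q q * swap (q @ [b]) (q @ [b]))"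
    by (subst (2) unit_op_def) (simp add: right_diff_distrib sum_distrib_left)
  also have "(\<Sum>b\<in>exits T (last q). unit_op T q q * swap (q @ [b]) (q @ [b])) = 0"
    using unit_op_kill(1)[OF assms, of _ q "[]"] by (intro sum.neutral) auto
  finally show ?thesis by (simp add: unit_op_mult_swap)
qed

lemma unit_op_orthogonal:
  assumes "finite T" "q \<in> paths_in T" "r \<in> paths_in T" "q \<noteq> r"
  shows "unit_op T q q * unit_op T r r = (0 :: ('v list, 'k::field) op)"
proof -
  have ext: "\<exists>b u. y = x @ b # u \<and> b \<in> exits T (last x)"
    if "prefix x y" "x \<noteq> y" "x \<in> paths_in T" "y \<in> paths_in T" for x y
  proof -
    obtain u where "y = x @ u" using \<open>prefix x y\<close> by (rule prefixE)
    then obtain b u' where "y = x @ b # u'" using \<open>x \<noteq> y\<close> by (cases u) auto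
    then show ?thesis using that
      by (auto simp: paths_in_def path_def exits_def successively_append_iff)
  qed
  have q: "unit_op T q q * swap q q = (unit_op T q q :: ('v list, 'k) op)" by (rule unit_op_mult_swap)
  have r: "swap r r * unit_op T r r = (unit_op T r r :: ('v list, 'k) op)" by (simp add: swap_mult_unit_op)
  have split: "unit_op T q q * unit_op T r r
      = unit_op T q q * (swap q q * swap r r) * (unit_op T r r :: ('v list, 'k) op)"
    by (simp add: q r flip: mult.assoc) (simp add: mult.assoc r)
  consider "prefix q r" | "prefix r q" | "\<not> prefix q r" "\<not> prefix r q" by blast
  then show ?thesis
  proof cases
    case 1
    then obtain b u where "r = q @ b # u" "b \<in> exits T (last q)" using ext assms by metis
    then have "unit_op T q q * swap r r = (0 :: ('v list, 'k) op)" using unit_op_kill assms by metis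
    then show ?thesis using split by (simp add: mult.assoc[symmetric] q)
  next
    case 2
    then obtain b u where "q = r @ b # u" "b \<in> exits T (last r)" using ext assms by metis
    then have "swap q q * unit_op T r r = (0 :: ('v list, 'k) op)" using unit_op_kill assms by metis
    then show ?thesis using split by (simp add: mult.assoc r)
  next
    case 3
    then have "swap q q * swap r r = (0 :: ('v list, 'k) op)" by (rule swap_mult_zero)
    then show ?thesis using split by simp
  qed
qed

lemma unit_op_mult:
  assumes "finite T" "(p, q) \<in> pairs_in T" "(r, s) \<in> pairs_in T"
  shows "unit_op T p q * unit_op T r s = (if q = r then unit_op T p s else (0 :: ('v list, 'k::field) op))"
proof -
  have "unit_op T p q = swap p q * (unit_op T q q :: ('v list, 'k) op)"
    using assms(2) by (simp add: pairs_in_def swap_mult_unit_op)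
  moreover have "unit_op T r s = unit_op T r r * (swap r s :: ('v list, 'k) op)"
    by (simp add: unit_op_mult_swap)
  ultimately have "unit_op T p q * unit_op T r s
      = swap p q * (unit_op T q q * unit_op T r r) * (swap r s :: ('v list, 'k) op)"
    by (simp add: mult.assoc)
  also have "\<dots> = (if q = r then swap p q * unit_op T q q * swap q s else 0)"
    using assms by (auto simp: pairs_in_def unit_op_idem unit_op_orthogonal)
  also have "swap p q * unit_op T q q * swap q s = unit_op T p p * swap p q * (swap q s :: ('v list, 'k) op)"
    using assms(2) by (simp add: swap_mult_unit_op unit_op_mult_swap pairs_in_def)
  also have "\<dots> = unit_op T p s"
    unfolding mult.assoc swap_mult_same by (rule unit_op_mult_swap)
  finally show ?thesis by simp
qed

text \<open>
  Combinations of matrix units whose row index lies in \<open>R\<close>.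
\<close>

definition units_span :: "'v set \<Rightarrow> 'v list set \<Rightarrow> ('v list, 'k::field) op set" where
  "units_span T R = op.span ((\<lambda>(p, q). unit_op T p q) ` {(p, q) \<in> pairs_in T. p \<in> R})"

lemma unit_op_in_units_span: "(p, q) \<in> pairs_in T \<Longrightarrow> p \<in> R \<Longrightarrow> unit_op T p q \<in> units_span T R"
  unfolding units_span_def by (rule op.span_base) auto

lemma pairs_in_snoc:
  assumes "(p, q) \<in> pairs_in T" "b \<in> exits T (last p)"
  shows "(p @ [b], q @ [b]) \<in> pairs_in T"
  using assms path_snoc[of p b] path_snoc[of q b]
  by (auto simp: pairs_in_def paths_in_def exits_def path_def)

text \<open>
  From \<open>v = (v - \<Sum> e e\<^sup>*) + \<Sum> e e\<^sup>*\<close> every monomial in \<open>T\<close> is a matrix unit plus monomials that end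
  further along an edge of \<open>T\<close>; this recursion stops because \<open>T\<close> is finite and the graph is acyclic.
\<close>

lemma swap_in_units_span:
  assumes "acyclic (arcs E)" "finite T" "(p, q) \<in> pairs_in T"
  shows "swap p q \<in> (units_span T UNIV :: ('v list, 'k::field) op set)"
proof -
  have "wf ((arcs E \<inter> T \<times> T)\<inverse>)"
    using assms by (intro finite_acyclic_wf_converse) (auto intro: acyclic_subset)
  then have "\<forall>p q. (p, q) \<in> pairs_in T \<longrightarrow> last p = v \<longrightarrow>
      swap p q \<in> (units_span T UNIV :: ('v list, 'k) op set)" for v
  proof (induction v rule: wf_induct_rule)
    case (less v)
    show ?case
    proof (intro allI impI)
      fix p q assume pq: "(p, q) \<in> pairs_in T" "last p = v"
      then have "v \<in> T" by (auto simp: pairs_in_def paths_in_def path_def)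
      have "swap (p @ [b]) (q @ [b]) \<in> (units_span T UNIV :: ('v list, 'k) op set)" if "b \<in> exits T v" for b
        using less[of b] pairs_in_snoc[OF pq(1), of b] that pq(2) \<open>v \<in> T\<close> by (auto simp: exits_def)
      then have "unit_op T p q + (\<Sum>b\<in>exits T (last p). swap (p @ [b]) (q @ [b])) \<in> (units_span T UNIV :: ('v list, 'k) op set)"
        using pq unit_op_in_units_span[of p q T UNIV] unfolding units_span_def
        by (intro op.span_add op.span_sum) auto
      then show "swap p q \<in> (units_span T UNIV :: ('v list, 'k) op set)" by (simp add: unit_op_def)
    qed
  qed
  then show ?thesis using assms(3) by blast
qed

lemma units_span_mult:
  fixes a b :: "('v list, 'k::field) op"
  assumes "finite T" "a \<in> units_span T R" "b \<in> units_span T UNIV"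
  shows "a * b \<in> units_span T R"
  using assms(2,3) unfolding units_span_def
proof (rule mult_span_span)
  fix x y :: "('v list, 'k) op"
  assume "x \<in> (\<lambda>(p, q). unit_op T p q) ` {(p, q) \<in> pairs_in T. p \<in> R}"
    "y \<in> (\<lambda>(p, q). unit_op T p q) ` {(p, q) \<in> pairs_in T. p \<in> UNIV}"
  then obtain p q r s where h: "x = unit_op T p q" "y = unit_op T r s" "(p, q) \<in> pairs_in T" "(r, s) \<in> pairs_in T" "p \<in> R"
    by auto
  show "x * y \<in> op.span ((\<lambda>(p, q). unit_op T p q) ` {(p, q) \<in> pairs_in T. p \<in> R})"
  proof (cases "q = r")
    case True
    then have "(p, s) \<in> pairs_in T" using h by (auto simp: pairs_in_def)
    then show ?thesis using h True unit_op_in_units_span[of p s T R]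
      by (simp add: units_span_def unit_op_mult[OF assms(1)])
  next
    case False
    then show ?thesis using h by (simp add: op.span_zero unit_op_mult[OF assms(1)])
  qed
qed

lemma units_span_mono: "R \<subseteq> R' \<Longrightarrow> units_span T R \<subseteq> units_span T R'"
  unfolding units_span_def by (intro op.span_mono) auto

text \<open>McCoy's lemma: \<open>a\<close> is regular as soon as \<open>a - aya\<close> is regular for some \<open>y\<close>.\<close>

lemma mccoy:
  fixes a :: "'r::ring_1"
  assumes "a - a * y * a = (a - a * y * a) * x * (a - a * y * a)"
  shows "a = a * (y + x - y * a * x - x * a * y + y * a * x * a * y) * a"
proof -
  have "a = a * y * a + (a - a * y * a) * x * (a - a * y * a)"
    using assms by (metis add_diff_cancel_left' add_diff_eq)
  also have "\<dots> = a * (y + x - y * a * x - x * a * y + y * a * x * a * y) * a"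
    by (simp add: algebra_simps)
  finally show ?thesis .
qed

lemma units_span_diff_row:
  fixes a :: "('v list, 'k::field) op"
  assumes "finite T" "p \<in> paths_in T" "a \<in> units_span T (insert p R)"
  shows "a - unit_op T p p * a \<in> units_span T R"
  using assms(3) unfolding units_span_def
proof (induction rule: op.span_induct_alt)
  case base
  show ?case by (simp add: op.span_zero)
next
  case (step c x y)
  then obtain r s where h: "x = unit_op T r s" "(r, s) \<in> pairs_in T" "r \<in> insert p R" by auto
  have pp: "(p, p) \<in> pairs_in T" using assms by (simp add: pairs_in_def)
  have "x - unit_op T p p * x \<in> op.span ((\<lambda>(p, q). unit_op T p q) ` {(p, q) \<in> pairs_in T. p \<in> R})"
  proof (cases "r = p")
    case True
    then show ?thesis using h pp by (simp add: op.span_zero unit_op_mult[OF assms(1)])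
  next
    case False
    then show ?thesis using h pp by (auto simp: unit_op_mult[OF assms(1)] intro!: op.span_base)
  qed
  then have "smul c (x - unit_op T p p * x) + (y - unit_op T p p * y)
      \<in> op.span ((\<lambda>(p, q). unit_op T p q) ` {(p, q) \<in> pairs_in T. p \<in> R})"
    using step by (intro op.span_add op.span_scale) auto
  then show ?case
    by (simp add: algebra_simps mult_smul op.scale_right_diff_distrib)
qed

text \<open>
  Gaussian elimination: if \<open>a\<close> has a nonzero entry \<open>k\<close> in position \<open>(p, q)\<close>, then for
  \<open>y = k\<^sup>-\<^sup>1 \<cdot> unit_op T q p\<close> the matrix \<open>a - aya\<close> has row \<open>p\<close> equal to zero, and no new nonzero rows.
  By McCoy's lemma, induction on the set of rows applies.
\<close>

lemma units_span_regular:
  fixes a :: "('v list, 'k::field) op"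
  assumes "finite T" "finite R" "R \<subseteq> paths_in T" "a \<in> units_span T R"
  shows "\<exists>x\<in>units_span T UNIV. a = a * x * a"
  using assms(2,3,4)
proof (induction R arbitrary: a rule: finite_induct)
  case empty
  then have "a = 0" by (simp add: units_span_def)
  then show ?case by (intro bexI[of _ 0]) (auto simp: units_span_def op.span_zero)
next
  case (insert p R)
  have pp: "(p, p) \<in> pairs_in T" using insert by (auto simp: pairs_in_def)
  obtain S c where S: "finite S" "S \<subseteq> {(i, j) \<in> pairs_in T. i \<in> insert p R}"
    "\<And>i. i \<in> S \<Longrightarrow> c i \<noteq> 0" "a = (\<Sum>i\<in>S. smul (c i) (case i of (r, s) \<Rightarrow> unit_op T r s))"
    by (rule span_indexed[OF insert.prems(2)[unfolded units_span_def]], rule that)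
  show ?case
  proof (cases "\<exists>q. (p, q) \<in> S")
    case False
    then have "S \<subseteq> {(i, j) \<in> pairs_in T. i \<in> R}" using S(2) by auto
    then have "a \<in> units_span T R"
      unfolding S(4) units_span_def by (intro op.span_sum op.span_scale op.span_base) auto
    then show ?thesis using insert by auto
  next
    case True
    then obtain q where q: "(p, q) \<in> S" by blast
    have pq: "(p, q) \<in> pairs_in T" and qp: "(q, p) \<in> pairs_in T" and qq: "(q, q) \<in> pairs_in T"
      using q S(2) by (auto simp: pairs_in_def)
    define k where "k = c (p, q)"
    have k: "k \<noteq> 0" using S(3) q by (simp add: k_def)
    have "unit_op T p p * a * unit_op T q q = (\<Sum>i\<in>S. if i = (p, q) then smul k (unit_op T p q) else 0)"
      unfolding S(4) sum_distrib_left sum_distrib_right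
    proof (rule sum.cong)
      fix i assume i: "i \<in> S"
      obtain r s where rs: "i = (r, s)" by force
      then have rs': "(r, s) \<in> pairs_in T" using i S(2) by auto
      show "unit_op T p p * smul (c i) (case i of (r, s) \<Rightarrow> unit_op T r s) * unit_op T q q =
          (if i = (p, q) then smul k (unit_op T p q) else 0)"
        using pp rs' qq pq by (auto simp: rs mult_smul smul_mult k_def unit_op_mult[OF assms(1)])
    qed simp
    also have "\<dots> = smul k (unit_op T p q)" using S(1) q by simp
    finally have corner: "unit_op T p p * a * unit_op T q q = smul k (unit_op T p q)" .
    define y where "y = smul (inverse k) (unit_op T q p :: ('v list, 'k) op)"
    have y: "y \<in> units_span T UNIV"
      using unit_op_in_units_span[OF qp UNIV_I] unfolding y_def units_span_def by (rule op.span_scale)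
    have qy: "unit_op T q q * y = y"
      using qq qp by (simp add: y_def mult_smul unit_op_mult[OF assms(1)])
    have "unit_op T p p * a * y = unit_op T p p * a * unit_op T q q * y"
      using qy by (simp add: mult.assoc)
    also have "\<dots> = unit_op T p p"
      using corner pq qp k by (simp add: y_def mult_smul smul_mult unit_op_mult[OF assms(1)])
    finally have row: "unit_op T p p * a * y = unit_op T p p" .
    define a' where "a' = a - a * y * a"
    have aU: "a \<in> units_span T UNIV"
      using insert.prems(2) units_span_mono[of "insert p R" UNIV T] by blast
    have "a' \<in> units_span T (insert p R)"
      using insert.prems(2) units_span_mult[OF assms(1) units_span_mult[OF assms(1) insert.prems(2) y] aU]
      unfolding a'_def units_span_def by (rule op.span_diff)
    moreover have "unit_op T p p * a' = 0"
      using row by (simp add: a'_def right_diff_distrib flip: mult.assoc)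
    ultimately have "a' \<in> units_span T R"
      using units_span_diff_row[OF assms(1), of p a' R] insert.prems(1) by auto
    then obtain x where x: "x \<in> units_span T UNIV" "a' = a' * x * a'"
      using insert by auto
    have m: "u * v \<in> units_span T UNIV" if "u \<in> units_span T UNIV" "v \<in> units_span T UNIV" for u v :: "('v list, 'k) op"
      using units_span_mult[OF assms(1)] that .
    have "y + x - y * a * x - x * a * y + y * a * x * a * y \<in> units_span T UNIV"
      using m[OF m[OF y aU] x(1)] m[OF m[OF x(1) aU] y] m[OF m[OF m[OF m[OF y aU] x(1)] aU] y] x(1) y
      unfolding units_span_def by (intro op.span_add op.span_diff)
    then show ?thesis
      using mccoy[OF x(2)[unfolded a'_def]] by blast
  qed
qed

lemma path_ops_regular:
  assumes "acyclic (arcs E)" "a \<in> path_ops"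
  shows "\<exists>x\<in>path_ops. a = a * x * (a :: ('v list, 'k::field) op)"
proof -
  obtain T where T: "finite T" "a \<in> op.span ((\<lambda>(\<alpha>, \<beta>). swap \<alpha> \<beta>) ` pairs_in T)"
    using path_ops_local[OF assms(2)] by blast
  have "op.span ((\<lambda>(\<alpha>, \<beta>). swap \<alpha> \<beta>) ` pairs_in T) \<subseteq> (units_span T (paths_in T) :: ('v list, 'k) op set)"
  proof (rule op.span_minimal)
    show "(\<lambda>(\<alpha>, \<beta>). swap \<alpha> \<beta>) ` pairs_in T \<subseteq> (units_span T (paths_in T) :: ('v list, 'k) op set)"
    proof -
      have "{(p, q) \<in> pairs_in T. p \<in> UNIV} = {(p, q) \<in> pairs_in T. p \<in> paths_in T}"
        by (auto simp: pairs_in_def)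
      then show ?thesis using swap_in_units_span[OF assms(1) T(1)] unfolding units_span_def by auto
    qed
    show "op.subspace (units_span T (paths_in T) :: ('v list, 'k) op set)"
      unfolding units_span_def by (rule op.subspace_span)
  qed
  then obtain x where x: "x \<in> units_span T UNIV" "a = a * x * a"
    using units_span_regular[OF T(1) finite_paths_in[OF assms(1) T(1)], of a] T(2) by blast
  have "units_span T UNIV \<subseteq> (path_ops :: ('v list, 'k) op set)"
    unfolding units_span_def
  proof (rule op.span_minimal)
    have "unit_op T p q \<in> (path_ops :: ('v list, 'k) op set)" if "(p, q) \<in> pairs_in T" for p q
      using that pairs_in_subset pairs_in_snoc[OF that] swap_in_path_ops
      unfolding unit_op_def path_ops_def by (intro op.span_diff op.span_sum) blast+
    then show "(\<lambda>(p, q). unit_op T p q) ` {(p, q) \<in> pairs_in T. p \<in> UNIV} \<subseteq> (path_ops :: ('v list, 'k) op set)"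
      by auto
    show "op.subspace (path_ops :: ('v list, 'k) op set)"
      unfolding path_ops_def by (rule op.subspace_span)
  qed
  with x show ?thesis by blast
qed

end


section \<open>Simple faithful modules\<close>

lemma left_module_smult_zero:
  assumes "left_module R M"
  shows "a \<in> carrier R \<Longrightarrow> a \<odot>\<^bsub>M\<^esub> \<zero>\<^bsub>M\<^esub> = \<zero>\<^bsub>M\<^esub>"
    and "x \<in> carrier M \<Longrightarrow> \<zero>\<^bsub>R\<^esub> \<odot>\<^bsub>M\<^esub> x = \<zero>\<^bsub>M\<^esub>"
proof -
  interpret left_module R M by fact
  show "a \<odot>\<^bsub>M\<^esub> \<zero>\<^bsub>M\<^esub> = \<zero>\<^bsub>M\<^esub>" if "a \<in> carrier R"
    using act_r_distr[OF that M.zero_closed M.zero_closed] act_closed[OF that M.zero_closed] by simp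
  show "\<zero>\<^bsub>R\<^esub> \<odot>\<^bsub>M\<^esub> x = \<zero>\<^bsub>M\<^esub>" if "x \<in> carrier M"
    using act_l_distr[of "\<zero>\<^bsub>R\<^esub>" "\<zero>\<^bsub>R\<^esub>" x] act_closed[of "\<zero>\<^bsub>R\<^esub>" x] that by simp
qed

lemma submoduleI_left_module:
  assumes "left_module R M" "N \<subseteq> carrier M" "\<zero>\<^bsub>M\<^esub> \<in> N"
    and "\<And>x y. x \<in> N \<Longrightarrow> y \<in> N \<Longrightarrow> x \<oplus>\<^bsub>M\<^esub> y \<in> N"
    and "\<And>x. x \<in> N \<Longrightarrow> \<ominus>\<^bsub>M\<^esub> x \<in> N"
    and "\<And>a x. a \<in> carrier R \<Longrightarrow> x \<in> N \<Longrightarrow> a \<odot>\<^bsub>M\<^esub> x \<in> N"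
  shows "submodule N R M"
proof -
  interpret left_module R M by fact
  have "subgroup N (add_monoid M)"
    by (rule M.add.subgroupI) (use assms in auto)
  then show ?thesis using assms(6) by (simp add: submodule_def submodule_axioms_def)
qed

text \<open>
  The vectors killed by a nonzero ideal \<open>I\<close> form a submodule, which is zero because the module is
  simple and faithful; hence \<open>Im\<close> is a nonzero submodule for each
  \<open>m \<noteq> 0\<close>, which is the whole module.
\<close>

lemma ideal_fixes_vector:
  assumes "simple_left_module R M" "faithful_left_module R M"
    and "two_sided_ideal I R" "b \<in> I" "b \<noteq> \<zero>\<^bsub>R\<^esub>"
    and m: "m \<in> carrier M" "m \<noteq> \<zero>\<^bsub>M\<^esub>"
  shows "\<exists>a\<in>I. a \<odot>\<^bsub>M\<^esub> m = m"
proof -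
  have LM: "left_module R M" using assms(1) by (simp add: simple_left_module_def)
  interpret left_module R M by (rule LM)
  have R: "abelian_group R" by unfold_locales
  interpret I: additive_subgroup I R using assms(3) by (simp add: two_sided_ideal_def)
  have IR: "a \<in> carrier R" if "a \<in> I" for a using that by (rule I.a_Hcarr)
  have id: "a \<otimes>\<^bsub>R\<^esub> x \<in> I" "x \<otimes>\<^bsub>R\<^esub> a \<in> I" if "x \<in> I" "a \<in> carrier R" for a x
    using assms(3) that by (auto simp: two_sided_ideal_def)
  have simple: "N = {\<zero>\<^bsub>M\<^esub>} \<or> N = carrier M" if "submodule N R M" for N
    using assms(1) that by (simp add: simple_left_module_def)
  have neg: "a \<odot>\<^bsub>M\<^esub> (\<ominus>\<^bsub>M\<^esub> x) = \<ominus>\<^bsub>M\<^esub> (a \<odot>\<^bsub>M\<^esub> x)" "(\<ominus>\<^bsub>R\<^esub> a) \<odot>\<^bsub>M\<^esub> x = \<ominus>\<^bsub>M\<^esub> (a \<odot>\<^bsub>M\<^esub> x)"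
    if "a \<in> carrier R" "x \<in> carrier M" for a x
  proof -
    have "a \<odot>\<^bsub>M\<^esub> (\<ominus>\<^bsub>M\<^esub> x) \<oplus>\<^bsub>M\<^esub> a \<odot>\<^bsub>M\<^esub> x = \<zero>\<^bsub>M\<^esub>"
      using act_r_distr[of a "\<ominus>\<^bsub>M\<^esub> x" x] that left_module_smult_zero(1)[OF LM]
      by (simp add: M.l_neg)
    then show "a \<odot>\<^bsub>M\<^esub> (\<ominus>\<^bsub>M\<^esub> x) = \<ominus>\<^bsub>M\<^esub> (a \<odot>\<^bsub>M\<^esub> x)"
      using that act_closed by (intro M.minus_equality[symmetric]) auto
    have "(\<ominus>\<^bsub>R\<^esub> a) \<odot>\<^bsub>M\<^esub> x \<oplus>\<^bsub>M\<^esub> a \<odot>\<^bsub>M\<^esub> x = \<zero>\<^bsub>M\<^esub>"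
      using act_l_distr[of "\<ominus>\<^bsub>R\<^esub> a" a x] that left_module_smult_zero(2)[OF LM]
      by (simp add: abelian_group.l_neg[OF R])
    then show "(\<ominus>\<^bsub>R\<^esub> a) \<odot>\<^bsub>M\<^esub> x = \<ominus>\<^bsub>M\<^esub> (a \<odot>\<^bsub>M\<^esub> x)"
      using that act_closed by (intro M.minus_equality[symmetric]) auto
  qed
  let ?A = "{x \<in> carrier M. \<forall>a\<in>I. a \<odot>\<^bsub>M\<^esub> x = \<zero>\<^bsub>M\<^esub>}"
  have "submodule ?A R M"
  proof (rule submoduleI_left_module[OF LM])
    fix a x assume ax: "a \<in> carrier R" "x \<in> ?A"
    then have "c \<odot>\<^bsub>M\<^esub> (a \<odot>\<^bsub>M\<^esub> x) = \<zero>\<^bsub>M\<^esub>" if "c \<in> I" for c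
      using that id(2)[OF that ax(1)] act_assoc[OF IR[OF that] ax(1), of x] by auto
    then show "a \<odot>\<^bsub>M\<^esub> x \<in> ?A" using ax act_closed by simp
  qed (use IR left_module_smult_zero[OF LM] neg act_r_distr in auto)
  moreover have "?A \<noteq> carrier M"
  proof
    assume "?A = carrier M"
    then have "\<forall>x\<in>carrier M. b \<odot>\<^bsub>M\<^esub> x = \<zero>\<^bsub>M\<^esub>" using assms(4) by blast
    then show False using assms(2,5) IR[OF assms(4)] by (auto simp: faithful_left_module_def)
  qed
  ultimately have A: "?A = {\<zero>\<^bsub>M\<^esub>}" using simple by blast
  let ?B = "(\<lambda>a. a \<odot>\<^bsub>M\<^esub> m) ` I"
  have "submodule ?B R M"
  proof (rule submoduleI_left_module[OF LM])
    show "?B \<subseteq> carrier M" using IR act_closed m by auto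
    show "\<zero>\<^bsub>M\<^esub> \<in> ?B" using left_module_smult_zero(2)[OF LM m(1)] I.zero_closed by (metis imageI)
  next
    fix x y assume "x \<in> ?B" "y \<in> ?B"
    then obtain a c where "a \<in> I" "c \<in> I" "x = a \<odot>\<^bsub>M\<^esub> m" "y = c \<odot>\<^bsub>M\<^esub> m" by blast
    then have "x \<oplus>\<^bsub>M\<^esub> y = (a \<oplus>\<^bsub>R\<^esub> c) \<odot>\<^bsub>M\<^esub> m" "a \<oplus>\<^bsub>R\<^esub> c \<in> I"
      using act_l_distr IR m by auto
    then show "x \<oplus>\<^bsub>M\<^esub> y \<in> ?B" by blast
  next
    fix x assume "x \<in> ?B"
    then obtain a where a: "a \<in> I" "x = a \<odot>\<^bsub>M\<^esub> m" by blast
    then have "\<ominus>\<^bsub>M\<^esub> x = (\<ominus>\<^bsub>R\<^esub> a) \<odot>\<^bsub>M\<^esub> m" using neg(2) IR m by simp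
    then show "\<ominus>\<^bsub>M\<^esub> x \<in> ?B" using I.a_inv_closed[OF a(1)] by blast
  next
    fix c x assume c: "c \<in> carrier R" "x \<in> ?B"
    then obtain a where a: "a \<in> I" "x = a \<odot>\<^bsub>M\<^esub> m" by blast
    then have "c \<odot>\<^bsub>M\<^esub> x = (c \<otimes>\<^bsub>R\<^esub> a) \<odot>\<^bsub>M\<^esub> m" using act_assoc IR c m by simp
    then show "c \<odot>\<^bsub>M\<^esub> x \<in> ?B" using id(1)[OF a(1) c(1)] by blast
  qed
  moreover have "?B \<noteq> {\<zero>\<^bsub>M\<^esub>}"
  proof
    assume "?B = {\<zero>\<^bsub>M\<^esub>}"
    then have "m \<in> ?A" using m by auto
    then show False using A m by simp
  qed
  ultimately have "?B = carrier M" using simple by blast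
  then have "m \<in> ?B" using m by simp
  then show ?thesis by (metis imageE)
qed


section \<open>Operators over the graph of finite subsets\<close>

lemma finite_subset_graph_simps:
  "verts (finite_subset_graph X) = {A. A \<subseteq> X \<and> finite A \<and> A \<noteq> {}}"
  "(A, B) \<in> arcs (finite_subset_graph X) \<longleftrightarrow>
     A \<in> verts (finite_subset_graph X) \<and> B \<in> verts (finite_subset_graph X) \<and> A \<subset> B"
  "tail (finite_subset_graph X) = fst" "head (finite_subset_graph X) = snd"
  by (simp_all add: finite_subset_graph_def Let_def)

lemma irregular_digraph_finite_subset_graph:
  assumes "infinite X"
  shows "irregular_digraph (finite_subset_graph X)"
proof (intro irregular_digraph.intro irregular_digraph_axioms.intro wf_finite_subset_graph)
  let ?E = "finite_subset_graph X"
  fix v assume fin: "finite {e \<in> arcs ?E. tail ?E e = v}"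
  show "{e \<in> arcs ?E. tail ?E e = v} = {}"
  proof (cases "v \<in> verts ?E")
    case True
    have "(\<lambda>x. (v, insert x v)) ` (X - v) \<subseteq> {e \<in> arcs ?E. tail ?E e = v}"
      using True by (auto simp: finite_subset_graph_simps)
    moreover have "inj_on (\<lambda>x. (v, insert x v)) (X - v)"
      by (auto simp: inj_on_def)
    moreover have "infinite (X - v)" using assms True by (auto simp: finite_subset_graph_simps)
    ultimately show ?thesis using finite_imageD[OF finite_subset[OF _ fin]] by blast
  next
    case False
    then show ?thesis using wf_digraph.tail_in_verts[OF wf_finite_subset_graph] by blast
  qed
next
  show "infinite (UNIV :: 'a set set)"
    using assms by (metis Finite_Set.finite_set finite_subset subset_UNIV)
qed (simp_all add: finite_subset_graph_simps)

lemma acyclic_finite_subset_graph: "acyclic (arcs (finite_subset_graph X))"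
proof -
  have "(A, B) \<in> (arcs (finite_subset_graph X))\<^sup>+ \<Longrightarrow> A \<subset> B" for A B
    by (induction rule: trancl_induct) (auto simp: finite_subset_graph_simps)
  then show ?thesis by (auto simp: acyclic_def)
qed

text \<open>
  The graph of finite subsets of an infinite set: every vertex emits infinitely many edges.
\<close>

locale infinite_set =
  fixes X :: "'x set"
  assumes infinite_X: "infinite X"
begin

sublocale irregular_digraph "finite_subset_graph X"
  by (rule irregular_digraph_finite_subset_graph[OF infinite_X])

text \<open>
  Every nonzero ideal contains all vertices above some vertex \<open>A\<close>.
\<close>

lemma swap_corner_in_path_ops:
  fixes a :: "('x set list, 'k::field) op"
  assumes "a \<in> path_ops" "a \<noteq> 0"
  obtains A where "A \<in> verts (finite_subset_graph X)"
    "\<And>B. B \<in> verts (finite_subset_graph X) \<Longrightarrow> A \<subseteq> B \<Longrightarrow>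
       \<exists>x\<in>path_ops. \<exists>y\<in>path_ops. x * a * y = swap [B] [B]"
proof -
  obtain S c where S: "finite S" "S \<subseteq> path_pairs" "\<And>i. i \<in> S \<Longrightarrow> c i \<noteq> 0"
    "a = (\<Sum>i\<in>S. smul (c i) (case i of (\<alpha>, \<beta>) \<Rightarrow> swap \<alpha> \<beta>))"
    by (rule span_indexed[OF assms(1)[unfolded path_ops_def]], rule that)
  have a: "a = (\<Sum>(\<alpha>, \<beta>)\<in>S. smul (c (\<alpha>, \<beta>)) (swap \<alpha> \<beta>))"
    unfolding S(4) by (rule sum.cong) auto
  have ne: "S \<noteq> {}" using assms(2) S(4) by auto
  obtain p q where pq: "(p, q) \<in> S"
    "\<And>f. (\<And>\<alpha> \<beta>. (\<alpha>, \<beta>) \<in> S \<Longrightarrow> f \<notin> set \<alpha> \<union> set \<beta>) \<Longrightarrow>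
       swap [f] (p @ [f]) * (\<Sum>(\<alpha>, \<beta>)\<in>S. smul (c (\<alpha>, \<beta>)) (swap \<alpha> \<beta>)) * swap (q @ [f]) [f]
         = smul (c (p, q)) (swap [f] [f])"
    using swap_sum_corner[OF S(1) ne, of c] by blast
  let ?V = "\<Union>(\<alpha>, \<beta>)\<in>S. set \<alpha> \<union> set \<beta>"
  have V: "?V \<subseteq> verts (finite_subset_graph X)"
    using S(2) by (auto simp: path_pairs_def path_def)
  have finU: "finite (\<Union>?V)"
    using S(1) V by (intro finite_Union) (auto simp: finite_subset_graph_simps)
  obtain x where x: "x \<in> X" "x \<notin> \<Union>?V"
    using infinite_X finU by (metis finite_subset subsetI)
  \<comment> \<open>Every \<open>B\<close> above \<open>?A\<close> is a fresh letter, and there is an edge from the end of \<open>p\<close> and \<open>q\<close> to it.\<close>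
  let ?A = "insert x (\<Union>?V)"
  have "?A \<in> verts (finite_subset_graph X)"
    using finU V x(1) by (auto simp: finite_subset_graph_simps)
  moreover have "\<exists>y\<in>path_ops. \<exists>z\<in>path_ops. y * a * z = swap [B] [B]"
    if B: "B \<in> verts (finite_subset_graph X)" "?A \<subseteq> B" for B
  proof -
    have new: "B \<notin> ?V" using B(2) x(2) by blast
    then have "swap [B] (p @ [B]) * a * swap (q @ [B]) [B] = smul (c (p, q)) (swap [B] [B])"
      unfolding a by (intro pq(2)) blast
    then have "smul (inverse (c (p, q))) (swap [B] (p @ [B])) * a * swap (q @ [B]) [B] = swap [B] [B]"
      using S(3)[OF pq(1)] by (simp add: smul_mult)
    moreover have "(p @ [B], [B]) \<in> path_pairs" "([B], q @ [B]) \<in> path_pairs"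
      "([B], p @ [B]) \<in> path_pairs" "(q @ [B], [B]) \<in> path_pairs"
    proof -
      have pp: "path p" "path q" "last p = last q" "p \<noteq> []" "q \<noteq> []"
        using pq(1) S(2) by (auto simp: path_pairs_def path_def)
      then have "last p \<in> ?V" using pq(1) by (force intro: last_in_set)
      then have "last p \<subset> B" using B(2) new by blast
      moreover have "last p \<in> verts (finite_subset_graph X)" using pp path_last by blast
      ultimately have "(last p, B) \<in> arcs (finite_subset_graph X)"
        using B(1) by (simp add: finite_subset_graph_simps)
      then show "(p @ [B], [B]) \<in> path_pairs" "([B], q @ [B]) \<in> path_pairs"
        "([B], p @ [B]) \<in> path_pairs" "(q @ [B], [B]) \<in> path_pairs"
        using pp B(1) by (auto simp: path_pairs_def path_snoc path_single)
    qed
    then have "swap [B] (p @ [B]) \<in> (path_ops :: ('x set list, 'k) op set)"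
      "swap (q @ [B]) [B] \<in> (path_ops :: ('x set list, 'k) op set)"
      by (simp_all add: swap_in_path_ops)
    moreover have "smul (inverse (c (p, q))) (swap [B] (p @ [B])) \<in> path_ops"
      using calculation(2) unfolding path_ops_def by (rule op.span_scale)
    ultimately show ?thesis by blast
  qed
  ultimately show thesis using that by blast
qed

lemma path_last_mono: "path (\<gamma> @ u) \<Longrightarrow> \<gamma> \<noteq> [] \<Longrightarrow> last \<gamma> \<subseteq> last (\<gamma> @ u)"
proof (induction u rule: rev_induct)
  case (snoc b u)
  then have "path (\<gamma> @ u)" "(last (\<gamma> @ u), b) \<in> arcs (finite_subset_graph X)"
    using path_snoc[of "\<gamma> @ u" b] by auto
  then show ?case using snoc by (auto simp: finite_subset_graph_simps)
qed simp

text \<open>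
  \<open>ops_above x\<close> is the ideal generated by the vertex \<open>{x}\<close>: it is spanned by the monomials
  \<open>\<alpha>\<beta>\<^sup>*\<close> whose paths end in a set containing \<open>x\<close>.
\<close>

definition pairs_above :: "'x \<Rightarrow> ('x set list \<times> 'x set list) set" where
  "pairs_above x = {(\<alpha>, \<beta>) \<in> path_pairs. x \<in> last \<alpha>}"

definition ops_above :: "'x \<Rightarrow> ('x set list, 'k::field) op set" where
  "ops_above x = op.span ((\<lambda>(\<alpha>, \<beta>). swap \<alpha> \<beta>) ` pairs_above x)"

lemma ops_above_subset: "ops_above x \<subseteq> path_ops"
  unfolding ops_above_def path_ops_def by (rule op.span_mono) (auto simp: pairs_above_def)

lemma ops_above_ideal:
  fixes a b :: "('x set list, 'k::field) op"
  assumes "a \<in> path_ops" "b \<in> ops_above x"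
  shows "a * b \<in> ops_above x" "b * a \<in> ops_above x"
proof -
  have sw: "swap \<alpha> \<beta> \<in> (ops_above x :: ('x set list, 'k) op set)" if "(\<alpha>, \<beta>) \<in> pairs_above x" for \<alpha> \<beta>
    unfolding ops_above_def using that by (intro op.span_base) auto
  have z: "0 \<in> (ops_above x :: ('x set list, 'k) op set)"
    unfolding ops_above_def by (rule op.span_zero)
  show "a * b \<in> ops_above x"
    using assms unfolding path_ops_def ops_above_def
  proof (rule mult_span_span, fold ops_above_def)
    fix s t :: "('x set list, 'k) op"
    assume "s \<in> (\<lambda>(\<alpha>, \<beta>). swap \<alpha> \<beta>) ` path_pairs" "t \<in> (\<lambda>(\<alpha>, \<beta>). swap \<alpha> \<beta>) ` pairs_above x"
    then obtain \<alpha> \<beta> \<gamma> \<delta> where h: "(\<alpha>, \<beta>) \<in> path_pairs" "(\<gamma>, \<delta>) \<in> path_pairs" "x \<in> last \<gamma>"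
      "s = swap \<alpha> \<beta>" "t = swap \<gamma> \<delta>"
      by (auto simp: pairs_above_def)
    from h(1,2) show "s * t \<in> ops_above x"
    proof (cases rule: path_pairs_mult_cases[where ?'k = 'k])
      case zero
      then show ?thesis using h z by simp
    next
      case (left u)
      then have "(\<alpha> @ u, \<delta>) \<in> pairs_above x"
        using h by (auto simp: pairs_above_def path_pairs_def)
      then show ?thesis using left h sw by simp
    next
      case (right u)
      then have "last \<gamma> \<subseteq> last \<beta>" using h path_last_mono[of \<gamma> u] by (auto simp: path_pairs_def path_def)
      then have "(\<alpha>, \<delta> @ u) \<in> pairs_above x"
        using right h by (auto simp: pairs_above_def path_pairs_def)
      then show ?thesis using right h sw by simp
    qed
  qed
  show "b * a \<in> ops_above x"
    using assms(2,1) unfolding path_ops_def ops_above_def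
  proof (rule mult_span_span, fold ops_above_def)
    fix s t :: "('x set list, 'k) op"
    assume "s \<in> (\<lambda>(\<alpha>, \<beta>). swap \<alpha> \<beta>) ` pairs_above x" "t \<in> (\<lambda>(\<alpha>, \<beta>). swap \<alpha> \<beta>) ` path_pairs"
    then obtain \<alpha> \<beta> \<gamma> \<delta> where h: "(\<alpha>, \<beta>) \<in> path_pairs" "(\<gamma>, \<delta>) \<in> path_pairs" "x \<in> last \<beta>"
      "s = swap \<alpha> \<beta>" "t = swap \<gamma> \<delta>"
      by (auto simp: pairs_above_def path_pairs_def)
    from h(1,2) show "s * t \<in> ops_above x"
    proof (cases rule: path_pairs_mult_cases[where ?'k = 'k])
      case zero
      then show ?thesis using h z by simp
    next
      case (left u)
      then have "last \<beta> \<subseteq> last \<gamma>" using h path_last_mono[of \<beta> u] by (auto simp: path_pairs_def path_def)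
      then have "(\<alpha> @ u, \<delta>) \<in> pairs_above x"
        using left h by (auto simp: pairs_above_def path_pairs_def)
      then show ?thesis using left h sw by simp
    next
      case (right u)
      then have "(\<alpha>, \<delta> @ u) \<in> pairs_above x"
        using h by (auto simp: pairs_above_def path_pairs_def)
      then show ?thesis using right h sw by simp
    qed
  qed
qed

text \<open>
  Let \<open>D x\<close> be the finite union of the ranges of the paths in \<open>a x\<close>. If \<open>a x * a y \<noteq> 0\<close> then two of
  the paths are comparable, and the last set of the shorter one is contained in that of the longer
  one; so \<open>x \<in> D y\<close> or \<open>y \<in> D x\<close>. This cannot hold for all pairs: take an infinite countable
  \<open>C \<subseteq> X\<close> and, by uncountability, a \<open>y \<in> X\<close> outside the countable set \<open>\<Union>x\<in>C. D x\<close>; then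
  \<open>C \<subseteq> D y\<close>.
\<close>

lemma ops_above_product_zero:
  fixes a :: "'x \<Rightarrow> ('x set list, 'k::field) op"
  assumes "uncountable X" "\<And>x. x \<in> X \<Longrightarrow> a x \<in> ops_above x"
  shows "\<exists>x\<in>X. \<exists>y\<in>X. a x * a y = 0"
proof (rule ccontr)
  assume contra: "\<not> ?thesis"
  have "\<exists>S. finite S \<and> S \<subseteq> pairs_above x \<and> a x \<in> op.span ((\<lambda>(\<alpha>, \<beta>). swap \<alpha> \<beta>) ` S)" if "x \<in> X" for x
  proof -
    obtain S c where S: "finite S" "S \<subseteq> pairs_above x"
      "a x = (\<Sum>i\<in>S. smul (c i) (case i of (\<alpha>, \<beta>) \<Rightarrow> swap \<alpha> \<beta>))"
      by (rule span_indexed[OF assms(2)[OF \<open>x \<in> X\<close>, unfolded ops_above_def]])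
    then have "a x \<in> op.span ((\<lambda>(\<alpha>, \<beta>). swap \<alpha> \<beta>) ` S)"
      unfolding S(3) by (intro op.span_sum op.span_scale op.span_base) auto
    with S show ?thesis by blast
  qed
  then obtain S where S: "\<And>x. x \<in> X \<Longrightarrow> finite (S x)" "\<And>x. x \<in> X \<Longrightarrow> S x \<subseteq> pairs_above x"
    "\<And>x. x \<in> X \<Longrightarrow> a x \<in> op.span ((\<lambda>(\<alpha>, \<beta>). swap \<alpha> \<beta>) ` S x)"
    by metis
  define D where "D x = (\<Union>(\<alpha>, \<beta>)\<in>S x. last \<alpha>)" for x
  have finD: "finite (D x)" if "x \<in> X" for x
  proof -
    have "finite (last \<alpha>)" if "(\<alpha>, \<beta>) \<in> S x" for \<alpha> \<beta>
      using that S(2)[OF \<open>x \<in> X\<close>] path_last[of \<alpha>]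
      by (auto simp: pairs_above_def path_pairs_def finite_subset_graph_simps)
    then show ?thesis using S(1)[OF that] by (auto simp: D_def)
  qed
  have comp: "x \<in> D y \<or> y \<in> D x" if xy: "x \<in> X" "y \<in> X" for x y
  proof (rule ccontr)
    assume no: "\<not> (x \<in> D y \<or> y \<in> D x)"
    have "(case i of (\<alpha>, \<beta>) \<Rightarrow> swap \<alpha> \<beta>) * (case j of (\<alpha>, \<beta>) \<Rightarrow> swap \<alpha> \<beta>) = (0 :: ('x set list, 'k) op)"
      if ij: "i \<in> S x" "j \<in> S y" for i j
    proof -
      obtain \<alpha> \<beta> \<gamma> \<delta> where e: "i = (\<alpha>, \<beta>)" "j = (\<gamma>, \<delta>)" by force
      have h: "(\<alpha>, \<beta>) \<in> path_pairs" "x \<in> last \<beta>" "(\<gamma>, \<delta>) \<in> path_pairs" "y \<in> last \<gamma>" "\<beta> \<noteq> []" "\<gamma> \<noteq> []"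
        using ij e S(2)[OF xy(1)] S(2)[OF xy(2)] by (auto simp: pairs_above_def path_pairs_def path_def)
      have "y \<notin> last \<beta>" "x \<notin> last \<gamma>"
        using no ij e h(1) by (force simp: D_def path_pairs_def)+
      then have "\<not> prefix \<beta> \<gamma>" "\<not> prefix \<gamma> \<beta>"
        using h path_last_mono by (fastforce simp: path_pairs_def elim!: prefixE)+
      then show ?thesis by (simp add: e swap_mult_zero)
    qed
    then have "a x * a y \<in> op.span {}"
      by (intro mult_span_span[OF S(3)[OF xy(1)] S(3)[OF xy(2)]]) auto
    then have "a x * a y = 0" by simp
    then show False using contra xy by blast
  qed
  obtain C where C: "C \<subseteq> X" "infinite C" "countable C"
    using infinite_countable_subset'[OF infinite_X] by blast
  have "countable (\<Union>x\<in>C. D x)" using C finD by (auto intro: countable_finite)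
  then obtain y where y: "y \<in> X" "y \<notin> (\<Union>x\<in>C. D x)"
    using assms(1) by (metis countable_subset subsetI)
  then have "C \<subseteq> D y" using comp C(1) by blast
  then show False using C(2) finD[OF y(1)] finite_subset by blast
qed

end


section \<open>Counting orthogonal idempotents\<close>

lemma finite_orthogonal_idempotents:
  fixes e :: "'i \<Rightarrow> ('b, 'k::field) op"
  assumes "finite B" "\<And>i. i \<in> I \<Longrightarrow> e i \<in> op.span B" "\<And>i. i \<in> I \<Longrightarrow> e i \<noteq> 0"
    and idem: "\<And>i. i \<in> I \<Longrightarrow> e i * e i = e i"
    and orth: "\<And>i j. i \<in> I \<Longrightarrow> j \<in> I \<Longrightarrow> i \<noteq> j \<Longrightarrow> e i * e j = 0"
  shows "finite I"
proof -
  have inj: "inj_on e I"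
    by (rule inj_onI) (metis assms(3) idem orth)
  have "op.independent (e ` I)"
    unfolding op.independent_explicit_module
  proof (intro allI impI)
    fix t u v assume t: "finite t" "t \<subseteq> e ` I" "(\<Sum>v\<in>t. smul (u v) v) = 0" "v \<in> t"
    have "v * w = (if w = v then v else 0)" if "w \<in> t" for w
      using that t(2,4) idem orth by (auto; blast)
    then have "v * (\<Sum>w\<in>t. smul (u w) w) = (\<Sum>w\<in>t. if w = v then smul (u v) v else 0)"
      unfolding sum_distrib_left by (intro sum.cong) (auto simp: mult_smul)
    also have "\<dots> = smul (u v) v" using t by simp
    finally have "smul (u v) v = 0" using t by simp
    then show "u v = 0" using t(2,4) assms(3) by auto
  qed
  then have "finite (e ` I)"
    using op.independent_span_bound[OF assms(1)] assms(2) by blast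
  then show ?thesis using finite_imageD[OF _ inj] by blast
qed

context includes cardinal_syntax
begin

lemma lists_length_ordLeq:
  assumes "infinite Y"
  shows "|{xs. set xs \<subseteq> Y \<and> length xs = n}| \<le>o |Y|"
proof (induction n)
  case 0
  have "{xs. set xs \<subseteq> Y \<and> length xs = 0} = {[]}" by auto
  then show ?case using assms by (simp add: card_of_singl_ordLeq infinite_imp_nonempty)
next
  case (Suc n)
  let ?L = "{xs. set xs \<subseteq> Y \<and> length xs = n}"
  have "{xs. set xs \<subseteq> Y \<and> length xs = Suc n} \<subseteq> (\<lambda>(x, xs). x # xs) ` (Y \<times> ?L)"
    by (auto simp: length_Suc_conv image_iff)
  then have "|{xs. set xs \<subseteq> Y \<and> length xs = Suc n}| \<le>o |(\<lambda>(x, xs). x # xs) ` (Y \<times> ?L)|"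
    by (rule card_of_mono1)
  also have "|(\<lambda>(x, xs). x # xs) ` (Y \<times> ?L)| \<le>o |Y \<times> ?L|"
    by (rule card_of_image)
  also have "|Y \<times> ?L| \<le>o |Y|"
    using assms Suc by (intro card_of_Sigma_ordLeq_infinite) (auto intro: card_of_mono1)
  finally show ?case .
qed

text \<open>
  An infinite set has as many finite subsets as elements, so a map from \<open>X\<close> to the finite subsets
  of \<open>Y\<close> with finite fibres bounds the cardinality of \<open>X\<close>.
\<close>

lemma lepoll_finite_fibres:
  fixes T :: "'a \<Rightarrow> 'b set"
  assumes "infinite Y" "\<And>x. x \<in> X \<Longrightarrow> finite (T x)" "\<And>x. x \<in> X \<Longrightarrow> T x \<subseteq> Y"
    and fibre: "\<And>F. finite F \<Longrightarrow> finite {x \<in> X. T x = F}"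
  shows "X \<lesssim> Y"
proof -
  have nat: "|UNIV :: nat set| \<le>o |Y|"
    using assms(1) by (simp add: infinite_iff_card_of_nat)
  have "|\<Union>n\<in>UNIV :: nat set. {xs. set xs \<subseteq> Y \<and> length xs = n}| \<le>o |Y|"
    using assms(1) nat lists_length_ordLeq by (intro card_of_UNION_ordLeq_infinite) auto
  moreover have "(\<Union>n\<in>UNIV :: nat set. {xs. set xs \<subseteq> Y \<and> length xs = n}) = lists Y"
    by (auto simp: lists_eq_set)
  ultimately have lists: "|lists Y| \<le>o |Y|" by simp
  have "|{x \<in> X. T x = set xs}| \<le>o |Y|" for xs
    using finite_lepoll_infinite[OF assms(1) fibre[of "set xs"]]
    by (simp add: lepoll_def flip: card_of_ordLeq)
  then have "|\<Union>xs\<in>lists Y. {x \<in> X. T x = set xs}| \<le>o |Y|"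
    using assms(1) lists by (intro card_of_UNION_ordLeq_infinite) auto
  moreover have "X \<subseteq> (\<Union>xs\<in>lists Y. {x \<in> X. T x = set xs})"
  proof
    fix x assume x: "x \<in> X"
    obtain xs where "set xs = T x" using finite_list[OF assms(2)[OF x]] by blast
    then show "x \<in> (\<Union>xs\<in>lists Y. {x \<in> X. T x = set xs})"
      using x assms(3)[OF x] by (auto simp: lists_eq_set)
  qed
  ultimately have "|X| \<le>o |Y|"
    using card_of_mono1 ordLeq_transitive by blast
  then show ?thesis by (simp add: lepoll_def flip: card_of_ordLeq)
qed

end


section \<open>The Leavitt path algebra of the graph of finite subsets\<close>

context infinite_set
begin

abbreviation L :: "'k::field itself \<Rightarrow> ('k, (('x set, 'x set \<times> 'x set) lpa_generator word \<Rightarrow>\<^sub>0 'k) set) module" where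
  "L _ \<equiv> leavitt_path_algebra (finite_subset_graph X)"

text \<open>
  A fixed isomorphism from the Leavitt path algebra onto \<open>path_ops\<close>.
\<close>

definition realization :: "(('x set, 'x set \<times> 'x set) lpa_generator word \<Rightarrow>\<^sub>0 'k::field) set \<Rightarrow> ('x set list, 'k) op" where
  "realization = (SOME h. bij_betw h (carrier (L TYPE('k))) path_ops \<and>
    (\<forall>x\<in>carrier (L TYPE('k)). \<forall>y\<in>carrier (L TYPE('k)). h (x \<oplus>\<^bsub>L TYPE('k)\<^esub> y) = h x + h y) \<and>
    (\<forall>x\<in>carrier (L TYPE('k)). \<forall>y\<in>carrier (L TYPE('k)). h (x \<otimes>\<^bsub>L TYPE('k)\<^esub> y) = h x * h y))"

lemma realization:
  shows realization_bij: "bij_betw realization (carrier (L TYPE('k::field))) path_ops"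
    and realization_add: "\<And>x y. x \<in> carrier (L TYPE('k)) \<Longrightarrow> y \<in> carrier (L TYPE('k)) \<Longrightarrow>
      realization (x \<oplus>\<^bsub>L TYPE('k)\<^esub> y) = realization x + realization y"
    and realization_mult: "\<And>x y. x \<in> carrier (L TYPE('k)) \<Longrightarrow> y \<in> carrier (L TYPE('k)) \<Longrightarrow>
      realization (x \<otimes>\<^bsub>L TYPE('k)\<^esub> y) = realization x * realization y"
proof -
  obtain h :: "_ \<Rightarrow> ('x set list, 'k) op" where "bij_betw h (carrier (L TYPE('k))) path_ops"
    "\<And>x y. x \<in> carrier (L TYPE('k)) \<Longrightarrow> y \<in> carrier (L TYPE('k)) \<Longrightarrow> h (x \<oplus>\<^bsub>L TYPE('k)\<^esub> y) = h x + h y"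
    "\<And>x y. x \<in> carrier (L TYPE('k)) \<Longrightarrow> y \<in> carrier (L TYPE('k)) \<Longrightarrow> h (x \<otimes>\<^bsub>L TYPE('k)\<^esub> y) = h x * h y"
    by (rule leavitt_path_algebra_embedding, rule that)
  then have "\<exists>h :: _ \<Rightarrow> ('x set list, 'k) op. bij_betw h (carrier (L TYPE('k))) path_ops \<and>
    (\<forall>x\<in>carrier (L TYPE('k)). \<forall>y\<in>carrier (L TYPE('k)). h (x \<oplus>\<^bsub>L TYPE('k)\<^esub> y) = h x + h y) \<and>
    (\<forall>x\<in>carrier (L TYPE('k)). \<forall>y\<in>carrier (L TYPE('k)). h (x \<otimes>\<^bsub>L TYPE('k)\<^esub> y) = h x * h y)"
    by blast
  from someI_ex[OF this, folded realization_def]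
  show "bij_betw realization (carrier (L TYPE('k))) path_ops"
    "\<And>x y. x \<in> carrier (L TYPE('k)) \<Longrightarrow> y \<in> carrier (L TYPE('k)) \<Longrightarrow>
      realization (x \<oplus>\<^bsub>L TYPE('k)\<^esub> y) = realization x + realization y"
    "\<And>x y. x \<in> carrier (L TYPE('k)) \<Longrightarrow> y \<in> carrier (L TYPE('k)) \<Longrightarrow>
      realization (x \<otimes>\<^bsub>L TYPE('k)\<^esub> y) = realization x * realization y"
    by blast+
qed

lemma nonunital_algebra_L: "nonunital_algebra (L TYPE('k::field))"
  by (rule leavitt_path_algebra_nonunital_algebra[OF wf_finite_subset_graph])

lemma nonunital_ring_L: "nonunital_ring (L TYPE('k::field))"
  using nonunital_algebra_L by (rule nonunital_algebra.axioms)

lemma realization_in: "x \<in> carrier (L TYPE('k::field)) \<Longrightarrow> realization x \<in> path_ops"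
  using realization_bij by (auto simp: bij_betw_def)

lemma realization_ex:
  assumes "a \<in> path_ops"
  obtains x where "x \<in> carrier (L TYPE('k::field))" "realization x = a"
proof -
  have "a \<in> realization ` carrier (L TYPE('k))"
    using assms by (simp add: bij_betw_imp_surj_on[OF realization_bij])
  then show thesis using that by blast
qed

lemma realization_inj:
  "x \<in> carrier (L TYPE('k::field)) \<Longrightarrow> y \<in> carrier (L TYPE('k)) \<Longrightarrow> realization x = realization y \<Longrightarrow> x = y"
  using realization_bij[where ?'k = 'k] by (auto simp: bij_betw_def inj_on_def)

lemma realization_zero: "realization \<zero>\<^bsub>L TYPE('k::field)\<^esub> = 0"
proof -
  interpret nonunital_algebra "L TYPE('k)" by (rule nonunital_algebra_L)
  show ?thesis using realization_add[OF zero_closed zero_closed] by simp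
qed

lemma realization_eq_0:
  "x \<in> carrier (L TYPE('k::field)) \<Longrightarrow> realization x = 0 \<longleftrightarrow> x = \<zero>\<^bsub>L TYPE('k)\<^esub>"
proof -
  interpret nonunital_algebra "L TYPE('k)" by (rule nonunital_algebra_L)
  show "x \<in> carrier (L TYPE('k::field)) \<Longrightarrow> realization x = 0 \<longleftrightarrow> x = \<zero>\<^bsub>L TYPE('k)\<^esub>"
    using realization_inj[OF _ zero_closed, of x] realization_zero by auto
qed

lemma von_neumann_regular_L: "von_neumann_regular (L TYPE('k::field))"
  unfolding von_neumann_regular_def
proof
  interpret nonunital_algebra "L TYPE('k)" by (rule nonunital_algebra_L)
  fix a assume a: "a \<in> carrier (L TYPE('k))"
  obtain b where b: "b \<in> path_ops" "realization a = realization a * b * realization a"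
    using path_ops_regular[OF acyclic_finite_subset_graph realization_in[OF a]] by blast
  obtain x where x: "x \<in> carrier (L TYPE('k))" "realization x = b"
    by (rule realization_ex[OF b(1)])
  have "a = a \<otimes>\<^bsub>L TYPE('k)\<^esub> x \<otimes>\<^bsub>L TYPE('k)\<^esub> a"
    using a x b by (intro realization_inj) (simp_all add: realization_mult m_closed)
  then show "\<exists>x\<in>carrier (L TYPE('k)). a = a \<otimes>\<^bsub>L TYPE('k)\<^esub> x \<otimes>\<^bsub>L TYPE('k)\<^esub> a"
    using x by blast
qed

lemma ideal_contains_vertices:
  assumes "two_sided_ideal I (L TYPE('k::field))" "I \<noteq> {\<zero>\<^bsub>L TYPE('k)\<^esub>}"
  obtains A where "A \<in> verts (finite_subset_graph X)"
    "\<And>B e. B \<in> verts (finite_subset_graph X) \<Longrightarrow> A \<subseteq> B \<Longrightarrow> e \<in> carrier (L TYPE('k)) \<Longrightarrow>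
       realization e = swap [B] [B] \<Longrightarrow> e \<in> I"
proof -
  interpret nonunital_algebra "L TYPE('k)" by (rule nonunital_algebra_L)
  interpret I: additive_subgroup I "L TYPE('k)" using assms(1) by (simp add: two_sided_ideal_def)
  obtain a where a: "a \<in> I" "a \<noteq> \<zero>\<^bsub>L TYPE('k)\<^esub>"
    using assms(2) I.zero_closed by blast
  have ac: "a \<in> carrier (L TYPE('k))" using a(1) by (rule I.a_Hcarr)
  obtain A where A: "A \<in> verts (finite_subset_graph X)"
    "\<And>B. B \<in> verts (finite_subset_graph X) \<Longrightarrow> A \<subseteq> B \<Longrightarrow>
       \<exists>x\<in>path_ops. \<exists>y\<in>path_ops. x * realization a * y = swap [B] [B]"
    using swap_corner_in_path_ops[OF realization_in[OF ac]] a(2) realization_eq_0[OF ac] by blast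
  show thesis
  proof (rule that[OF A(1)])
    fix B e assume B: "B \<in> verts (finite_subset_graph X)" "A \<subseteq> B"
      and e: "e \<in> carrier (L TYPE('k))" "realization e = swap [B] [B]"
    obtain s t where st: "s \<in> path_ops" "t \<in> path_ops" "s * realization a * t = swap [B] [B]"
      using A(2)[OF B] by blast
    obtain x where x: "x \<in> carrier (L TYPE('k))" "realization x = s" by (rule realization_ex[OF st(1)])
    obtain y where y: "y \<in> carrier (L TYPE('k))" "realization y = t" by (rule realization_ex[OF st(2)])
    have "e = x \<otimes>\<^bsub>L TYPE('k)\<^esub> a \<otimes>\<^bsub>L TYPE('k)\<^esub> y"
      using ac x y e st(3) by (intro realization_inj) (simp_all add: realization_mult m_closed)
    then show "e \<in> I" using assms(1) a(1) x(1) y(1) by (simp add: two_sided_ideal_def)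
  qed
qed

lemma prime_ring_L: "prime_ring (L TYPE('k::field))"
  unfolding prime_ring_def
proof (intro allI impI, elim conjE)
  interpret nonunital_algebra "L TYPE('k)" by (rule nonunital_algebra_L)
  fix I J assume IJ: "two_sided_ideal I (L TYPE('k))" "I \<noteq> {\<zero>\<^bsub>L TYPE('k)\<^esub>}"
    "two_sided_ideal J (L TYPE('k))" "J \<noteq> {\<zero>\<^bsub>L TYPE('k)\<^esub>}"
  obtain A where A: "A \<in> verts (finite_subset_graph X)"
    "\<And>B e. B \<in> verts (finite_subset_graph X) \<Longrightarrow> A \<subseteq> B \<Longrightarrow> e \<in> carrier (L TYPE('k)) \<Longrightarrow>
       realization e = swap [B] [B] \<Longrightarrow> e \<in> I"
    using ideal_contains_vertices[OF IJ(1,2)] by blast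
  obtain A' where A': "A' \<in> verts (finite_subset_graph X)"
    "\<And>B e. B \<in> verts (finite_subset_graph X) \<Longrightarrow> A' \<subseteq> B \<Longrightarrow> e \<in> carrier (L TYPE('k)) \<Longrightarrow>
       realization e = swap [B] [B] \<Longrightarrow> e \<in> J"
    using ideal_contains_vertices[OF IJ(3,4)] by blast
  let ?B = "A \<union> A'"
  have B: "?B \<in> verts (finite_subset_graph X)" using A A' by (auto simp: finite_subset_graph_simps)
  have "swap [?B] [?B] \<in> (path_ops :: ('x set list, 'k) op set)"
    using B by (intro swap_in_path_ops) (simp add: path_pairs_def path_single)
  then obtain e where e: "e \<in> carrier (L TYPE('k))" "realization e = swap [?B] [?B]"
    by (rule realization_ex)
  have "e \<otimes>\<^bsub>L TYPE('k)\<^esub> e = e"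
    using e by (intro realization_inj) (simp_all add: realization_mult m_closed swap_mult_same)
  moreover have "e \<in> I" "e \<in> J" using A(2)[OF B _ e] A'(2)[OF B _ e] by auto
  ultimately have "e \<in> ideal_prod (L TYPE('k)) I J" by (metis ideal_prod.prod)
  moreover have "e \<noteq> \<zero>\<^bsub>L TYPE('k)\<^esub>"
    using realization_eq_0[OF e(1)] e(2) swap_nonzero by metis
  ultimately show "ideal_prod (L TYPE('k)) I J \<noteq> {\<zero>\<^bsub>L TYPE('k)\<^esub>}" by blast
qed

lemma not_left_primitive_L:
  assumes "uncountable X"
  shows "\<not> left_primitive TYPE('m) (L TYPE('k::field))"
proof
  interpret nonunital_algebra "L TYPE('k)" by (rule nonunital_algebra_L)
  assume "left_primitive TYPE('m) (L TYPE('k))"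
  then obtain M :: "(_, 'm) module" where M: "simple_left_module (L TYPE('k)) M" "faithful_left_module (L TYPE('k)) M"
    by (auto simp: left_primitive_def)
  have LM: "left_module (L TYPE('k)) M" using M(1) by (simp add: simple_left_module_def)
  obtain b m where m: "b \<in> carrier (L TYPE('k))" "m \<in> carrier M" "b \<odot>\<^bsub>M\<^esub> m \<noteq> \<zero>\<^bsub>M\<^esub>"
    using M(1) by (auto simp: simple_left_module_def)
  have m0: "m \<noteq> \<zero>\<^bsub>M\<^esub>" using m left_module_smult_zero(1)[OF LM m(1)] by auto
  have "\<exists>a\<in>carrier (L TYPE('k)). realization a \<in> ops_above x \<and> a \<odot>\<^bsub>M\<^esub> m = m" if x: "x \<in> X" for x
  proof -
    let ?I = "{a \<in> carrier (L TYPE('k)). realization a \<in> ops_above x}"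
    have uminus: "realization (\<ominus>\<^bsub>L TYPE('k)\<^esub> a) = - realization a" if "a \<in> carrier (L TYPE('k))" for a
    proof -
      have "realization (\<ominus>\<^bsub>L TYPE('k)\<^esub> a) + realization a = 0"
        using realization_add[of "\<ominus>\<^bsub>L TYPE('k)\<^esub> a" a] that by (simp add: l_neg realization_zero)
      then show ?thesis by (simp add: eq_neg_iff_add_eq_0)
    qed
    have "additive_subgroup ?I (L TYPE('k))"
    proof (rule additive_subgroup.intro, rule add.subgroupI)
      have "\<zero>\<^bsub>L TYPE('k)\<^esub> \<in> ?I" by (simp add: realization_zero ops_above_def op.span_zero)
      then show "?I \<noteq> {}" by blast
    qed (auto simp: realization_add uminus ops_above_def intro: op.span_add op.span_neg)
    then have ideal: "two_sided_ideal ?I (L TYPE('k))"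
      by (simp add: two_sided_ideal_def m_closed realization_mult realization_in ops_above_ideal)
    have "swap [{x}] [{x}] \<in> (ops_above x :: ('x set list, 'k) op set)"
      using x unfolding ops_above_def
      by (intro op.span_base) (force simp: pairs_above_def path_pairs_def path_single finite_subset_graph_simps)
    moreover from this obtain e where e: "e \<in> carrier (L TYPE('k))" "realization e = swap [{x}] [{x}]"
      using ops_above_subset realization_ex by blast
    ultimately have "e \<in> ?I" by simp
    moreover have "e \<noteq> \<zero>\<^bsub>L TYPE('k)\<^esub>"
      using realization_eq_0[OF e(1)] e(2) swap_nonzero by metis
    ultimately show ?thesis
      using ideal_fixes_vector[OF M ideal _ _ m(2) m0] by blast
  qed
  then obtain a where a: "\<And>x. x \<in> X \<Longrightarrow> a x \<in> carrier (L TYPE('k))"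
    "\<And>x. x \<in> X \<Longrightarrow> realization (a x) \<in> ops_above x" "\<And>x. x \<in> X \<Longrightarrow> a x \<odot>\<^bsub>M\<^esub> m = m"
    by metis
  obtain x y where xy: "x \<in> X" "y \<in> X" "realization (a x) * realization (a y) = 0"
    using ops_above_product_zero[OF assms, of "\<lambda>x. realization (a x)"] a(2) by blast
  then have "a x \<otimes>\<^bsub>L TYPE('k)\<^esub> a y = \<zero>\<^bsub>L TYPE('k)\<^esub>"
    using a(1) by (simp add: realization_mult m_closed flip: realization_eq_0)
  then have "(a x \<otimes>\<^bsub>L TYPE('k)\<^esub> a y) \<odot>\<^bsub>M\<^esub> m = \<zero>\<^bsub>M\<^esub>"
    using left_module_smult_zero(2)[OF LM m(2)] by simp
  moreover have "(a x \<otimes>\<^bsub>L TYPE('k)\<^esub> a y) \<odot>\<^bsub>M\<^esub> m = m"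
    using left_module.act_assoc[OF LM a(1)[OF xy(1)] a(1)[OF xy(2)] m(2)] a(3) xy by simp
  ultimately show False using m0 by simp
qed

end

lemma algebra_isomorphic_sym:
  assumes "nonunital_algebra A" "algebra_isomorphic A B"
  shows "algebra_isomorphic B A"
proof -
  interpret nonunital_algebra A by fact
  obtain f where f: "bij_betw f (carrier A) (carrier B)"
    "\<And>x y. x \<in> carrier A \<Longrightarrow> y \<in> carrier A \<Longrightarrow> f (x \<oplus>\<^bsub>A\<^esub> y) = f x \<oplus>\<^bsub>B\<^esub> f y"
    "\<And>x y. x \<in> carrier A \<Longrightarrow> y \<in> carrier A \<Longrightarrow> f (x \<otimes>\<^bsub>A\<^esub> y) = f x \<otimes>\<^bsub>B\<^esub> f y"
    "\<And>c x. x \<in> carrier A \<Longrightarrow> f (c \<odot>\<^bsub>A\<^esub> x) = c \<odot>\<^bsub>B\<^esub> f x"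
    using assms(2) unfolding algebra_isomorphic_def by blast
  let ?g = "the_inv_into (carrier A) f"
  have g: "bij_betw ?g (carrier B) (carrier A)" using f(1) by (rule bij_betw_the_inv_into)
  have gin: "?g y \<in> carrier A" if "y \<in> carrier B" for y using g that by (auto simp: bij_betw_def)
  have fg: "f (?g y) = y" if "y \<in> carrier B" for y
    using f(1) that by (simp add: f_the_inv_into_f_bij_betw)
  have gf: "?g (f x) = x" if "x \<in> carrier A" for x
    using f(1) that by (simp add: the_inv_into_f_f bij_betw_def)
  show ?thesis
    unfolding algebra_isomorphic_def
  proof (intro exI[of _ ?g] conjI ballI allI g)
    fix x y assume "x \<in> carrier B" "y \<in> carrier B"
    then show "?g (x \<oplus>\<^bsub>B\<^esub> y) = ?g x \<oplus>\<^bsub>A\<^esub> ?g y" "?g (x \<otimes>\<^bsub>B\<^esub> y) = ?g x \<otimes>\<^bsub>A\<^esub> ?g y"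
      using f(2,3)[of "?g x" "?g y"] gf[of "?g x \<oplus>\<^bsub>A\<^esub> ?g y"] gf[of "?g x \<otimes>\<^bsub>A\<^esub> ?g y"]
      by (simp_all add: gin fg m_closed)
  next
    fix c x assume "x \<in> carrier B"
    then show "?g (c \<odot>\<^bsub>B\<^esub> x) = c \<odot>\<^bsub>A\<^esub> ?g x"
      using f(4)[of "?g x" c] gf[of "c \<odot>\<^bsub>A\<^esub> ?g x"] by (simp add: gin fg smult_closed)
  qed
qed

text \<open>
  The vertices \<open>{x}\<close> are orthogonal nonzero idempotents, and so are their images. Each image involves
  only subsets of a finite \<open>T x \<subseteq> Y\<close>, and the elements that involve only subsets of a given finite
  set lie in a finite-dimensional space.
\<close>

lemma isomorphic_imp_lepoll:
  fixes X :: "'x set" and Y :: "'y set"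
  assumes "infinite X" "infinite Y"
    and "algebra_isomorphic (leavitt_path_algebra (finite_subset_graph X) :: ('k::field, _) module)
      (leavitt_path_algebra (finite_subset_graph Y))"
  shows "X \<lesssim> Y"
proof -
  interpret X: infinite_set X by unfold_locales fact
  interpret Y: infinite_set Y by unfold_locales fact
  let ?L = "leavitt_path_algebra (finite_subset_graph X) :: ('k, _) module"
  let ?L' = "leavitt_path_algebra (finite_subset_graph Y) :: ('k, _) module"
  interpret L: nonunital_algebra ?L by (rule X.nonunital_algebra_L)
  interpret L': nonunital_algebra ?L' by (rule Y.nonunital_algebra_L)
  obtain f where f: "bij_betw f (carrier ?L) (carrier ?L')"
    "\<And>x y. x \<in> carrier ?L \<Longrightarrow> y \<in> carrier ?L \<Longrightarrow> f (x \<oplus>\<^bsub>?L\<^esub> y) = f x \<oplus>\<^bsub>?L'\<^esub> f y"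
    "\<And>x y. x \<in> carrier ?L \<Longrightarrow> y \<in> carrier ?L \<Longrightarrow> f (x \<otimes>\<^bsub>?L\<^esub> y) = f x \<otimes>\<^bsub>?L'\<^esub> f y"
    using assms(3) unfolding algebra_isomorphic_def by blast
  have fin: "f x \<in> carrier ?L'" if "x \<in> carrier ?L" for x
    using f(1) that by (auto simp: bij_betw_def)
  have f0: "f \<zero>\<^bsub>?L\<^esub> = \<zero>\<^bsub>?L'\<^esub>"
    using f(2)[of "\<zero>\<^bsub>?L\<^esub>" "\<zero>\<^bsub>?L\<^esub>"] fin[of "\<zero>\<^bsub>?L\<^esub>"] by simp
  have "\<exists>e\<in>carrier ?L. X.realization e = swap [{x}] [{x}]" if "x \<in> X" for x
  proof -
    have "swap [{x}] [{x}] \<in> (X.path_ops :: ('x set list, 'k) op set)"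
      using that by (intro X.swap_in_path_ops) (simp add: X.path_pairs_def X.path_single finite_subset_graph_simps)
    then show ?thesis by (metis X.realization_ex)
  qed
  then obtain e where e: "\<And>x. x \<in> X \<Longrightarrow> e x \<in> carrier ?L"
    "\<And>x. x \<in> X \<Longrightarrow> X.realization (e x) = swap [{x}] [{x}]"
    by metis
  have mult: "e x \<otimes>\<^bsub>?L\<^esub> e y = (if x = y then e x else \<zero>\<^bsub>?L\<^esub>)" if "x \<in> X" "y \<in> X" for x y
  proof (rule X.realization_inj)
    show "X.realization (e x \<otimes>\<^bsub>?L\<^esub> e y) = X.realization (if x = y then e x else \<zero>\<^bsub>?L\<^esub>)"
      using that e by (auto simp: X.realization_mult X.realization_zero swap_mult_same intro!: swap_mult_zero)
  qed (use that e L.m_closed in auto)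
  have ne: "e x \<noteq> \<zero>\<^bsub>?L\<^esub>" if "x \<in> X" for x
    using X.realization_eq_0[OF e(1)[OF that]] e(2)[OF that] swap_nonzero by metis
  define g where "g x = Y.realization (f (e x))" for x
  have gin: "g x \<in> Y.path_ops" if "x \<in> X" for x
    unfolding g_def using that e fin by (intro Y.realization_in) auto
  have gmult: "g x * g y = (if x = y then g x else 0)" if "x \<in> X" "y \<in> X" for x y
    unfolding g_def using that e fin mult[OF that]
    by (simp flip: Y.realization_mult f(3)) (simp add: f0 Y.realization_zero)
  have gne: "g x \<noteq> 0" if "x \<in> X" for x
  proof
    assume "g x = 0"
    then have "f (e x) = f \<zero>\<^bsub>?L\<^esub>"
      unfolding g_def using that e fin Y.realization_eq_0 f0 by metis
    then show False using f(1) ne[OF that] e(1)[OF that] L.zero_closed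
      by (auto simp: bij_betw_def inj_on_def)
  qed
  have "\<exists>T. finite T \<and> T \<subseteq> Y \<and> g x \<in> op.span ((\<lambda>(\<alpha>, \<beta>). swap \<alpha> \<beta>) ` Y.pairs_in (Pow T))" if x: "x \<in> X" for x
  proof -
    obtain S where S: "finite S" "S \<subseteq> verts (finite_subset_graph Y)"
      "g x \<in> op.span ((\<lambda>(\<alpha>, \<beta>). swap \<alpha> \<beta>) ` Y.pairs_in S)"
      by (rule Y.path_ops_local[OF gin[OF x]])
    have "Y.pairs_in S \<subseteq> Y.pairs_in (Pow (\<Union>S))"
      by (auto simp: Y.pairs_in_def Y.paths_in_def)
    then have "g x \<in> op.span ((\<lambda>(\<alpha>, \<beta>). swap \<alpha> \<beta>) ` Y.pairs_in (Pow (\<Union>S)))"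
      using S(3) op.span_mono[OF image_mono] by blast
    moreover have "finite (\<Union>S)" "\<Union>S \<subseteq> Y" using S by (auto simp: finite_subset_graph_simps)
    ultimately show ?thesis by blast
  qed
  then obtain T where T: "\<And>x. x \<in> X \<Longrightarrow> finite (T x)" "\<And>x. x \<in> X \<Longrightarrow> T x \<subseteq> Y"
    "\<And>x. x \<in> X \<Longrightarrow> g x \<in> op.span ((\<lambda>(\<alpha>, \<beta>). swap \<alpha> \<beta>) ` Y.pairs_in (Pow (T x)))"
    by metis
  have "finite {x \<in> X. T x = F}" if F: "finite F" for F
  proof (rule finite_orthogonal_idempotents[where e = g])
    show "finite ((\<lambda>(\<alpha>, \<beta>). swap \<alpha> \<beta> :: ('y set list, 'k) op) ` Y.pairs_in (Pow F))"
      by (intro finite_imageI Y.finite_pairs_in acyclic_finite_subset_graph) (simp add: F)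
  qed (use T(3) gne gmult in auto)
  then show ?thesis by (intro lepoll_finite_fibres[of Y X T] assms T)
qed

theorem theorem5p3:
  shows
   "(\<forall>X :: 'x set. uncountable X \<longrightarrow>
      (let L = (leavitt_path_algebra (finite_subset_graph X) :: ('k::field, _) module)
       in nonunital_ring L \<and> prime_ring L \<and> \<not> left_primitive TYPE('m) L \<and>
          von_neumann_regular L)) \<and>
    (\<forall>(\<A> :: 'i set) (X :: 'i \<Rightarrow> 'y set).
      (\<forall>\<alpha>\<in>\<A>. uncountable (X \<alpha>)) \<and>
      (\<forall>\<alpha>\<in>\<A>. \<forall>\<beta>\<in>\<A>. \<alpha> \<noteq> \<beta> \<longrightarrow> \<not> X \<alpha> \<approx> X \<beta>) \<longrightarrow>
      (let L = (\<lambda>\<alpha>. leavitt_path_algebra (finite_subset_graph (X \<alpha>)) :: (complex, _) module)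
       in (\<forall>\<alpha>\<in>\<A>. nonunital_algebra (L \<alpha>) \<and> prime_ring (L \<alpha>) \<and>
              \<not> left_primitive TYPE('n) (L \<alpha>) \<and> von_neumann_regular (L \<alpha>)) \<and>
          (\<forall>\<alpha>\<in>\<A>. \<forall>\<beta>\<in>\<A>. \<alpha> \<noteq> \<beta> \<longrightarrow> \<not> algebra_isomorphic (L \<alpha>) (L \<beta>))))"
proof (intro conjI allI impI; unfold Let_def)
  fix X :: "'x set" assume X: "uncountable X"
  then interpret infinite_set X by unfold_locales (auto dest: countable_finite)
  show "nonunital_ring (L TYPE('k)) \<and> prime_ring (L TYPE('k)) \<and>
      \<not> left_primitive TYPE('m) (L TYPE('k)) \<and> von_neumann_regular (L TYPE('k))"
    by (simp add: nonunital_ring_L prime_ring_L not_left_primitive_L[OF X] von_neumann_regular_L)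
next
  fix \<A> :: "'i set" and X :: "'i \<Rightarrow> 'y set"
  assume X: "(\<forall>\<alpha>\<in>\<A>. uncountable (X \<alpha>)) \<and> (\<forall>\<alpha>\<in>\<A>. \<forall>\<beta>\<in>\<A>. \<alpha> \<noteq> \<beta> \<longrightarrow> \<not> X \<alpha> \<approx> X \<beta>)"
  let ?L = "\<lambda>\<alpha>. leavitt_path_algebra (finite_subset_graph (X \<alpha>)) :: (complex, _) module"
  have inf: "infinite (X \<alpha>)" if "\<alpha> \<in> \<A>" for \<alpha> using X that countable_finite by blast
  show "(\<forall>\<alpha>\<in>\<A>. nonunital_algebra (?L \<alpha>) \<and> prime_ring (?L \<alpha>) \<and>
              \<not> left_primitive TYPE('n) (?L \<alpha>) \<and> von_neumann_regular (?L \<alpha>)) \<and>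
          (\<forall>\<alpha>\<in>\<A>. \<forall>\<beta>\<in>\<A>. \<alpha> \<noteq> \<beta> \<longrightarrow> \<not> algebra_isomorphic (?L \<alpha>) (?L \<beta>))"
  proof (intro conjI[of "\<forall>\<alpha>\<in>\<A>. _ \<alpha>"] ballI impI)
    fix \<alpha> assume \<alpha>: "\<alpha> \<in> \<A>"
    then interpret infinite_set "X \<alpha>" by unfold_locales (rule inf)
    show "nonunital_algebra (?L \<alpha>) \<and> prime_ring (?L \<alpha>) \<and>
              \<not> left_primitive TYPE('n) (?L \<alpha>) \<and> von_neumann_regular (?L \<alpha>)"
      using X \<alpha> by (simp add: nonunital_algebra_L prime_ring_L not_left_primitive_L von_neumann_regular_L)
  next
    fix \<alpha> \<beta> assume \<alpha>\<beta>: "\<alpha> \<in> \<A>" "\<beta> \<in> \<A>" "\<alpha> \<noteq> \<beta>"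
    show "\<not> algebra_isomorphic (?L \<alpha>) (?L \<beta>)"
    proof
      assume iso: "algebra_isomorphic (?L \<alpha>) (?L \<beta>)"
      have "algebra_isomorphic (?L \<beta>) (?L \<alpha>)"
        by (rule algebra_isomorphic_sym[OF leavitt_path_algebra_nonunital_algebra[OF wf_finite_subset_graph] iso])
      with iso have "X \<alpha> \<lesssim> X \<beta>" "X \<beta> \<lesssim> X \<alpha>"
        using inf \<alpha>\<beta> by (blast intro: isomorphic_imp_lepoll)+
      then show False using X \<alpha>\<beta> lepoll_antisym by blast
    qed
  qed
qed

end
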